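(* Let $L$ be a nondegenerate even lattice and let $\epsilon$ be a normalized $\mathbb{C}^{\times}$-valued $2$-cocycle of $L$. Then $$E^{+}(-\alpha,x)x^{\alpha(0)}\in\mathrm{PEnd}^{-}(B_{L,\epsilon})\quad\text{for }\alpha\in L.$$ Furthermore, there exists a unique $B_L$-module structure $Y_M$ on $B_{L,\epsilon}$ such that $$Y_M(e^{\alpha},x)=E^{+}(-\alpha,x)x^{\alpha(0)}\quad\text{for }\alpha\in L,$$ and $B_{L,\epsilon}$ equipped with this $B_L$-module structure $Y_M$ is a $B_L$-module nonlocal vertex algebra.
   Context: All vector spaces are over $\mathbb{C}$; $(x_1\pm x_2)^n$ is expanded in nonnegative powers of the second variable. A nonlocal vertex algebra is a vector space $V$ with a linear map $Y(\cdot,x):V\to\mathrm{Hom}(V,V((x)))$ and a vacuum $\mathbf{1}$ such that $Y(\mathbf{1},x)=1$; $Y(v,x)\mathbf{1}\in V[[x]]$ with constant term $v$; and for all $u,v,w\in V$ there is $l\ge0$ with $(x_0+x_2)^lY(u,x_0+x_2)Y(v,x_2)w=(x_0+x_2)^lY(Y(u,x_0)v,x_2)w$. A module $(W,Y_W)$ for $V$ satisfies $Y_W:V\to\mathrm{Hom}(W,W((x)))$ linear, $Y_W(\mathbf{1},x)=1_W$, and for all $u,v\in V,w\in W$ there is $l\ge0$ with $(x_0+x_2)^lY_W(u,x_0+x_2)Y_W(v,x_2)w=(x_0+x_2)^lY_W(Y(u,x_0)v,x_2)w$. For a unital associative algebra $A$ with derivation $\partial$, $(A,\partial)$ is the nonlocal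 vertex algebra with vacuum $1$ and $Y(a,x)b=(e^{x\partial}a)b$. $\mathrm{PEnd}^{-}(V)$ is the set of $\phi(x)\in\mathrm{Hom}_{\mathbb{C}}(V,V\otimes\mathbb{C}((x)))$ with $\phi(x)\mathbf{1}=\mathbf{1}$ and $\phi(x_1)Y(v,x_2)=Y(\phi(x_1-x_2)v,x_2)\phi(x_1)$ for all $v\in V$. A vertex bialgebra is a nonlocal vertex algebra $H$ with a coalgebra structure such that $\Delta:H\to H\otimes H$ and $\varepsilon:H\to\mathbb{C}$ are homomorphisms of nonlocal vertex algebras. An $H$-module nonlocal vertex algebra is a nonlocal vertex algebra $V$ with an $H$-module structure $Y_M$ such that for $h\in H$, $u,v\in V$: $Y_M(h,x)v\in V\otimes\mathbb{C}((x))$, $Y_M(h,x)\mathbf{1}_V=\varepsilon(h)\mathbf{1}_V$, and $Y_M(h,x_1)Y(u,x_2)v=\sum Y(Y_M(h_{(1)},x_1-x_2)u,x_2)Y_M(h_{(2)},x_1)v$, with $\Delta(h)=\sum h_{(1)}\otimes h_{(2)}$. Lattice data: $L$ is a free abelian group of finite rank with a nondegenerate symmetric $\mathbb{Z}$-bilinear form $\langle\cdot,\cdot\rangle:L\times L\to\mathbb{Z}$ with $\langle\alpha,\alpha\rangle\in2\mathbb{Z}$; $\mathbf{h}=\mathbb{C}\otimes_{\mathbb{Z}}L$ with the extended form. $\epsilon:L\times L\to\mathbb{C}^{\times}$ satisfies $\epsilon(\alpha,0)=\epsilon(0,\alpha)=1$ and $\epsilon(\alpha,\beta+\gamma)\epsilon(\beta,\gamma)=\epsilon(\alpha+\beta,\gamma)\epsilon(\alpha,\beta)$.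 $\hat{\mathbf{h}}^{-}=\mathbf{h}\otimes t^{-1}\mathbb{C}[t^{-1}]$, $h(n)=h\otimes t^n$; $B_{\mathbf{h}}=S(\hat{\mathbf{h}}^{-})$, a bialgebra with elements of $\hat{\mathbf{h}}^-$ primitive, with the derivation $L(-1)$ given by $L(-1)h(-n)=nh(-n-1)$, $n\ge1$. On $B_{\mathbf{h}}$, for $h\in\mathbf{h}$: $h(n)$ with $n<0$ acts by multiplication, and for $n\ge1$, $h(n)$ is the derivation with $h(n)\beta(-m)=n\langle h,\beta\rangle\delta_{n,m}$ ($\beta\in\mathbf{h}$, $m\ge1$). $\mathbb{C}_{\epsilon}[L]$ has basis $\{e_\alpha\}_{\alpha\in L}$ and product $e_\alpha e_\beta=\epsilon(\alpha,\beta)e_{\alpha+\beta}$. $B_{L,\epsilon}=\mathbb{C}_{\epsilon}[L]\otimes B_{\mathbf{h}}$ (associative algebra) with derivation $L(-1)(e_\alpha\otimes u)=e_\alpha\otimes\alpha(-1)u+e_\alpha\otimes L(-1)u$; it is regarded as the nonlocal vertex algebra $(B_{L,\epsilon},L(-1))$. $B_L=\mathbb{C}[L]\otimes B_{\mathbf{h}}$ is the case of trivial $\epsilon$, with basis elements of the group algebra written $e^{\alpha}$; it is a Hopf algebra ($e^{\alpha}$ group-like, elements of $\hat{\mathbf{h}}^-$ primitive), and with $L(-1)$ it is a vertex bialgebra $(B_L,L(-1))$. Operators on $B_{L,\epsilon}$: $h(n)(e_\alpha\otimes u)=e_\alpha\otimes h(n)u$ for $n\neq0$, $h(0)(e_\alpha\otimes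 u)=\langle h,\alpha\rangle e_\alpha\otimes u$. $E^{+}(-\alpha,x)=\exp\left(\sum_{n\ge1}\frac{-\alpha(n)}{n}x^{-n}\right)$, and $x^{\alpha(0)}$ acts on $e_\beta\otimes u$ as $x^{\langle\alpha,\beta\rangle}$. *)

theory Defs
  imports
    Complex_Main
    "HOL-Library.Poly_Mapping"
    "HOL-Computational_Algebra.Formal_Laurent_Series"
    "HOL-Algebra.Free_Abelian_Groups"
begin

unbundle fps_syntax

section \<open>Complex vector spaces\<close>

class complex_vector = ab_group_add +
  fixes scaleC :: "complex \<Rightarrow> 'a \<Rightarrow> 'a" (infixr "*\<^sub>C" 75)
  assumes scaleC_add_right: "a *\<^sub>C (x + y) = a *\<^sub>C x + a *\<^sub>C y"
    and scaleC_add_left: "(a + b) *\<^sub>C x = a *\<^sub>C x + b *\<^sub>C x"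
    and scaleC_scaleC: "a *\<^sub>C b *\<^sub>C x = (a * b) *\<^sub>C x"
    and scaleC_one: "1 *\<^sub>C x = x"

global_interpretation complex_vector: vector_space "scaleC :: complex \<Rightarrow> 'a \<Rightarrow> 'a::complex_vector"
  by standard (simp_all add: scaleC_add_right scaleC_add_left scaleC_scaleC scaleC_one)

abbreviation clinear :: "('a::complex_vector \<Rightarrow> 'b::complex_vector) \<Rightarrow> bool" where
  "clinear \<equiv> Vector_Spaces.linear scaleC scaleC"

definition cbilinear ::
  "('a::complex_vector \<Rightarrow> 'b::complex_vector \<Rightarrow> 'c::complex_vector) \<Rightarrow> bool" where
  "cbilinear f \<longleftrightarrow> (\<forall>a. clinear (f a)) \<and> (\<forall>b. clinear (\<lambda>a. f a b))"

abbreviation cspan :: "'a::complex_vector set \<Rightarrow> 'a set" where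
  "cspan \<equiv> module.span scaleC"

instantiation complex :: complex_vector
begin
definition scaleC_complex :: "complex \<Rightarrow> complex \<Rightarrow> complex" where
  "scaleC_complex = (*)"
instance by standard (simp_all add: scaleC_complex_def algebra_simps)
end

instantiation poly_mapping :: (type, complex_vector) complex_vector
begin
lift_definition scaleC_poly_mapping :: "complex \<Rightarrow> ('a \<Rightarrow>\<^sub>0 'b) \<Rightarrow> 'a \<Rightarrow>\<^sub>0 'b"
  is "\<lambda>c f x. c *\<^sub>C f x"
  by (erule rev_finite_subset) auto
instance
  by standard (transfer, simp add: fun_eq_iff scaleC_add_right scaleC_add_left scaleC_scaleC scaleC_one)+
end

instantiation fls :: (complex_vector) complex_vector
begin
lift_definition scaleC_fls :: "complex \<Rightarrow> 'a fls \<Rightarrow> 'a fls"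
  is "\<lambda>c f n. c *\<^sub>C f n"
  by (erule MOST_mono) simp
instance
  by standard (transfer, simp add: fun_eq_iff scaleC_add_right scaleC_add_left scaleC_scaleC scaleC_one)+
end

lemma span_cong:
  fixes scale :: "'a::comm_ring_1 \<Rightarrow> 'b::ab_group_add \<Rightarrow> 'b"
  assumes "Modules.module scale"
  shows equivp_span_cong: "equivp (\<lambda>p q. p - q \<in> module.span scale S)"
    and span_cong_add: "p - p' \<in> module.span scale S \<Longrightarrow> q - q' \<in> module.span scale S \<Longrightarrow>
      (p + q) - (p' + q') \<in> module.span scale S"
    and span_cong_diff: "p - p' \<in> module.span scale S \<Longrightarrow> q - q' \<in> module.span scale S \<Longrightarrow>
      (p - q) - (p' - q') \<in> module.span scale S"
    and span_cong_minus: "p - p' \<in> module.span scale S \<Longrightarrow> - p - (- p') \<in> module.span scale S"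
    and span_cong_scale: "p - p' \<in> module.span scale S \<Longrightarrow> scale c p - scale c p' \<in> module.span scale S"
proof -
  interpret Modules.module scale by fact
  have rewr: "(p + q) - (p' + q') = (p - p') + (q - q')"
    "(p - q) - (p' - q') = (p - p') - (q - q')"
    "- p - (- p') = - (p - p')" for p q p' q' :: 'b
    by (simp_all add: algebra_simps)
  show "equivp (\<lambda>p q. p - q \<in> span S)"
  proof (rule equivpI)
    show "reflp (\<lambda>p q. p - q \<in> span S)"
      by (simp add: reflp_def span_zero)
    show "symp (\<lambda>p q. p - q \<in> span S)"
    proof (rule sympI)
      fix p q assume "p - q \<in> span S"
      from span_neg [OF this] show "q - p \<in> span S" by simp
    qed
    show "transp (\<lambda>p q. p - q \<in> span S)"
    proof (rule transpI)
      fix p q r assume "p - q \<in> span S" "q - r \<in> span S"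
      from span_add [OF this] show "p - r \<in> span S" by simp
    qed
  qed
  show "p - p' \<in> span S \<Longrightarrow> q - q' \<in> span S \<Longrightarrow> (p + q) - (p' + q') \<in> span S"
    unfolding rewr by (rule span_add)
  show "p - p' \<in> span S \<Longrightarrow> q - q' \<in> span S \<Longrightarrow> (p - q) - (p' - q') \<in> span S"
    unfolding rewr by (rule span_diff)
  show "p - p' \<in> span S \<Longrightarrow> - p - (- p') \<in> span S"
    unfolding rewr by (rule span_neg)
  show "p - p' \<in> span S \<Longrightarrow> scale c p - scale c p' \<in> span S"
    unfolding scale_right_diff_distrib [symmetric] by (rule span_scale)
qed

lemmas cspan_cong = span_cong [OF complex_vector.module_axioms]


section \<open>Tensor products of complex vector spaces\<close>

definition tensor_relators ::
  "(('a::complex_vector \<times> 'b::complex_vector) \<Rightarrow>\<^sub>0 complex) set" where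
  "tensor_relators =
     {Poly_Mapping.single (a + a', b) 1 - Poly_Mapping.single (a, b) 1
        - Poly_Mapping.single (a', b) 1 | a a' b. True} \<union>
     {Poly_Mapping.single (a, b + b') 1 - Poly_Mapping.single (a, b) 1
        - Poly_Mapping.single (a, b') 1 | a b b'. True} \<union>
     {Poly_Mapping.single (c *\<^sub>C a, b) 1 - c *\<^sub>C Poly_Mapping.single (a, b) 1 | a b c. True} \<union>
     {Poly_Mapping.single (a, c *\<^sub>C b) 1 - c *\<^sub>C Poly_Mapping.single (a, b) 1 | a b c. True}"

definition tensor_eq ::
  "(('a::complex_vector \<times> 'b::complex_vector) \<Rightarrow>\<^sub>0 complex) \<Rightarrow> (('a \<times> 'b) \<Rightarrow>\<^sub>0 complex) \<Rightarrow> bool" where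
  "tensor_eq p q \<longleftrightarrow> p - q \<in> cspan tensor_relators"

quotient_type (overloaded) ('a, 'b) tensor =
    "('a::complex_vector \<times> 'b::complex_vector) \<Rightarrow>\<^sub>0 complex" / tensor_eq
  unfolding tensor_eq_def by (rule cspan_cong(1))

instantiation tensor :: (complex_vector, complex_vector) complex_vector
begin
lift_definition zero_tensor :: "('a, 'b) tensor" is 0 .
lift_definition plus_tensor :: "('a, 'b) tensor \<Rightarrow> ('a, 'b) tensor \<Rightarrow> ('a, 'b) tensor" is "(+)"
  unfolding tensor_eq_def by (rule cspan_cong(2))
lift_definition uminus_tensor :: "('a, 'b) tensor \<Rightarrow> ('a, 'b) tensor" is uminus
  unfolding tensor_eq_def by (rule cspan_cong(4))
lift_definition minus_tensor :: "('a, 'b) tensor \<Rightarrow> ('a, 'b) tensor \<Rightarrow> ('a, 'b) tensor" is "(-)"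
  unfolding tensor_eq_def by (rule cspan_cong(3))
lift_definition scaleC_tensor :: "complex \<Rightarrow> ('a, 'b) tensor \<Rightarrow> ('a, 'b) tensor" is scaleC
  unfolding tensor_eq_def by (rule cspan_cong(5))
instance
  by standard (transfer, simp add: tensor_eq_def complex_vector.span_zero add.assoc add.commute
      scaleC_add_right scaleC_add_left scaleC_scaleC scaleC_one)+
end

lift_definition tens ::
  "'a::complex_vector \<Rightarrow> 'b::complex_vector \<Rightarrow> ('a, 'b) tensor" (infixl "\<otimes>\<^sub>C" 73)
  is "\<lambda>a b. Poly_Mapping.single (a, b) 1" .

text \<open>The linear map on the tensor product induced by a bilinear map.  Applied to
  \<open>\<Delta>(h) = \<Sum> h\<^sub>(\<^sub>1\<^sub>) \<otimes> h\<^sub>(\<^sub>2\<^sub>)\<close>, the value \<open>tensor_lift f (\<Delta> h)\<close> is the Sweedler sum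
  \<open>\<Sum> f h\<^sub>(\<^sub>1\<^sub>) h\<^sub>(\<^sub>2\<^sub>)\<close>.\<close>

definition tensor_lift ::
  "('a::complex_vector \<Rightarrow> 'b::complex_vector \<Rightarrow> 'c::complex_vector) \<Rightarrow> ('a, 'b) tensor \<Rightarrow> 'c" where
  "tensor_lift f = (THE g. clinear g \<and> (\<forall>a b. g (a \<otimes>\<^sub>C b) = f a b))"

definition tensor_mult ::
  "('a \<Rightarrow> 'a \<Rightarrow> 'a) \<Rightarrow> ('b \<Rightarrow> 'b \<Rightarrow> 'b) \<Rightarrow>
   ('a::complex_vector, 'b::complex_vector) tensor \<Rightarrow> ('a, 'b) tensor \<Rightarrow> ('a, 'b) tensor" where
  "tensor_mult m m' s t =
     tensor_lift (\<lambda>a b. tensor_lift (\<lambda>c d. m a c \<otimes>\<^sub>C m' b d) t) s"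


section \<open>Symmetric algebras\<close>

text \<open>The symmetric algebra of \<open>'v\<close> is the polynomial ring on the underlying set of \<open>'v\<close>
  modulo the ideal that makes the inclusion of generators linear.  Here
  \<open>module.span (*)\<close> is the ideal generated by a set.\<close>

definition sym_gen :: "'v \<Rightarrow> ('v \<Rightarrow>\<^sub>0 nat) \<Rightarrow>\<^sub>0 complex" where
  "sym_gen v = Poly_Mapping.single (Poly_Mapping.single v 1) 1"

definition sym_relators :: "(('v::complex_vector \<Rightarrow>\<^sub>0 nat) \<Rightarrow>\<^sub>0 complex) set" where
  "sym_relators =
     {sym_gen (u + v) - sym_gen u - sym_gen v | u v. True} \<union>
     {sym_gen (c *\<^sub>C v) - c *\<^sub>C sym_gen v | c v. True}"

definition sym_eq ::
  "(('v::complex_vector \<Rightarrow>\<^sub>0 nat) \<Rightarrow>\<^sub>0 complex) \<Rightarrow> (('v \<Rightarrow>\<^sub>0 nat) \<Rightarrow>\<^sub>0 complex) \<Rightarrow> bool" where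
  "sym_eq p q \<longleftrightarrow> p - q \<in> module.span (*) sym_relators"

lemma module_mult: "Modules.module ((*) :: 'a::comm_ring_1 \<Rightarrow> 'a \<Rightarrow> 'a)"
  by standard (simp_all add: algebra_simps)

lemmas ideal_zero = module.span_zero [OF module_mult]
lemmas ideal_cong = span_cong [OF module_mult]

lemma scaleC_eq_single_times:
  fixes p :: "('v \<Rightarrow>\<^sub>0 nat) \<Rightarrow>\<^sub>0 complex"
  shows "c *\<^sub>C p = Poly_Mapping.single 0 c * p"
proof -
  have "c *\<^sub>C p = Poly_Mapping.map ((*) c) p"
    by (rule poly_mapping_eqI)
      (simp add: scaleC_poly_mapping.rep_eq scaleC_complex_def Poly_Mapping.map.rep_eq when_def)
  then show ?thesis by (simp add: mult_map_scale_conv_mult)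
qed

quotient_type (overloaded) 'v sym =
    "('v::complex_vector \<Rightarrow>\<^sub>0 nat) \<Rightarrow>\<^sub>0 complex" / sym_eq
  unfolding sym_eq_def by (rule ideal_cong(1))

lemma lookup_zero_times:
  fixes p q :: "('v \<Rightarrow>\<^sub>0 nat) \<Rightarrow>\<^sub>0 complex"
  shows "Poly_Mapping.lookup (p * q) 0 = Poly_Mapping.lookup p 0 * Poly_Mapping.lookup q 0"
proof -
  have zero_iff: "0 = k + l \<longleftrightarrow> k = 0 \<and> l = 0" for k l :: "'v \<Rightarrow>\<^sub>0 nat"
    by (auto simp: poly_mapping_eq_iff lookup_add fun_eq_iff)
  have inner: "(\<Sum>l. Poly_Mapping.lookup q l when k = 0 \<and> l = 0) = (Poly_Mapping.lookup q 0 when k = 0)" for k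
    by (cases "k = 0") simp_all
  show ?thesis
    by (simp add: lookup_mult zero_iff inner mult_when)
qed

lemma sym_one_neq_zero: "\<not> sym_eq 0 (1 :: ('v::complex_vector \<Rightarrow>\<^sub>0 nat) \<Rightarrow>\<^sub>0 complex)"
proof
  assume "sym_eq 0 (1 :: ('v \<Rightarrow>\<^sub>0 nat) \<Rightarrow>\<^sub>0 complex)"
  then have one_mem: "1 \<in> module.span (*) (sym_relators :: (('v \<Rightarrow>\<^sub>0 nat) \<Rightarrow>\<^sub>0 complex) set)"
    unfolding sym_eq_def using module.span_neg [OF module_mult] by fastforce
  have sub: "module.subspace (*) {p :: ('v \<Rightarrow>\<^sub>0 nat) \<Rightarrow>\<^sub>0 complex. Poly_Mapping.lookup p 0 = 0}"
    by (rule module.subspaceI [OF module_mult]) (simp_all add: lookup_add lookup_zero_times)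
  have gen0: "Poly_Mapping.lookup (sym_gen v) 0 = 0" for v :: 'v
    unfolding sym_gen_def lookup_single
    by (metis lookup_single_eq lookup_zero when_simps(2) zero_neq_one)
  have "sym_relators \<subseteq> {p :: ('v \<Rightarrow>\<^sub>0 nat) \<Rightarrow>\<^sub>0 complex. Poly_Mapping.lookup p 0 = 0}"
    by (auto simp: sym_relators_def lookup_minus gen0 scaleC_poly_mapping.rep_eq)
  then have "(1 :: ('v \<Rightarrow>\<^sub>0 nat) \<Rightarrow>\<^sub>0 complex) \<in> {p. Poly_Mapping.lookup p 0 = 0}"
    using module.span_minimal [OF module_mult _ sub] one_mem by blast
  then show False by simp
qed

instantiation sym :: (complex_vector) "{complex_vector, comm_ring_1}"
begin
lift_definition zero_sym :: "'a sym" is 0 .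
lift_definition one_sym :: "'a sym" is 1 .
lift_definition plus_sym :: "'a sym \<Rightarrow> 'a sym \<Rightarrow> 'a sym" is "(+)"
  unfolding sym_eq_def by (rule ideal_cong(2))
lift_definition uminus_sym :: "'a sym \<Rightarrow> 'a sym" is uminus
  unfolding sym_eq_def by (rule ideal_cong(4))
lift_definition minus_sym :: "'a sym \<Rightarrow> 'a sym \<Rightarrow> 'a sym" is "(-)"
  unfolding sym_eq_def by (rule ideal_cong(3))
lift_definition scaleC_sym :: "complex \<Rightarrow> 'a sym \<Rightarrow> 'a sym" is scaleC
  unfolding sym_eq_def scaleC_eq_single_times by (rule ideal_cong(5))
lift_definition times_sym :: "'a sym \<Rightarrow> 'a sym \<Rightarrow> 'a sym" is "(*)"
proof -
  fix p p' q q' :: "('a \<Rightarrow>\<^sub>0 nat) \<Rightarrow>\<^sub>0 complex"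
  assume "sym_eq p p'" "sym_eq q q'"
  then have "q * (p - p') + p' * (q - q') \<in> module.span (*) sym_relators"
    unfolding sym_eq_def
    by (intro module.span_add [OF module_mult] module.span_scale [OF module_mult])
  moreover have "q * (p - p') + p' * (q - q') = p * q - p' * q'"
    by (simp add: algebra_simps)
  ultimately show "sym_eq (p * q) (p' * q')"
    unfolding sym_eq_def by simp
qed
instance
proof
  fix a b c :: "'a sym" and r s :: complex
  have eqI: "p = q \<Longrightarrow> sym_eq p q" for p q :: "('a \<Rightarrow>\<^sub>0 nat) \<Rightarrow>\<^sub>0 complex"
    by (simp add: sym_eq_def ideal_zero)
  show "a + b + c = a + (b + c)" by transfer (rule eqI, simp add: add.assoc)
  show "a + b = b + a" by transfer (rule eqI, simp add: add.commute)
  show "0 + a = a" by transfer (rule eqI, simp)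
  show "- a + a = 0" by transfer (rule eqI, simp)
  show "a - b = a + - b" by transfer (rule eqI, simp)
  show "r *\<^sub>C (a + b) = r *\<^sub>C a + r *\<^sub>C b" by transfer (rule eqI, simp add: scaleC_add_right)
  show "(r + s) *\<^sub>C a = r *\<^sub>C a + s *\<^sub>C a" by transfer (rule eqI, simp add: scaleC_add_left)
  show "r *\<^sub>C s *\<^sub>C a = (r * s) *\<^sub>C a" by transfer (rule eqI, simp add: scaleC_scaleC)
  show "1 *\<^sub>C a = a" by transfer (rule eqI, simp add: scaleC_one)
  show "a * b * c = a * (b * c)" by transfer (rule eqI, simp add: mult.assoc)
  show "a * b = b * a" by transfer (rule eqI, simp add: mult.commute)
  show "1 * a = a" by transfer (rule eqI, simp)
  show "(a + b) * c = a * c + b * c" by transfer (rule eqI, simp add: distrib_right)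
  show "(0 :: 'a sym) \<noteq> 1" by transfer (rule sym_one_neq_zero)
qed
end

lift_definition sym_inc :: "'v::complex_vector \<Rightarrow> 'v sym" is sym_gen .

definition sym_derivation :: "('v::complex_vector sym \<Rightarrow> 'v sym) \<Rightarrow> bool" where
  "sym_derivation D \<longleftrightarrow> clinear D \<and> (\<forall>a b. D (a * b) = D a * b + a * D b)"


section \<open>Nonlocal vertex algebras\<close>

text \<open>A linear map \<open>Y : V \<rightarrow> Hom(W, W((x)))\<close> is a function \<open>Y :: 'v \<Rightarrow> 'w \<Rightarrow> 'w fls\<close>,
  and \<open>Y u w $$ n\<close> is the coefficient of \<open>x\<^sup>n\<close> in \<open>Y(u,x)w\<close> (not of \<open>x\<^sup>-\<^sup>n\<^sup>-\<^sup>1\<close>).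
  Formal series in two variables are functions of the two exponents.  Every sum
  \<open>Sum_any\<close> below has finite support whenever the operators involved are of the type just described
  (for \<open>twisted_coeff\<close>: whenever moreover \<open>f\<close> and \<open>g\<close> lie in \<open>V \<otimes> \<complex>((x))\<close>).\<close>

text \<open>The coefficient of \<open>x\<^sub>0\<^sup>a x\<^sub>2\<^sup>b\<close> in \<open>Y\<^sub>W(u, x\<^sub>0 + x\<^sub>2) Y\<^sub>W(v, x\<^sub>2) w\<close>: only
  the term \<open>x\<^sup>n\<close>, \<open>n = a + k\<close>, of \<open>Y\<^sub>W(u,x)\<close> contributes to \<open>x\<^sub>0\<^sup>a x\<^sub>2\<^sup>k\<close>, with coefficient
  \<open>(a + k) gchoose k\<close>.\<close>

definition iterate_shifted ::
  "('v \<Rightarrow> 'w::complex_vector \<Rightarrow> 'w fls) \<Rightarrow> 'v \<Rightarrow> 'v \<Rightarrow> 'w \<Rightarrow> int \<Rightarrow> int \<Rightarrow> 'w" where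
  "iterate_shifted YW u v w a b =
     Sum_any (\<lambda>k::nat.
       (of_int (a + int k) gchoose k) *\<^sub>C (YW u (YW v w $$ (b - int k)) $$ (a + int k)))"

text \<open>The coefficient of \<open>x\<^sub>0\<^sup>a x\<^sub>2\<^sup>b\<close> in \<open>Y\<^sub>W(Y(u, x\<^sub>0) v, x\<^sub>2) w\<close>.\<close>

definition iterate_nested ::
  "('v::zero \<Rightarrow> 'v \<Rightarrow> 'v fls) \<Rightarrow> ('v \<Rightarrow> 'w::zero \<Rightarrow> 'w fls) \<Rightarrow> 'v \<Rightarrow> 'v \<Rightarrow> 'w \<Rightarrow> int \<Rightarrow> int \<Rightarrow> 'w" where
  "iterate_nested Y YW u v w a b = YW (Y u v $$ a) w $$ b"

text \<open>Multiplication of a series in \<open>x\<^sub>0, x\<^sub>2\<close> by \<open>(x\<^sub>0 + x\<^sub>2)\<^sup>l\<close>.\<close>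

definition mult_sum_power ::
  "nat \<Rightarrow> (int \<Rightarrow> int \<Rightarrow> 'w::complex_vector) \<Rightarrow> int \<Rightarrow> int \<Rightarrow> 'w" where
  "mult_sum_power l F a b =
     (\<Sum>j\<le>l. of_nat (l choose j) *\<^sub>C F (a - int (l - j)) (b - int j))"

locale nonlocal_vertex_algebra =
  fixes Y :: "'v::complex_vector \<Rightarrow> 'v \<Rightarrow> 'v fls" and vac :: 'v
  assumes Y_bilinear: "cbilinear Y"
    and Y_vac: "Y vac v = fls_const v"
    and Y_creation: "n < 0 \<Longrightarrow> Y v vac $$ n = 0" "Y v vac $$ 0 = v"
    and Y_weak_assoc: "\<exists>l. mult_sum_power l (iterate_shifted Y u v w) =
                            mult_sum_power l (iterate_nested Y Y u v w)"

locale nonlocal_va_module = nonlocal_vertex_algebra Y vac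
  for Y :: "'v::complex_vector \<Rightarrow> 'v \<Rightarrow> 'v fls" and vac :: 'v +
  fixes YW :: "'v \<Rightarrow> 'w::complex_vector \<Rightarrow> 'w fls"
  assumes YW_bilinear: "cbilinear YW"
    and YW_vac: "YW vac w = fls_const w"
    and YW_weak_assoc: "\<exists>l. mult_sum_power l (iterate_shifted YW u v w) =
                             mult_sum_power l (iterate_nested Y YW u v w)"

definition nonlocal_va_hom ::
  "('v::complex_vector \<Rightarrow> 'v \<Rightarrow> 'v fls) \<Rightarrow> 'v \<Rightarrow> ('w::complex_vector \<Rightarrow> 'w \<Rightarrow> 'w fls) \<Rightarrow> 'w \<Rightarrow>
   ('v \<Rightarrow> 'w) \<Rightarrow> bool" where
  "nonlocal_va_hom Y vac Y' vac' f \<longleftrightarrow>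
     clinear f \<and> f vac = vac' \<and> (\<forall>u v n. f (Y u v $$ n) = Y' (f u) (f v) $$ n)"

text \<open>The nonlocal vertex algebra \<open>(A, \<partial>)\<close>: \<open>Y(a,x)b = (e\<^sup>x\<^sup>\<partial> a)b\<close>.\<close>

definition Y_of_derivation ::
  "('a \<Rightarrow> 'a \<Rightarrow> 'a) \<Rightarrow> ('a \<Rightarrow> 'a) \<Rightarrow> 'a::complex_vector \<Rightarrow> 'a \<Rightarrow> 'a fls" where
  "Y_of_derivation mul D a b = fps_to_fls (Abs_fps (\<lambda>n. (1 / fact n) *\<^sub>C mul ((D ^^ n) a) b))"

text \<open>The tensor product of nonlocal vertex algebras:
  \<open>Y(a \<otimes> b, x)(c \<otimes> d) = Y(a,x)c \<otimes> Y(b,x)d\<close>.\<close>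

definition tensor_Y ::
  "('a \<Rightarrow> 'a \<Rightarrow> 'a fls) \<Rightarrow> ('b \<Rightarrow> 'b \<Rightarrow> 'b fls) \<Rightarrow>
   ('a::complex_vector, 'b::complex_vector) tensor \<Rightarrow> ('a, 'b) tensor \<Rightarrow> ('a, 'b) tensor fls" where
  "tensor_Y Y Y' s t =
     tensor_lift (\<lambda>a b. tensor_lift (\<lambda>c d.
       Abs_fls (\<lambda>n. Sum_any (\<lambda>i::int. (Y a c $$ i) \<otimes>\<^sub>C (Y' b d $$ (n - i))))) t) s"

text \<open>The subspace \<open>V \<otimes> \<complex>((x))\<close> of \<open>V((x))\<close>.\<close>

definition tensor_laurent :: "'v::complex_vector fls set" where
  "tensor_laurent =
     {F. \<exists>(m::nat) (v :: nat \<Rightarrow> 'v) (f :: nat \<Rightarrow> complex fls).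
           \<forall>n. F $$ n = (\<Sum>i<m. (f i $$ n) *\<^sub>C v i)}"

text \<open>The coefficient of \<open>x\<^sub>1\<^sup>a x\<^sub>2\<^sup>b\<close> in \<open>Y(f(x\<^sub>1 - x\<^sub>2), x\<^sub>2) g(x\<^sub>1)\<close>, for
  \<open>f, g \<in> V \<otimes> \<complex>((x))\<close>; both restrictions are needed for the sum to be finite.\<close>

definition twisted_coeff ::
  "('v \<Rightarrow> 'v \<Rightarrow> 'v fls) \<Rightarrow> 'v fls \<Rightarrow> 'v fls \<Rightarrow> int \<Rightarrow> int \<Rightarrow> 'v::complex_vector" where
  "twisted_coeff Y f g a b =
     Sum_any (\<lambda>(n::int, k::nat). ((-1) ^ k * (of_int n gchoose k)) *\<^sub>C
       (Y (f $$ n) (g $$ (a - (n - int k))) $$ (b - int k)))"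

definition PEnd_minus ::
  "('v::complex_vector \<Rightarrow> 'v \<Rightarrow> 'v fls) \<Rightarrow> 'v \<Rightarrow> ('v \<Rightarrow> 'v fls) set" where
  "PEnd_minus Y vac =
     {\<phi>. clinear \<phi> \<and> range \<phi> \<subseteq> tensor_laurent \<and> \<phi> vac = fls_const vac \<and>
         (\<forall>v w a b. \<phi> (Y v w $$ b) $$ a = twisted_coeff Y (\<phi> v) (\<phi> w) a b)}"


section \<open>Vertex bialgebras and their module nonlocal vertex algebras\<close>

text \<open>Coassociativity is stated in \<open>(H \<otimes> H) \<otimes> H\<close>.  The ground field is the nonlocal vertex
  algebra \<open>\<complex>\<close> with \<open>Y(a,x)b = ab\<close>.\<close>

definition coalgebra ::
  "('h::complex_vector \<Rightarrow> ('h, 'h) tensor) \<Rightarrow> ('h \<Rightarrow> complex) \<Rightarrow> bool" where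
  "coalgebra \<Delta> \<epsilon> \<longleftrightarrow> clinear \<Delta> \<and> clinear \<epsilon> \<and>
     (\<forall>h. tensor_lift (\<lambda>a b. \<Delta> a \<otimes>\<^sub>C b) (\<Delta> h) =
          tensor_lift (\<lambda>a b. tensor_lift (\<lambda>c d. (a \<otimes>\<^sub>C c) \<otimes>\<^sub>C d) (\<Delta> b)) (\<Delta> h)) \<and>
     (\<forall>h. tensor_lift (\<lambda>a b. \<epsilon> a *\<^sub>C b) (\<Delta> h) = h) \<and>
     (\<forall>h. tensor_lift (\<lambda>a b. \<epsilon> b *\<^sub>C a) (\<Delta> h) = h)"

locale vertex_bialgebra = nonlocal_vertex_algebra Y vac
  for Y :: "'h::complex_vector \<Rightarrow> 'h \<Rightarrow> 'h fls" and vac :: 'h +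
  fixes \<Delta> :: "'h \<Rightarrow> ('h, 'h) tensor" and \<epsilon> :: "'h \<Rightarrow> complex"
  assumes coalgebra: "coalgebra \<Delta> \<epsilon>"
    and comult_hom: "nonlocal_va_hom Y vac (tensor_Y Y Y) (vac \<otimes>\<^sub>C vac) \<Delta>"
    and counit_hom: "nonlocal_va_hom Y vac (\<lambda>a b. fls_const (a * b)) 1 \<epsilon>"

locale module_nonlocal_vertex_algebra =
  H: vertex_bialgebra YH vacH \<Delta> \<epsilon> +
  V: nonlocal_vertex_algebra Y vac +
  M: nonlocal_va_module YH vacH YM
  for YH :: "'h::complex_vector \<Rightarrow> 'h \<Rightarrow> 'h fls" and vacH :: 'h
    and \<Delta> :: "'h \<Rightarrow> ('h, 'h) tensor" and \<epsilon> :: "'h \<Rightarrow> complex"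
    and Y :: "'v::complex_vector \<Rightarrow> 'v \<Rightarrow> 'v fls" and vac :: 'v
    and YM :: "'h \<Rightarrow> 'v \<Rightarrow> 'v fls" +
  assumes YM_tensor_laurent: "YM h v \<in> tensor_laurent"
    and YM_vac_V: "YM h vac = fls_const (\<epsilon> h *\<^sub>C vac)"
    and YM_Y: "YM h (Y u v $$ b) $$ a =
                 tensor_lift (\<lambda>h1 h2. twisted_coeff Y (YM h1 u) (YM h2 v) a b) (\<Delta> h)"


section \<open>Lattices and the algebras \<open>B\<^sub>L\<^sub>,\<^sub>\<epsilon>\<close>\<close>

definition nondegenerate_even_lattice :: "('l::ab_group_add \<Rightarrow> 'l \<Rightarrow> int) \<Rightarrow> bool" where
  "nondegenerate_even_lattice form \<longleftrightarrow>
     (\<exists>B::'l set. finite B \<and>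
        (\<lparr>carrier = UNIV, monoid.mult = (+), one = 0\<rparr> :: 'l monoid) \<cong> free_Abelian_group B) \<and>
     (\<forall>\<alpha> \<beta>. form \<alpha> \<beta> = form \<beta> \<alpha>) \<and>
     (\<forall>\<alpha> \<beta> \<gamma>. form (\<alpha> + \<beta>) \<gamma> = form \<alpha> \<gamma> + form \<beta> \<gamma>) \<and>
     (\<forall>\<alpha>. (\<forall>\<beta>. form \<alpha> \<beta> = 0) \<longrightarrow> \<alpha> = 0) \<and>
     (\<forall>\<alpha>. even (form \<alpha> \<alpha>))"

definition normalized_cocycle :: "('l::ab_group_add \<Rightarrow> 'l \<Rightarrow> complex) \<Rightarrow> bool" where
  "normalized_cocycle eps \<longleftrightarrow>
     (\<forall>\<alpha> \<beta>. eps \<alpha> \<beta> \<noteq> 0) \<and>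
     (\<forall>\<alpha>. eps \<alpha> 0 = 1 \<and> eps 0 \<alpha> = 1) \<and>
     (\<forall>\<alpha> \<beta> \<gamma>. eps \<alpha> (\<beta> + \<gamma>) * eps \<beta> \<gamma> = eps (\<alpha> + \<beta>) \<gamma> * eps \<alpha> \<beta>)"

text \<open>\<open>\<h> = \<complex> \<otimes>\<^sub>\<int> L\<close>, presented as the complex vector space on symbols \<open>1 \<otimes> \<alpha>\<close>, \<open>\<alpha> \<in> L\<close>,
  modulo additivity in \<open>\<alpha>\<close>.\<close>

definition cplx_relators :: "('l::ab_group_add \<Rightarrow>\<^sub>0 complex) set" where
  "cplx_relators =
     {Poly_Mapping.single (\<alpha> + \<beta>) 1 - Poly_Mapping.single \<alpha> 1 - Poly_Mapping.single \<beta> 1 | \<alpha> \<beta>. True}"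

definition cplx_eq ::
  "('l::ab_group_add \<Rightarrow>\<^sub>0 complex) \<Rightarrow> ('l \<Rightarrow>\<^sub>0 complex) \<Rightarrow> bool" where
  "cplx_eq p q \<longleftrightarrow> p - q \<in> cspan cplx_relators"

quotient_type (overloaded) 'l cplx = "'l::ab_group_add \<Rightarrow>\<^sub>0 complex" / cplx_eq
  unfolding cplx_eq_def by (rule cspan_cong(1))

instantiation cplx :: (ab_group_add) complex_vector
begin
lift_definition zero_cplx :: "'a cplx" is 0 .
lift_definition plus_cplx :: "'a cplx \<Rightarrow> 'a cplx \<Rightarrow> 'a cplx" is "(+)"
  unfolding cplx_eq_def by (rule cspan_cong(2))
lift_definition uminus_cplx :: "'a cplx \<Rightarrow> 'a cplx" is uminus
  unfolding cplx_eq_def by (rule cspan_cong(4))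
lift_definition minus_cplx :: "'a cplx \<Rightarrow> 'a cplx \<Rightarrow> 'a cplx" is "(-)"
  unfolding cplx_eq_def by (rule cspan_cong(3))
lift_definition scaleC_cplx :: "complex \<Rightarrow> 'a cplx \<Rightarrow> 'a cplx" is scaleC
  unfolding cplx_eq_def by (rule cspan_cong(5))
instance
  by standard (transfer, simp add: cplx_eq_def complex_vector.span_zero add.assoc add.commute
      scaleC_add_right scaleC_add_left scaleC_scaleC scaleC_one)+
end

lift_definition cplx_inc :: "'l::ab_group_add \<Rightarrow> 'l cplx" is "\<lambda>\<alpha>. Poly_Mapping.single \<alpha> 1" .

definition cplx_form ::
  "('l::ab_group_add \<Rightarrow> 'l \<Rightarrow> int) \<Rightarrow> 'l cplx \<Rightarrow> 'l cplx \<Rightarrow> complex" where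
  "cplx_form form = (THE B. cbilinear B \<and>
     (\<forall>\<alpha> \<beta>. B (cplx_inc \<alpha>) (cplx_inc \<beta>) = of_int (form \<alpha> \<beta>)))"

text \<open>\<open>nat \<Rightarrow>\<^sub>0 complex\<close> stands for \<open>t\<^sup>-\<^sup>1\<complex>[t\<^sup>-\<^sup>1]\<close>, the basis vector of index \<open>k\<close> being
  \<open>t\<^sup>-\<^sup>k\<^sup>-\<^sup>1\<close>; so \<open>'l hminus\<close> is \<open>\<h> \<otimes> t\<^sup>-\<^sup>1\<complex>[t\<^sup>-\<^sup>1]\<close> and \<open>'l heis\<close> is its symmetric
  algebra.\<close>

type_synonym 'l hminus = "('l cplx, nat \<Rightarrow>\<^sub>0 complex) tensor"
type_synonym 'l heis = "'l hminus sym"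

text \<open>\<open>hneg h n\<close> is \<open>h(-n)\<close>, for \<open>n \<ge> 1\<close>.\<close>

definition hneg :: "'l::ab_group_add cplx \<Rightarrow> nat \<Rightarrow> 'l heis" where
  "hneg h n = sym_inc (h \<otimes>\<^sub>C Poly_Mapping.single (n - 1) 1)"

text \<open>\<open>heis_trans\<close> and \<open>B_trans\<close> are the derivations \<open>L(-1)\<close> of \<open>B\<^sub>\<h>\<close> and \<open>B\<^sub>L\<^sub>,\<^sub>\<epsilon>\<close>.\<close>

definition heis_trans :: "'l::ab_group_add heis \<Rightarrow> 'l heis" where
  "heis_trans = (THE D. sym_derivation D \<and> (\<forall>h. \<forall>n\<ge>1. D (hneg h n) = of_nat n *\<^sub>C hneg h (n + 1)))"

definition heis_mode ::
  "('l::ab_group_add \<Rightarrow> 'l \<Rightarrow> int) \<Rightarrow> 'l cplx \<Rightarrow> int \<Rightarrow> 'l heis \<Rightarrow> 'l heis" where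
  "heis_mode form h n =
     (if n < 0 then (\<lambda>u. hneg h (nat (- n)) * u)
      else (THE D. sym_derivation D \<and>
        (\<forall>\<beta>. \<forall>m\<ge>1. D (hneg \<beta> m) =
           (if n = int m then (of_int n * cplx_form form h \<beta>) *\<^sub>C 1 else 0))))"

type_synonym 'l lattice_alg = "('l \<Rightarrow>\<^sub>0 complex, 'l heis) tensor"

definition e_basis :: "'l \<Rightarrow> 'l \<Rightarrow>\<^sub>0 complex" where
  "e_basis \<alpha> = Poly_Mapping.single \<alpha> 1"

definition group_alg_mult ::
  "('l::ab_group_add \<Rightarrow> 'l \<Rightarrow> complex) \<Rightarrow> ('l \<Rightarrow>\<^sub>0 complex) \<Rightarrow> ('l \<Rightarrow>\<^sub>0 complex) \<Rightarrow> 'l \<Rightarrow>\<^sub>0 complex" where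
  "group_alg_mult eps a b =
     (\<Sum>\<alpha>\<in>Poly_Mapping.keys a. \<Sum>\<beta>\<in>Poly_Mapping.keys b.
        (Poly_Mapping.lookup a \<alpha> * Poly_Mapping.lookup b \<beta> * eps \<alpha> \<beta>) *\<^sub>C e_basis (\<alpha> + \<beta>))"

definition B_mult ::
  "('l::ab_group_add \<Rightarrow> 'l \<Rightarrow> complex) \<Rightarrow> 'l lattice_alg \<Rightarrow> 'l lattice_alg \<Rightarrow> 'l lattice_alg" where
  "B_mult eps = tensor_mult (group_alg_mult eps) (*)"

definition B_one :: "'l::ab_group_add lattice_alg" where
  "B_one = e_basis 0 \<otimes>\<^sub>C 1"

text \<open>The linear map on \<open>\<complex>[L] \<otimes> B\<^sub>\<h>\<close> with \<open>e\<^sub>\<alpha> \<otimes> u \<mapsto> F \<alpha> u\<close>, for \<open>F\<close> linear in \<open>u\<close>.\<close>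

definition B_lift ::
  "('l::ab_group_add \<Rightarrow> 'l heis \<Rightarrow> 'c::complex_vector) \<Rightarrow> 'l lattice_alg \<Rightarrow> 'c" where
  "B_lift F = tensor_lift (\<lambda>a u. \<Sum>\<alpha>\<in>Poly_Mapping.keys a. Poly_Mapping.lookup a \<alpha> *\<^sub>C F \<alpha> u)"

definition B_trans :: "'l::ab_group_add lattice_alg \<Rightarrow> 'l lattice_alg" where
  "B_trans = B_lift (\<lambda>\<alpha> u. e_basis \<alpha> \<otimes>\<^sub>C (hneg (cplx_inc \<alpha>) 1 * u) + e_basis \<alpha> \<otimes>\<^sub>C heis_trans u)"

definition B_Y ::
  "('l::ab_group_add \<Rightarrow> 'l \<Rightarrow> complex) \<Rightarrow> 'l lattice_alg \<Rightarrow> 'l lattice_alg \<Rightarrow> 'l lattice_alg fls" where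
  "B_Y eps = Y_of_derivation (B_mult eps) B_trans"

abbreviation trivial_cocycle :: "'l \<Rightarrow> 'l \<Rightarrow> complex" where
  "trivial_cocycle \<equiv> \<lambda>_ _. 1"

definition BL_comult :: "'l::ab_group_add lattice_alg \<Rightarrow> ('l lattice_alg, 'l lattice_alg) tensor" where
  "BL_comult = (THE \<Delta>. clinear \<Delta> \<and> \<Delta> B_one = B_one \<otimes>\<^sub>C B_one \<and>
     (\<forall>a b. \<Delta> (B_mult trivial_cocycle a b) =
        tensor_mult (B_mult trivial_cocycle) (B_mult trivial_cocycle) (\<Delta> a) (\<Delta> b)) \<and>
     (\<forall>\<alpha>. \<Delta> (e_basis \<alpha> \<otimes>\<^sub>C 1) = (e_basis \<alpha> \<otimes>\<^sub>C 1) \<otimes>\<^sub>C (e_basis \<alpha> \<otimes>\<^sub>C 1)) \<and>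
     (\<forall>v. \<Delta> (e_basis 0 \<otimes>\<^sub>C sym_inc v) =
        (e_basis 0 \<otimes>\<^sub>C sym_inc v) \<otimes>\<^sub>C B_one + B_one \<otimes>\<^sub>C (e_basis 0 \<otimes>\<^sub>C sym_inc v)))"

definition BL_counit :: "'l::ab_group_add lattice_alg \<Rightarrow> complex" where
  "BL_counit = (THE \<epsilon>. clinear \<epsilon> \<and> \<epsilon> B_one = 1 \<and>
     (\<forall>a b. \<epsilon> (B_mult trivial_cocycle a b) = \<epsilon> a * \<epsilon> b) \<and>
     (\<forall>\<alpha>. \<epsilon> (e_basis \<alpha> \<otimes>\<^sub>C 1) = 1) \<and>
     (\<forall>v. \<epsilon> (e_basis 0 \<otimes>\<^sub>C sym_inc v) = 0))"


section \<open>The operators \<open>E\<^sup>+(-\<alpha>,x)\<close> and \<open>x\<^sup>\<alpha>\<^sup>(\<^sup>0\<^sup>)\<close>\<close>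

definition B_mode ::
  "('l::ab_group_add \<Rightarrow> 'l \<Rightarrow> int) \<Rightarrow> 'l cplx \<Rightarrow> int \<Rightarrow> 'l lattice_alg \<Rightarrow> 'l lattice_alg" where
  "B_mode form h n = B_lift (\<lambda>\<alpha> u.
     if n = 0 then cplx_form form h (cplx_inc \<alpha>) *\<^sub>C (e_basis \<alpha> \<otimes>\<^sub>C u)
     else e_basis \<alpha> \<otimes>\<^sub>C heis_mode form h n u)"

text \<open>Products, powers and exponentials of operator-valued series \<open>V \<rightarrow> V((x))\<close>, with \<open>(A(x)B(x)w)\<close>
  computed coefficientwise.  They are applied below only to series in \<open>x\<^sup>-\<^sup>1\<close> and Laurent polynomials
  (on each vector), and the exponential only to a locally nilpotent one, so the sums are finite.\<close>

definition op_comp ::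
  "('v \<Rightarrow> 'v fls) \<Rightarrow> ('v \<Rightarrow> 'v fls) \<Rightarrow> 'v \<Rightarrow> 'v::complex_vector fls" where
  "op_comp A B w = Abs_fls (\<lambda>n. Sum_any (\<lambda>i::int. A (B w $$ i) $$ (n - i)))"

definition op_exp :: "('v \<Rightarrow> 'v fls) \<Rightarrow> 'v \<Rightarrow> 'v::complex_vector fls" where
  "op_exp A w = Sum_any (\<lambda>k::nat. (1 / fact k) *\<^sub>C ((op_comp A ^^ k) fls_const) w)"

text \<open>The coefficient of \<open>x\<^sup>-\<^sup>n\<close> in the exponent of \<open>E\<^sup>+(-\<alpha>,x)\<close> is \<open>-\<alpha>(n)/n\<close>, \<open>n \<ge> 1\<close>.\<close>

definition E_plus_neg ::
  "('l::ab_group_add \<Rightarrow> 'l \<Rightarrow> int) \<Rightarrow> 'l \<Rightarrow> 'l lattice_alg \<Rightarrow> 'l lattice_alg fls" where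
  "E_plus_neg form \<alpha> = op_exp (\<lambda>w. Abs_fls (\<lambda>k.
     if k < 0 then (- 1 / of_int (- k)) *\<^sub>C B_mode form (cplx_inc \<alpha>) (- k) w else 0))"

definition x_pow_zero_mode ::
  "('l::ab_group_add \<Rightarrow> 'l \<Rightarrow> int) \<Rightarrow> 'l \<Rightarrow> 'l lattice_alg \<Rightarrow> 'l lattice_alg fls" where
  "x_pow_zero_mode form \<alpha> = B_lift (\<lambda>\<beta> u. fls_shift (- form \<alpha> \<beta>) (fls_const (e_basis \<beta> \<otimes>\<^sub>C u)))"

definition E_x_operator ::
  "('l::ab_group_add \<Rightarrow> 'l \<Rightarrow> int) \<Rightarrow> 'l \<Rightarrow> 'l lattice_alg \<Rightarrow> 'l lattice_alg fls" where
  "E_x_operator form \<alpha> = op_comp (E_plus_neg form \<alpha>) (x_pow_zero_mode form \<alpha>)"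

end

(*
  The space B_{L,eps} is the direct sum of its components e_beta S, where S = B_h, and all operators
  in question preserve the components, so one can work in the commutative ring S[x,1/x].  On the
  component of beta, e^gamma acts as x^<gamma,beta> times the ring homomorphism
  h(-n) |-> h(-n) - <gamma,h> x^-n, which is the exponential of the derivation in E^+(-gamma,x), and
  h(-m) acts as a multiplication operator plus an x-linear derivation, namely as the (m-1)-st divided
  derivative of sum_n h(n) x^(-n-1).  These operators commute, hence define an action A_beta of the
  commutative algebra B_L, and they satisfy, by induction from the generators,
    [d/dx, A_beta(h)] = A_beta(L(-1)h),
    [L(-1) - d/dx, A_beta(h)] = 0,
    A_{beta+beta'}(h)(pq) = sum A_beta(h_1)p A_beta'(h_2)q.
  By the first identity and Taylor's formula, the two sides of weak associativity are the expansions
  of the same Laurent polynomial in x_0+x_2 and x_2 in the two possible directions, and a power of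
  x_0+x_2 clears the poles.  The other two identities give the compatibility with Y.  For uniqueness,
  the elements on which two module structures agree form a subalgebra closed under L(-1) by weak
  associativity; it contains all e^alpha, hence alpha(-1) = e^-alpha L(-1) e^alpha, hence everything.
*)
theory Submission
  imports Defs "HOL-Library.Product_Plus"
begin

text \<open>The given objects are quotients and definite descriptions, so each needs existence and
  uniqueness before anything can be computed. For symmetric algebras one fact does this: commuting
  operators on a space W, linear in v, extend to an action of S(V) on W. Multiplication operators on
  an algebra W yield homomorphisms; the dual numbers, derivations; W = B_L tensor B_L, the
  coproduct; W = S[x,1/x], the action of B_L on a component, which is why \<open>prim_op\<close> is
  shown to commute before any module exists.

  Laurent polynomials suffice because every operator in question sends a vector to finitely many
  powers of x, so the sums of the definitions become finite. The cocycle enters only as the scalar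
  \<open>eps \<beta> \<beta>'\<close> in the product of two components, so one action serves every
  cocycle. L(-1) - d/dx occurs because Y(f(x_1-x_2),x_2)g(x_1) is the product of
  e^(x_2(L(-1)-d/dx_1))f(x_1) and g(x_1), so that operators commuting with it pass through.\<close>

abbreviation lookup :: "('a \<Rightarrow>\<^sub>0 'b::zero) \<Rightarrow> 'a \<Rightarrow> 'b" where "lookup \<equiv> Poly_Mapping.lookup"
abbreviation keys :: "('a \<Rightarrow>\<^sub>0 'b::zero) \<Rightarrow> 'a set" where "keys \<equiv> Poly_Mapping.keys"
abbreviation single :: "'a \<Rightarrow> 'b \<Rightarrow> 'a \<Rightarrow>\<^sub>0 'b::zero" where "single \<equiv> Poly_Mapping.single"

section \<open>Complex vector spaces and tensor products\<close>

lemma clinearI: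
  assumes "\<And>x y. f (x + y) = f x + f y" "\<And>c x. f (c *\<^sub>C x) = c *\<^sub>C f x"
  shows "clinear f"
  by unfold_locales (simp_all add: assms)

lemma clinear_add: "clinear f \<Longrightarrow> f (x + y) = f x + f y"
  by (rule Vector_Spaces.linear.axioms(3)[THEN module_hom.add])
lemma clinear_scale: "clinear f \<Longrightarrow> f (c *\<^sub>C x) = c *\<^sub>C f x"
  by (rule Vector_Spaces.linear.axioms(3)[THEN module_hom.scale])
lemma clinear_zero: "clinear f \<Longrightarrow> f 0 = 0"
  by (rule Vector_Spaces.linear.axioms(3)[THEN module_hom.zero])
lemma clinear_diff: "clinear f \<Longrightarrow> f (x - y) = f x - f y"
  by (rule Vector_Spaces.linear.axioms(3)[THEN module_hom.diff])
lemma clinear_minus: "clinear f \<Longrightarrow> f (- x) = - f x"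
  by (rule Vector_Spaces.linear.axioms(3)[THEN module_hom.neg])
lemma clinear_sum: "clinear f \<Longrightarrow> f (sum g A) = (\<Sum>a\<in>A. f (g a))"
  by (rule Vector_Spaces.linear.axioms(3)[THEN module_hom.sum])

lemmas clinear_simps = clinear_add clinear_scale clinear_zero clinear_diff clinear_minus clinear_sum

lemma clinear_compose:
  assumes "clinear f" "clinear g"
  shows "clinear (\<lambda>x. f (g x))"
  by (rule clinearI) (simp_all only: clinear_add[OF assms(1)] clinear_add[OF assms(2)]
      clinear_scale[OF assms(1)] clinear_scale[OF assms(2)])

lemma clinear_eq_0_on_span: "clinear f \<Longrightarrow> (\<And>x. x \<in> S \<Longrightarrow> f x = 0) \<Longrightarrow> x \<in> cspan S \<Longrightarrow> f x = 0"
  by (rule module_hom.eq_0_on_span[OF Vector_Spaces.linear.axioms(3)])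

lemmas scaleC_simps =
  complex_vector.scale_zero_left complex_vector.scale_zero_right
  complex_vector.scale_minus_left complex_vector.scale_minus_right
  complex_vector.scale_right_diff_distrib complex_vector.scale_left_diff_distrib
  complex_vector.scale_sum_right scaleC_add_right scaleC_scaleC scaleC_one

lemma cbilinearI:
  assumes "\<And>a b b'. f a (b + b') = f a b + f a b'" "\<And>a c b. f a (c *\<^sub>C b) = c *\<^sub>C f a b"
    "\<And>a a' b. f (a + a') b = f a b + f a' b" "\<And>a c b. f (c *\<^sub>C a) b = c *\<^sub>C f a b"
  shows "cbilinear f"
  unfolding cbilinear_def by (auto intro!: clinearI simp: assms)

lemma
  assumes "cbilinear f"
  shows cbilinear_right: "clinear (f a)" and cbilinear_left: "clinear (\<lambda>a. f a b)"
  using assms by (auto simp: cbilinear_def)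

lemma
  assumes "cbilinear f"
  shows cbilinear_add_right: "f a (b + b') = f a b + f a b'"
    and cbilinear_scale_right: "f a (c *\<^sub>C b) = c *\<^sub>C f a b"
    and cbilinear_zero_right: "f a 0 = 0"
    and cbilinear_diff_right: "f a (b - b') = f a b - f a b'"
    and cbilinear_sum_right: "f a (sum g A) = (\<Sum>i\<in>A. f a (g i))"
    and cbilinear_add_left: "f (a + a') b = f a b + f a' b"
    and cbilinear_scale_left: "f (c *\<^sub>C a) b = c *\<^sub>C f a b"
    and cbilinear_zero_left: "f 0 b = 0"
    and cbilinear_diff_left: "f (a - a') b = f a b - f a' b"
    and cbilinear_sum_left: "f (sum h A') b = (\<Sum>i\<in>A'. f (h i) b)"
  by (simp_all only: clinear_simps[OF cbilinear_right[OF assms]] clinear_simps[OF cbilinear_left[OF assms]])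

lemmas cbilinear_simps = cbilinear_add_right cbilinear_scale_right cbilinear_zero_right
  cbilinear_diff_right cbilinear_sum_right cbilinear_add_left cbilinear_scale_left
  cbilinear_zero_left cbilinear_diff_left cbilinear_sum_left

lemma clinear_sum_fun:
  assumes "\<And>i. i \<in> I \<Longrightarrow> clinear (f i)"
  shows "clinear (\<lambda>x. \<Sum>i\<in>I. f i x)"
proof (rule clinearI)
  fix x y c
  show "(\<Sum>i\<in>I. f i (x + y)) = (\<Sum>i\<in>I. f i x) + (\<Sum>i\<in>I. f i y)"
    unfolding sum.distrib[symmetric] by (rule sum.cong[OF refl]) (rule clinear_add[OF assms])
  show "(\<Sum>i\<in>I. f i (c *\<^sub>C x)) = c *\<^sub>C (\<Sum>i\<in>I. f i x)"
    unfolding complex_vector.scale_sum_right by (rule sum.cong[OF refl]) (rule clinear_scale[OF assms])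
qed

instantiation prod :: (complex_vector, complex_vector) complex_vector
begin
definition scaleC_prod :: "complex \<Rightarrow> 'a \<times> 'b \<Rightarrow> 'a \<times> 'b" where
  "scaleC_prod c p = (c *\<^sub>C fst p, c *\<^sub>C snd p)"
instance
  by standard (simp_all add: scaleC_prod_def prod_eq_iff scaleC_add_right scaleC_add_left
      scaleC_scaleC scaleC_one)
end

lemma fst_scaleC [simp]: "fst (c *\<^sub>C p) = c *\<^sub>C fst p"
  and snd_scaleC [simp]: "snd (c *\<^sub>C p) = c *\<^sub>C snd p"
  by (simp_all add: scaleC_prod_def)

lemma lookup_scaleC [simp]: "lookup (c *\<^sub>C p) k = c *\<^sub>C lookup p k"
  by (simp add: scaleC_poly_mapping.rep_eq)

lemma fls_nth_scaleC [simp]: "(c *\<^sub>C F) $$ n = c *\<^sub>C (F $$ n)"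
  by (simp add: scaleC_fls.rep_eq)

lemma scaleC_single: "c *\<^sub>C single k x = single k (c *\<^sub>C x)"
  by (rule poly_mapping_eqI) (simp add: lookup_single when_def)

section \<open>Linear maps out of spaces of finitely supported functions\<close>

lemma poly_mapping_induct [case_names zero add single]:
  fixes p :: "'k \<Rightarrow>\<^sub>0 'b::comm_monoid_add"
  assumes "P 0" "\<And>p q. P p \<Longrightarrow> P q \<Longrightarrow> P (p + q)" "\<And>k c. P (single k c)"
  shows "P p"
proof (induction p rule: update_induct)
  case const
  show ?case by (rule assms)
next
  case (update f a b)
  then have "Poly_Mapping.update a b f = f + single a b"
    by (intro poly_mapping_eqI)
      (auto simp: lookup_update lookup_add lookup_single when_def in_keys_iff)
  then show ?case using assms update by simp
qed

definition pm_lift :: "('k \<Rightarrow> 'c::complex_vector) \<Rightarrow> ('k \<Rightarrow>\<^sub>0 complex) \<Rightarrow> 'c" where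
  "pm_lift F p = (\<Sum>k\<in>keys p. lookup p k *\<^sub>C F k)"

lemma pm_lift_superset:
  assumes "finite A" "keys p \<subseteq> A"
  shows "pm_lift F p = (\<Sum>k\<in>A. lookup p k *\<^sub>C F k)"
  unfolding pm_lift_def using assms
  by (intro sum.mono_neutral_left) (auto simp: in_keys_iff scaleC_simps)

lemma clinear_pm_lift: "clinear (pm_lift F)"
proof (rule clinearI)
  fix p q :: "'a \<Rightarrow>\<^sub>0 complex" and c
  let ?A = "keys p \<union> keys q"
  show "pm_lift F (p + q) = pm_lift F p + pm_lift F q"
    by (simp add: pm_lift_superset[of ?A] keys_add lookup_add scaleC_add_left sum.distrib)
  have "keys (c *\<^sub>C p) \<subseteq> keys p"
    by (auto simp: in_keys_iff scaleC_simps)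
  then show "pm_lift F (c *\<^sub>C p) = c *\<^sub>C pm_lift F p"
    by (simp add: pm_lift_superset[of "keys p"] scaleC_simps scaleC_complex_def)
qed

lemma pm_lift_single [simp]: "pm_lift F (single k c) = c *\<^sub>C F k"
  by (simp add: pm_lift_superset[of "{k}"])

lemma single_eq_scaleC: "single k c = c *\<^sub>C single k (1::complex)"
  by (simp add: scaleC_single scaleC_complex_def)

lemma clinear_pm_eqI:
  assumes "clinear f" "clinear g" "\<And>k. f (single k (1::complex)) = g (single k 1)"
  shows "f p = g p"
proof (induction p rule: poly_mapping_induct)
  case (single k c)
  show ?case
    by (subst (1 2) single_eq_scaleC)
      (simp add: clinear_scale[OF assms(1)] clinear_scale[OF assms(2)] assms(3) del: single_one)
qed (simp_all add: clinear_simps[OF assms(1)] clinear_simps[OF assms(2)])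

lemma clinear_pm_lift_fun:
  assumes "\<And>k. clinear (\<lambda>x. F x k)"
  shows "clinear (\<lambda>x. pm_lift (F x) p)"
  unfolding pm_lift_def
  by (rule clinear_sum_fun, rule clinearI)
    (simp_all add: clinear_add[OF assms] clinear_scale[OF assms] scaleC_simps mult.commute)

section \<open>Tensor products and their universal property\<close>

lemma tensor_abs_cases: obtains p where "t = abs_tensor p"
  using Quotient_abs_rep[OF Quotient_tensor] by metis

lemma cbilinear_tens: "cbilinear (\<otimes>\<^sub>C)"
proof (rule cbilinearI)
  have r: "x \<in> tensor_relators \<Longrightarrow> x \<in> cspan tensor_relators" for x :: "('a \<times> 'b) \<Rightarrow>\<^sub>0 complex"
    by (rule complex_vector.span_base)
  fix a a' :: 'a and b b' :: 'b and c
  show "a \<otimes>\<^sub>C (b + b') = a \<otimes>\<^sub>C b + a \<otimes>\<^sub>C b'"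
    by transfer (simp only: tensor_eq_def diff_diff_eq[symmetric], rule r, unfold tensor_relators_def, blast)
  show "(a + a') \<otimes>\<^sub>C b = a \<otimes>\<^sub>C b + a' \<otimes>\<^sub>C b"
    by transfer (simp only: tensor_eq_def diff_diff_eq[symmetric], rule r, unfold tensor_relators_def, blast)
  show "a \<otimes>\<^sub>C (c *\<^sub>C b) = c *\<^sub>C (a \<otimes>\<^sub>C b)"
    by transfer (simp only: tensor_eq_def, rule r, unfold tensor_relators_def, blast)
  show "(c *\<^sub>C a) \<otimes>\<^sub>C b = c *\<^sub>C (a \<otimes>\<^sub>C b)"
    by transfer (simp only: tensor_eq_def, rule r, unfold tensor_relators_def, blast)
qed

lemmas tens_simps = cbilinear_simps[OF cbilinear_tens]

lemma abs_tensor_add: "abs_tensor (p + q) = abs_tensor p + abs_tensor q"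
  by (simp add: plus_tensor.abs_eq)

text \<open>A scalar multiple of a simple tensor is again simple, since the scalar can be absorbed
  into the left factor. Hence simple tensors generate additively and no case for scaling is
  needed.\<close>

lemma tensor_induct [case_names add tens]:
  assumes add: "\<And>s t. P s \<Longrightarrow> P t \<Longrightarrow> P (s + t)" and tens: "\<And>a b. P (a \<otimes>\<^sub>C b)"
  shows "P t"
proof (cases t rule: tensor_abs_cases)
  case (1 p)
  have "P (abs_tensor p)"
  proof (induction p rule: poly_mapping_induct)
    case zero
    have "abs_tensor 0 = (0 :: 'a) \<otimes>\<^sub>C (0 :: 'b)" by (simp add: zero_tensor.abs_eq tens_simps)
    then show ?case by (simp add: tens)
  next
    case (add p q)
    then show ?case by (simp add: abs_tensor_add assms)
  next
    case (single k c)
    obtain a b where k: "k = (a, b)" by fastforce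
    have "abs_tensor (single k c) = c *\<^sub>C (a \<otimes>\<^sub>C b)"
      by (simp add: k scaleC_tensor.abs_eq tens.abs_eq scaleC_single scaleC_complex_def del: single_one)
    then show ?case using tens by (simp flip: tens_simps(2))
  qed
  with 1 show ?thesis by simp
qed

lemma clinear_tensor_eqI:
  assumes "clinear f" "clinear g" "\<And>a b. f (a \<otimes>\<^sub>C b) = g (a \<otimes>\<^sub>C b)"
  shows "f t = g t"
  by (induction t rule: tensor_induct)
    (simp_all only: assms(3) clinear_add[OF assms(1)] clinear_add[OF assms(2)])

text \<open>The linear extension of \<open>f\<close> to formal sums of pairs kills all four families
  of relators by bilinearity, so it is constant on classes.\<close>

lemma tensor_lift_ex:
  fixes f :: "'a::complex_vector \<Rightarrow> 'b::complex_vector \<Rightarrow> 'c::complex_vector"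
  assumes f: "cbilinear f"
  shows "\<exists>g. clinear g \<and> (\<forall>a b. g (a \<otimes>\<^sub>C b) = f a b)"
proof -
  let ?e = "pm_lift (\<lambda>(a, b). f a b)"
  have lin: "clinear ?e" by (rule clinear_pm_lift)
  have rel: "?e r = 0" if "r \<in> tensor_relators" for r
    using that by (auto simp: tensor_relators_def clinear_simps[OF lin] cbilinear_simps[OF f] scaleC_simps
        simp del: single_one)
  have wd: "?e p = ?e q" if "abs_tensor p = abs_tensor q" for p q
  proof -
    have "p - q \<in> cspan tensor_relators" using that by (simp add: tensor.abs_eq_iff tensor_eq_def)
    then have "?e (p - q) = 0" using clinear_eq_0_on_span[OF lin] rel by blast
    then show ?thesis by (simp add: clinear_simps[OF lin])
  qed
  define g where "g t = ?e (rep_tensor t)" for t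
  have abs_rep: "abs_tensor (rep_tensor t) = t" for t :: "('a, 'b) tensor"
    by (rule Quotient_abs_rep[OF Quotient_tensor])
  have g: "g (abs_tensor p) = ?e p" for p
    unfolding g_def by (rule wd) (rule abs_rep)
  have "clinear g"
  proof (rule clinearI)
    fix s t :: "('a, 'b) tensor" and c
    obtain p q where "s = abs_tensor p" "t = abs_tensor q" by (metis tensor_abs_cases)
    then show "g (s + t) = g s + g t" "g (c *\<^sub>C s) = c *\<^sub>C g s"
      by (simp_all add: g scaleC_tensor.abs_eq abs_tensor_add[symmetric] clinear_simps[OF lin])
  qed
  moreover have "g (a \<otimes>\<^sub>C b) = f a b" for a b
    by (simp add: tens.abs_eq g scaleC_simps del: single_one)
  ultimately show ?thesis by blast
qed

lemma tensor_lift: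
  assumes "cbilinear f"
  shows clinear_tensor_lift: "clinear (tensor_lift f)"
    and tensor_lift_tens: "tensor_lift f (a \<otimes>\<^sub>C b) = f a b"
proof -
  have "\<exists>!g. clinear g \<and> (\<forall>a b. g (a \<otimes>\<^sub>C b) = f a b)"
    using tensor_lift_ex[OF assms] by (metis ext clinear_tensor_eqI)
  from theI'[OF this]
  show "clinear (tensor_lift f)" "tensor_lift f (a \<otimes>\<^sub>C b) = f a b"
    unfolding tensor_lift_def by auto
qed

text \<open>This collapses a lift whose integrand depends on the simple tensor only; with it the
  nested lifts in \<open>tensor_Y\<close> are removed one after the other.\<close>

lemma tensor_lift_unique:
  assumes "clinear g"
  shows "tensor_lift (\<lambda>a b. g (a \<otimes>\<^sub>C b)) t = g t"
proof -
  have b: "cbilinear (\<lambda>a b. g (a \<otimes>\<^sub>C b))"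
    by (rule cbilinearI) (simp_all add: clinear_simps[OF assms] tens_simps)
  show ?thesis
    by (rule clinear_tensor_eqI[OF clinear_tensor_lift[OF b] assms]) (simp add: tensor_lift_tens[OF b])
qed

lemma clinear_comp_tensor_lift:
  assumes "cbilinear f" "clinear g"
  shows "g (tensor_lift f t) = tensor_lift (\<lambda>a b. g (f a b)) t"
proof -
  have b: "cbilinear (\<lambda>a b. g (f a b))"
    by (rule cbilinearI) (simp_all only: cbilinear_simps[OF assms(1)] clinear_simps[OF assms(2)])
  show ?thesis
    by (rule clinear_tensor_eqI[OF clinear_compose[OF assms(2) clinear_tensor_lift[OF assms(1)]]
        clinear_tensor_lift[OF b]]) (simp add: tensor_lift_tens[OF b] tensor_lift_tens[OF assms(1)])
qed

text \<open>Nested lifts, as in \<open>tensor_mult\<close>, make sense only if the inner lift is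
  bilinear in the variables of the outer one; this supplies that linearity in a parameter.\<close>

lemma clinear_tensor_lift_fun:
  assumes "\<And>x. cbilinear (f x)" "\<And>a b. clinear (\<lambda>x. f x a b)"
  shows "clinear (\<lambda>x. tensor_lift (f x) t)"
proof (rule clinearI)
  fix x y c
  note lin = clinear_add[OF clinear_tensor_lift[OF assms(1)]] and lift_tens = tensor_lift_tens[OF assms(1)]
  show "tensor_lift (f (x + y)) t = tensor_lift (f x) t + tensor_lift (f y) t"
  proof (induction t rule: tensor_induct)
    case (add s t)
    then show ?case unfolding lin by (simp only: add.assoc add.left_commute)
  next
    case (tens a b)
    show ?case unfolding lift_tens by (rule clinear_add[OF assms(2)])
  qed
  show "tensor_lift (f (c *\<^sub>C x)) t = c *\<^sub>C tensor_lift (f x) t"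
  proof (induction t rule: tensor_induct)
    case (add s t)
    then show ?case unfolding lin by (simp only: scaleC_add_right)
  next
    case (tens a b)
    show ?case unfolding lift_tens by (rule clinear_scale[OF assms(2)])
  qed
qed

lemma cbilinear_tensor_mult:
  assumes m: "cbilinear m" and m': "cbilinear m'"
  shows "cbilinear (tensor_mult m m')"
    and tensor_mult_tens: "tensor_mult m m' (a \<otimes>\<^sub>C b) (c \<otimes>\<^sub>C d) = m a c \<otimes>\<^sub>C m' b d"
proof -
  have b1: "cbilinear (\<lambda>c d. m a c \<otimes>\<^sub>C m' b d)" for a b
    by (rule cbilinearI) (simp_all add: cbilinear_simps[OF m] cbilinear_simps[OF m'] tens_simps)
  have b2: "cbilinear (\<lambda>a b. tensor_lift (\<lambda>c d. m a c \<otimes>\<^sub>C m' b d) t)" for t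
    unfolding cbilinear_def
  proof (intro conjI allI)
    have "clinear (\<lambda>b. m a c \<otimes>\<^sub>C m' b d)" "clinear (\<lambda>a. m a c \<otimes>\<^sub>C m' b d)" for a b c d
      by (rule clinearI; simp only: cbilinear_simps[OF m] cbilinear_simps[OF m'] tens_simps)+
    then show "clinear (\<lambda>b. tensor_lift (\<lambda>c d. m a c \<otimes>\<^sub>C m' b d) t)"
      "clinear (\<lambda>a. tensor_lift (\<lambda>c d. m a c \<otimes>\<^sub>C m' b d) t)" for a b
      using clinear_tensor_lift_fun[where f = "\<lambda>b c d. m a c \<otimes>\<^sub>C m' b d", OF b1]
          clinear_tensor_lift_fun[where f = "\<lambda>a c d. m a c \<otimes>\<^sub>C m' b d", OF b1]
      by simp_all
  qed
  show "cbilinear (tensor_mult m m')"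
    unfolding cbilinear_def tensor_mult_def
  proof (intro conjI allI)
    show "clinear (\<lambda>t. tensor_lift (\<lambda>a b. tensor_lift (\<lambda>c d. m a c \<otimes>\<^sub>C m' b d) t) s)" for s
      by (rule clinear_tensor_lift_fun[where f = "\<lambda>t a b. tensor_lift (\<lambda>c d. m a c \<otimes>\<^sub>C m' b d) t", OF b2])
        (rule clinear_tensor_lift[OF b1])
    show "clinear (\<lambda>s. tensor_lift (\<lambda>a b. tensor_lift (\<lambda>c d. m a c \<otimes>\<^sub>C m' b d) t) s)" for t
      by (rule clinear_tensor_lift[OF b2])
  qed
  show "tensor_mult m m' (a \<otimes>\<^sub>C b) (c \<otimes>\<^sub>C d) = m a c \<otimes>\<^sub>C m' b d"
    unfolding tensor_mult_def by (subst tensor_lift_tens[OF b2]) (rule tensor_lift_tens[OF b1])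
qed

section \<open>The complexified lattice and the extension of the form\<close>

lemma cplx_abs_cases: obtains p where "t = abs_cplx p"
  using Quotient_abs_rep[OF Quotient_cplx] by metis

lemma cplx_inc_add: "cplx_inc (\<alpha> + \<beta>) = cplx_inc \<alpha> + cplx_inc \<beta>"
  by transfer (auto simp: cplx_eq_def diff_diff_eq[symmetric] cplx_relators_def
      intro!: complex_vector.span_base)

lemma cplx_induct [case_names add scale inc]:
  assumes "\<And>s t. P s \<Longrightarrow> P t \<Longrightarrow> P (s + t)" "\<And>c s. P s \<Longrightarrow> P (c *\<^sub>C s)" "\<And>\<alpha>. P (cplx_inc \<alpha>)"
  shows "P t"
proof (cases t rule: cplx_abs_cases)
  case (1 p)
  have single: "abs_cplx (single k c) = c *\<^sub>C cplx_inc k" for k :: 'a and c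
    by (simp add: scaleC_cplx.abs_eq cplx_inc.abs_eq scaleC_single scaleC_complex_def del: single_one)
  have "P (abs_cplx p)"
  proof (induction p rule: poly_mapping_induct)
    case zero
    have "abs_cplx 0 = 0 *\<^sub>C cplx_inc (0::'a)" by (simp flip: single)
    then show ?case by (simp only: assms)
  qed (simp_all add: plus_cplx.abs_eq[symmetric] single assms)
  with 1 show ?thesis by simp
qed

lemma clinear_cplx_eqI:
  assumes "clinear f" "clinear g" "\<And>a. f (cplx_inc a) = g (cplx_inc a)"
  shows "f t = g t"
  by (induction t rule: cplx_induct)
    (simp_all only: assms(3) clinear_add[OF assms(1)] clinear_add[OF assms(2)]
      clinear_scale[OF assms(1)] clinear_scale[OF assms(2)])

lemma cplx_lift_ex:
  fixes f :: "'a::ab_group_add \<Rightarrow> 'b::complex_vector"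
  assumes f: "\<And>a b. f (a + b) = f a + f b"
  shows "\<exists>g. clinear g \<and> (\<forall>a. g (cplx_inc a) = f a)"
proof -
  let ?e = "pm_lift f"
  have lin: "clinear ?e" by (rule clinear_pm_lift)
  have rel: "?e r = 0" if "r \<in> cplx_relators" for r
    using that by (auto simp: cplx_relators_def clinear_simps[OF lin] f scaleC_simps simp del: single_one)
  have wd: "?e p = ?e q" if "abs_cplx p = abs_cplx q" for p q
  proof -
    have "p - q \<in> cspan cplx_relators" using that by (simp add: cplx.abs_eq_iff cplx_eq_def)
    then have "?e (p - q) = 0" using clinear_eq_0_on_span[OF lin] rel by blast
    then show ?thesis by (simp add: clinear_simps[OF lin])
  qed
  define g where "g t = ?e (rep_cplx t)" for t
  have g: "g (abs_cplx p) = ?e p" for p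
    unfolding g_def by (rule wd) (rule Quotient_abs_rep[OF Quotient_cplx])
  have "clinear g"
  proof (rule clinearI)
    fix s t :: "'a cplx" and c
    obtain p q where "s = abs_cplx p" "t = abs_cplx q" by (metis cplx_abs_cases)
    then show "g (s + t) = g s + g t" "g (c *\<^sub>C s) = c *\<^sub>C g s"
      by (simp_all add: g scaleC_cplx.abs_eq plus_cplx.abs_eq clinear_simps[OF lin])
  qed
  moreover have "g (cplx_inc a) = f a" for a
    by (simp add: cplx_inc.abs_eq g scaleC_simps del: single_one)
  ultimately show ?thesis by blast
qed

text \<open>The form is extended one argument at a time: \<open>g \<alpha>\<close> extends the
  second argument for each lattice vector, is additive in \<open>\<alpha>\<close> because linear
  maps are determined on the lattice, and can then be extended in the first argument.\<close>

lemma cplx_form: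
  assumes "\<And>\<alpha> \<beta> \<gamma>. form (\<alpha> + \<beta>) \<gamma> = form \<alpha> \<gamma> + form \<beta> \<gamma>"
    and sym: "\<And>\<alpha> \<beta>. form \<alpha> \<beta> = form \<beta> \<alpha>"
  shows cbilinear_cplx_form: "cbilinear (cplx_form form)"
    and cplx_form_inc: "cplx_form form (cplx_inc \<alpha>) (cplx_inc \<beta>) = of_int (form \<alpha> \<beta>)"
proof -
  have add: "form (\<alpha> + \<beta>) \<gamma> = form \<alpha> \<gamma> + form \<beta> \<gamma>" "form \<gamma> (\<alpha> + \<beta>) = form \<gamma> \<alpha> + form \<gamma> \<beta>"
    for \<alpha> \<beta> \<gamma>
    using assms(1)[of \<alpha> \<beta> \<gamma>] sym[of \<gamma> "\<alpha> + \<beta>"] sym[of \<gamma> \<alpha>] sym[of \<gamma> \<beta>] by simp_all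
  have "\<exists>g. clinear g \<and> (\<forall>\<beta>. g (cplx_inc \<beta>) = (of_int (form \<alpha> \<beta>) :: complex))" for \<alpha>
    by (rule cplx_lift_ex) (simp add: add)
  then have "\<exists>g. \<forall>\<alpha>. clinear (g \<alpha>) \<and> (\<forall>\<beta>. g \<alpha> (cplx_inc \<beta>) = (of_int (form \<alpha> \<beta>) :: complex))"
    by (intro choice allI)
  then obtain g where g: "clinear (g \<alpha>)" "g \<alpha> (cplx_inc \<beta>) = (of_int (form \<alpha> \<beta>) :: complex)" for \<alpha> \<beta>
    by blast
  have g_add: "g (\<alpha> + \<alpha>') b = g \<alpha> b + g \<alpha>' b" for \<alpha> \<alpha>' b
    by (rule clinear_cplx_eqI[OF g(1), where g = "\<lambda>b. g \<alpha> b + g \<alpha>' b"])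
      (auto intro!: clinearI simp: g(2) clinear_simps[OF g(1)] scaleC_simps add)
  have "\<exists>h. clinear h \<and> (\<forall>\<alpha>. h (cplx_inc \<alpha>) = g \<alpha> b)" for b
    by (rule cplx_lift_ex) (simp add: g_add)
  then have "\<exists>h. \<forall>b. clinear (h b) \<and> (\<forall>\<alpha>. h b (cplx_inc \<alpha>) = g \<alpha> b)"
    by (intro choice allI)
  then obtain h' where h': "\<And>b. clinear (h' b)" "\<And>b \<alpha>. h' b (cplx_inc \<alpha>) = g \<alpha> b"
    by blast
  define h where "h a b = h' b a" for a b
  have h: "clinear (\<lambda>a. h a b)" "h (cplx_inc \<alpha>) b = g \<alpha> b" for b \<alpha>
    by (simp_all add: h_def h')
  note h1 = clinear_add[OF h(1)] clinear_scale[OF h(1)]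
  have "cbilinear h"
  proof (rule cbilinearI)
    fix a b b' c
    show "h a (b + b') = h a b + h a b'"
      by (rule clinear_cplx_eqI[OF h(1), where g = "\<lambda>a. h a b + h a b'"])
        (auto intro!: clinearI simp: h(2) h1 clinear_simps[OF g(1)] scaleC_simps)
    show "h a (c *\<^sub>C b) = c *\<^sub>C h a b"
      by (rule clinear_cplx_eqI[OF h(1), where g = "\<lambda>a. c *\<^sub>C h a b"])
        (auto intro!: clinearI simp: h(2) h1 clinear_simps[OF g(1)] scaleC_simps mult.commute)
  qed (simp_all add: h1)
  moreover have "h (cplx_inc \<alpha>) (cplx_inc \<beta>) = of_int (form \<alpha> \<beta>)" for \<alpha> \<beta>
    by (simp add: h g)
  moreover have uniq: "k = k'" if "cbilinear k" "\<forall>\<alpha> \<beta>. k (cplx_inc \<alpha>) (cplx_inc \<beta>) = of_int (form \<alpha> \<beta>)"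
    "cbilinear k'" "\<forall>\<alpha> \<beta>. k' (cplx_inc \<alpha>) (cplx_inc \<beta>) = of_int (form \<alpha> \<beta>)"
    for k k' :: "'a cplx \<Rightarrow> 'a cplx \<Rightarrow> complex"
  proof (intro ext)
    fix a b
    have "k (cplx_inc \<alpha>) b = k' (cplx_inc \<alpha>) b" for \<alpha>
      by (rule clinear_cplx_eqI[OF cbilinear_right[OF that(1)] cbilinear_right[OF that(3)]])
        (simp add: that(2,4))
    then show "k a b = k' a b"
      by (rule clinear_cplx_eqI[OF cbilinear_left[OF that(1)] cbilinear_left[OF that(3)]])
  qed
  ultimately have "\<exists>!B. cbilinear B \<and> (\<forall>\<alpha> \<beta>. B (cplx_inc \<alpha>) (cplx_inc \<beta>) = complex_of_int (form \<alpha> \<beta>))"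
    by (intro ex1I[of _ h] conjI allI) (auto intro: uniq)
  from theI'[OF this]
  show "cbilinear (cplx_form form)"
    "cplx_form form (cplx_inc \<alpha>) (cplx_inc \<beta>) = of_int (form \<alpha> \<beta>)"
    unfolding cplx_form_def by auto
qed

section \<open>Symmetric algebras\<close>

text \<open>The type \<open>sym\<close> comes as a vector space and as a ring with no law tying the
  two structures together. The class adds this law, so that the extension results can be stated at
  once for \<open>sym\<close>, for Laurent polynomials over it and for
  \<open>complex\<close>.\<close>

class ccalgebra = complex_vector + comm_ring_1 +
  assumes scaleC_mult_left: "(c *\<^sub>C a) * b = c *\<^sub>C (a * b)"
begin

lemma scaleC_mult_right: "a * (c *\<^sub>C b) = c *\<^sub>C (a * b)"
  using scaleC_mult_left[of c b a] by (simp add: mult.commute)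

end

lemmas scaleC_mult = scaleC_mult_left scaleC_mult_right

instance complex :: ccalgebra
  by standard (simp add: scaleC_complex_def)

instance sym :: (complex_vector) ccalgebra
  by standard (transfer, simp add: sym_eq_def scaleC_eq_single_times mult.assoc ideal_zero)

lemma scaleC_eq_single_zero_times:
  "c *\<^sub>C p = single 0 (c *\<^sub>C 1) * (p :: 'k::comm_monoid_add \<Rightarrow>\<^sub>0 'a::ccalgebra)"
  by (induction p rule: poly_mapping_induct)
    (simp_all add: distrib_left mult_single scaleC_single scaleC_mult_left scaleC_add_right complex_vector.scale_zero_right)

instance poly_mapping :: (comm_monoid_add, ccalgebra) ccalgebra
  by standard (simp only: scaleC_eq_single_zero_times mult.assoc)

lemma sym_abs_cases: obtains p where "t = abs_sym p"
  using Quotient_abs_rep[OF Quotient_sym] by metis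

lemma clinear_abs_sym: "clinear abs_sym"
  by (rule clinearI) (simp_all add: plus_sym.abs_eq scaleC_sym.abs_eq)

lemma clinear_sym_inc: "clinear sym_inc"
proof (rule clinearI)
  fix u v :: 'a and c
  have r: "x \<in> sym_relators \<Longrightarrow> x \<in> module.span (*) sym_relators" for x :: "('a \<Rightarrow>\<^sub>0 nat) \<Rightarrow>\<^sub>0 complex"
    by (rule module.span_base[OF module_mult])
  show "sym_inc (u + v) = sym_inc u + sym_inc v"
    by transfer (simp only: sym_eq_def diff_diff_eq[symmetric], rule r, unfold sym_relators_def, blast)
  show "sym_inc (c *\<^sub>C v) = c *\<^sub>C sym_inc v"
    by transfer (simp only: sym_eq_def, rule r, unfold sym_relators_def, blast)
qed

lemma sym_induct [case_names add scale one mult]: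
  assumes add: "\<And>s t. P s \<Longrightarrow> P t \<Longrightarrow> P (s + t)" and scale: "\<And>c s. P s \<Longrightarrow> P (c *\<^sub>C s)"
    and one: "P 1" and mult: "\<And>v s. P s \<Longrightarrow> P (sym_inc v * s)"
  shows "P (t :: 'v::complex_vector sym)"
proof -
  \<comment> \<open>The statement is for every \<open>s\<close> with \<open>P s\<close>, so that a
    monomial can be peeled off variable by variable, and within one variable exponent by
    exponent.\<close>
  have mono: "P s \<Longrightarrow> P (abs_sym (single k 1) * s)" for k s
  proof (induction k arbitrary: s rule: poly_mapping_induct)
    case zero
    then show ?case by (simp flip: one_sym.abs_eq)
  next
    case (add k l)
    have "abs_sym (single (k + l) 1) * s =
      abs_sym (single k 1) * (abs_sym (single l 1) * s)"
      by (simp add: times_sym.abs_eq mult_single flip: mult.assoc)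
    then show ?case using add by simp
  next
    case (single v n)
    then show ?case
    proof (induction n arbitrary: s)
      case 0
      then show ?case by (simp flip: one_sym.abs_eq)
    next
      case (Suc n)
      have "abs_sym (single (single v (Suc n)) 1) * s =
        sym_inc v * (abs_sym (single (single v n) 1) * s)"
        by (simp add: sym_inc.abs_eq sym_gen_def times_sym.abs_eq mult_single flip: mult.assoc single_add)
      then show ?case using Suc mult by simp
    qed
  qed
  obtain p where t: "t = abs_sym p" by (rule sym_abs_cases)
  have "P (abs_sym p)"
  proof (induction p rule: poly_mapping_induct)
    case zero
    have "abs_sym 0 = 0 *\<^sub>C (1 :: 'v sym)"
      by (simp add: clinear_zero[OF clinear_abs_sym])
    then show ?case using scale[OF one, of 0] by (simp add: complex_vector.scale_zero_left)
  next
    case (add p q)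
    then show ?case using assms(1) by (simp add: clinear_add[OF clinear_abs_sym])
  next
    case (single k c)
    show ?case
      using scale[OF mono[OF one], of c k]
      by (subst single_eq_scaleC) (simp add: clinear_scale[OF clinear_abs_sym] del: single_one)
  qed
  then show ?thesis by (simp add: t)
qed

context
  fixes f :: "'v::complex_vector \<Rightarrow> 'w::complex_vector \<Rightarrow> 'w"
  assumes f: "cbilinear f" and comm: "f a (f b x) = f b (f a x)"
begin

text \<open>The operator attached to the monomial with exponents \<open>n\<close>. The variables
  carry no order, so the product is a fold, well defined because the operators commute. The set
  \<open>A\<close> is kept separate from the support of \<open>n\<close> to let two monomials be
  compared over a common set.\<close>

definition monomial_action :: "'v set \<Rightarrow> ('v \<Rightarrow> nat) \<Rightarrow> 'w \<Rightarrow> 'w" where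
  "monomial_action A n = Finite_Set.fold (\<lambda>v g. (f v ^^ n v) \<circ> g) id A"

lemma funpow_f_comm1: "(f a ^^ i) (f b x) = f b ((f a ^^ i) x)"
  by (induction i) (simp_all add: comm[of b])

lemma funpow_f_comm: "(f a ^^ i) ((f b ^^ j) x) = (f b ^^ j) ((f a ^^ i) x)"
  by (induction j) (simp_all add: funpow_f_comm1)

lemma monomial_action_empty [simp]: "monomial_action {} n = id"
  by (simp add: monomial_action_def)

lemma monomial_action_insert:
  assumes "finite A" "v \<notin> A"
  shows "monomial_action (insert v A) n x = (f v ^^ n v) (monomial_action A n x)"
proof -
  interpret comp_fun_commute "\<lambda>v g. (f v ^^ n v) \<circ> g"
    by standard (simp add: fun_eq_iff funpow_f_comm)
  show ?thesis using assms by (simp add: monomial_action_def)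
qed

lemma monomial_action_comm:
  "finite A \<Longrightarrow> monomial_action A n ((f b ^^ j) x) = (f b ^^ j) (monomial_action A n x)"
  by (induction A rule: finite_induct) (simp_all add: monomial_action_insert funpow_f_comm)

lemma monomial_action_add:
  "finite A \<Longrightarrow> monomial_action A (\<lambda>v. m v + n v) x = monomial_action A m (monomial_action A n x)"
  by (induction A rule: finite_induct)
    (simp_all add: monomial_action_insert monomial_action_comm funpow_add funpow_f_comm)

lemma monomial_action_superset:
  assumes "finite B" "A \<subseteq> B" "\<And>v. v \<in> B - A \<Longrightarrow> n v = 0"
  shows "monomial_action B n x = monomial_action A n x"
proof -
  have "finite C \<Longrightarrow> C \<inter> A = {} \<Longrightarrow> (\<And>v. v \<in> C \<Longrightarrow> n v = 0) \<Longrightarrow>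
    monomial_action (A \<union> C) n x = monomial_action A n x" for C
  proof (induction C rule: finite_induct)
    case (insert v C)
    then show ?case
      using monomial_action_insert[of "A \<union> C" v n x] finite_subset[OF assms(2,1)] by simp
  qed simp
  from this[of "B - A"] show ?thesis using assms
    by (metis Diff_disjoint Diff_partition finite_Diff inf_commute)
qed

lemma clinear_f: "clinear (f v)"
  by (rule cbilinear_right[OF f])

lemma clinear_funpow_f: "clinear (f v ^^ n)"
proof (induction n)
  case (Suc n)
  show ?case
    using clinear_compose[OF clinear_f Suc] by (simp add: o_def)
qed (simp add: clinearI)

lemma clinear_monomial_action: "finite A \<Longrightarrow> clinear (monomial_action A n)"
proof (induction A rule: finite_induct)
  case empty
  then show ?case by (simp add: clinearI)
next
  case (insert v A)
  have "monomial_action (insert v A) n = (\<lambda>x. (f v ^^ n v) (monomial_action A n x))"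
    by (rule ext) (rule monomial_action_insert[OF insert(1,2)])
  then show ?case using clinear_compose[OF clinear_funpow_f insert(3)] by simp
qed

definition poly_action :: "(('v \<Rightarrow>\<^sub>0 nat) \<Rightarrow>\<^sub>0 complex) \<Rightarrow> 'w \<Rightarrow> 'w" where
  "poly_action p x = pm_lift (\<lambda>k. monomial_action (keys k) (lookup k) x) p"

lemma clinear_poly_action: "clinear (\<lambda>p. poly_action p x)" "clinear (poly_action p)"
proof -
  show "clinear (\<lambda>p. poly_action p x)" unfolding poly_action_def by (rule clinear_pm_lift)
  have "clinear (\<lambda>x. poly_action p x)" unfolding poly_action_def
    by (rule clinear_pm_lift_fun) (rule clinear_monomial_action, simp)
  then show "clinear (poly_action p)" by simp
qed

lemma poly_action_single:
  "poly_action (single k 1) x = monomial_action (keys k) (lookup k) x"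
  by (simp add: poly_action_def scaleC_one del: single_one)

lemma poly_action_one: "poly_action 1 x = x"
  using poly_action_single[of 0 x] by simp

lemma poly_action_gen: "poly_action (sym_gen v) x = f v x"
  by (simp add: sym_gen_def poly_action_single monomial_action_insert)

lemma poly_action_mult: "poly_action (p * q) x = poly_action p (poly_action q x)"
proof -
  have s: "poly_action (single k 1 * single l 1) x =
    poly_action (single k 1) (poly_action (single l 1) x)" for k l
  proof -
    let ?A = "keys k \<union> keys l"
    have *: "monomial_action (keys j) (lookup j) y =
      monomial_action ?A (lookup j) y" if "keys j \<subseteq> ?A" for j y
      by (rule monomial_action_superset[symmetric]) (use that in \<open>auto simp: in_keys_iff\<close>)
    have "lookup (k + l) = (\<lambda>v. lookup k v + lookup l v)"
      by (simp add: fun_eq_iff lookup_add)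
    then show ?thesis
      unfolding poly_action_single mult_single mult_1 *[OF keys_add] *[OF Un_upper1] *[OF Un_upper2]
      by (simp only: monomial_action_add[symmetric] finite_keys finite_UnI)
  qed
  have "poly_action (single k 1 * q) x = poly_action (single k 1) (poly_action q x)" for k
  proof (rule clinear_pm_eqI[where f = "\<lambda>q. poly_action (single k 1 * q) x"])
    show "clinear (\<lambda>q. poly_action (single k 1 * q) x)"
      by (rule clinearI) (simp_all only: clinear_simps[OF clinear_poly_action(1)] distrib_left scaleC_mult)
    show "clinear (\<lambda>q. poly_action (single k 1) (poly_action q x))"
      by (rule clinearI) (simp_all only: clinear_simps[OF clinear_poly_action(1)] clinear_simps[OF clinear_poly_action(2)])
  qed (rule s)
  moreover have "clinear (\<lambda>p. poly_action (p * q) x)"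
    by (rule clinearI) (simp_all only: clinear_simps[OF clinear_poly_action(1)] distrib_right scaleC_mult)
  moreover have "clinear (\<lambda>p. poly_action p (poly_action q x))"
    by (rule clinear_poly_action)
  ultimately show ?thesis
    using clinear_pm_eqI[where f = "\<lambda>p. poly_action (p * q) x" and g = "\<lambda>p. poly_action p (poly_action q x)"]
    by blast
qed

text \<open>Because the action is multiplicative, the polynomials that act by zero form an ideal;
  linearity of \<open>f\<close> in its first argument puts the relators into it.\<close>

lemma poly_action_cong: "abs_sym p = abs_sym q \<Longrightarrow> poly_action p x = poly_action q x"
proof -
  note lin = clinear_poly_action(1)
  let ?N = "{p. \<forall>x. poly_action p x = 0}"
  have sub: "module.subspace (*) ?N"
    by (rule module.subspaceI[OF module_mult])
      (simp_all add: clinear_simps[OF lin] poly_action_mult clinear_simps[OF clinear_poly_action(2)])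
  have "sym_relators \<subseteq> ?N"
    by (auto simp: sym_relators_def clinear_simps[OF lin] poly_action_gen cbilinear_simps[OF f])
  then have span: "module.span (*) sym_relators \<subseteq> ?N"
    by (rule module.span_minimal[OF module_mult _ sub])
  assume "abs_sym p = abs_sym q"
  then have "p - q \<in> module.span (*) sym_relators"
    by (simp add: sym.abs_eq_iff sym_eq_def)
  then show ?thesis using span clinear_diff[OF lin, of p q x] by auto
qed

lemma sym_action_ex:
  "\<exists>g. cbilinear g \<and> (\<forall>x. g 1 x = x) \<and> (\<forall>s t x. g (s * t) x = g s (g t x)) \<and> (\<forall>v x. g (sym_inc v) x = f v x)"
proof -
  define g where "g t = poly_action (rep_sym t)" for t
  have g: "g (abs_sym p) x = poly_action p x" for p x
    unfolding g_def by (rule poly_action_cong) (rule Quotient_abs_rep[OF Quotient_sym])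
  have "cbilinear g"
  proof (rule cbilinearI)
    fix s t :: "'v sym" and x c
    obtain p q where "s = abs_sym p" "t = abs_sym q" by (metis sym_abs_cases)
    then show "g (s + t) x = g s x + g t x" "g (c *\<^sub>C s) x = c *\<^sub>C g s x"
      by (simp_all add: g plus_sym.abs_eq scaleC_sym.abs_eq clinear_simps[OF clinear_poly_action(1)])
  qed (simp_all add: g_def clinear_simps[OF clinear_poly_action(2)])
  moreover have "g 1 x = x" for x
    by (simp add: one_sym.abs_eq g poly_action_one)
  moreover have "g (s * t) x = g s (g t x)" for s t x
  proof -
    obtain p q where "s = abs_sym p" "t = abs_sym q" by (metis sym_abs_cases)
    then show ?thesis by (simp add: times_sym.abs_eq g poly_action_mult)
  qed
  moreover have "g (sym_inc v) x = f v x" for v x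
    by (simp add: sym_inc.abs_eq g poly_action_gen)
  ultimately show ?thesis by blast
qed

end

section \<open>Homomorphisms and derivations out of a symmetric algebra\<close>

lemma sym_hom_ex:
  fixes k :: "'v::complex_vector \<Rightarrow> 'a::ccalgebra"
  assumes k: "clinear k"
  shows "\<exists>h. clinear h \<and> h 1 = 1 \<and> (\<forall>s t. h (s * t) = h s * h t) \<and> (\<forall>v. h (sym_inc v) = k v)"
proof -
  have b: "cbilinear (\<lambda>v x. k v * x)"
    by (rule cbilinearI) (simp_all add: clinear_simps[OF k] algebra_simps scaleC_mult)
  obtain g where g: "cbilinear g" "\<And>x. g 1 x = x" "\<And>s t x. g (s * t) x = g s (g t x)"
    "\<And>v x. g (sym_inc v) x = k v * x"
    using sym_action_ex[OF b] mult.left_commute by metis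
  \<comment> \<open>The action commutes with multiplication by elements of the target, so it is
    multiplication by its value at 1. That value is the homomorphism sought.\<close>
  have mult: "g s x = g s 1 * x" for s x
    by (induction s rule: sym_induct)
      (simp_all add: g cbilinear_simps[OF g(1)] distrib_right scaleC_mult mult.assoc)
  have "g (s * t) 1 = g s 1 * g t 1" for s t
    by (simp add: g(3)) (rule mult)
  then show ?thesis
    by (intro exI[of _ "\<lambda>s. g s 1"]) (simp add: g cbilinear_left[OF g(1)])
qed

text \<open>Derivations of S[x,1/x] need not preserve S, so the Leibniz rule is taken along a
  homomorphism \<open>h\<close>. The case of the identity gives derivations of S, and
  \<open>h = lconst\<close> gives maps that extend to x-linear derivations of Laurent
  polynomials.\<close>

lemma sym_hom_deriv_ex:
  fixes d :: "'v::complex_vector \<Rightarrow> 'a::ccalgebra"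
  assumes h: "clinear h" "h 1 = 1" "\<And>s t. h (s * t) = h s * h t" and d: "clinear d"
  shows "\<exists>D. clinear D \<and> (\<forall>s t. D (s * t) = D s * h t + h s * D t) \<and> (\<forall>v. D (sym_inc v) = d v)"
proof -
  \<comment> \<open>Pairs are dual numbers: \<open>s\<close> is to act as multiplication by \<open>h s + D s \<cdot> \<epsilon>\<close>.\<close>
  define f where "f v p = (h (sym_inc v) * fst p, h (sym_inc v) * snd p + d v * fst p)" for v p
  note hi = clinear_compose[OF h(1) clinear_sym_inc]
  have b: "cbilinear f"
    by (rule cbilinearI)
      (simp_all add: f_def prod_eq_iff clinear_simps[OF hi] clinear_simps[OF d] algebra_simps scaleC_mult scaleC_add_right)
  have comm: "f a (f b x) = f b (f a x)" for a b x
    by (simp add: f_def prod_eq_iff algebra_simps)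
  obtain g where g: "cbilinear g" "\<And>x. g 1 x = x" "\<And>s t x. g (s * t) x = g s (g t x)"
    "\<And>v x. g (sym_inc v) x = f v x"
    using sym_action_ex[OF b comm] by blast
  define D where "D s = snd (g s (1, 0))" for s
  have D_simps: "D (s + t) = D s + D t" "D (c *\<^sub>C s) = c *\<^sub>C D s" "D 1 = 0"
    "D (sym_inc v * s) = snd (f v (g s (1, 0)))" for s t c v
    by (simp_all add: D_def g cbilinear_simps[OF g(1)])
  have D: "g s p = (h s * fst p, h s * snd p + D s * fst p)" for s p
  proof (induction s arbitrary: p rule: sym_induct)
    case (add s t)
    then show ?case by (simp add: cbilinear_simps[OF g(1)] D_simps clinear_simps[OF h(1)] algebra_simps)
  next
    case (scale c s)
    then show ?case
      by (simp add: cbilinear_simps[OF g(1)] D_simps clinear_simps[OF h(1)] scaleC_mult scaleC_prod_def scaleC_add_right)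
  next
    case one
    show ?case by (simp add: g D_simps h)
  next
    case (mult v s)
    then show ?case by (simp add: g(3,4) f_def D_simps h(3)) (simp add: algebra_simps)
  qed
  have "clinear D"
    by (rule clinearI) (simp_all add: D_simps)
  moreover have "D (s * t) = D s * h t + h s * D t" for s t
    using D[of s "g t (1,0)"] D[of t "(1,0)"] by (simp add: D_def[of "s * t"] g(3))
  moreover have "D (sym_inc v) = d v" for v
    by (simp add: D_def g(4) f_def)
  ultimately show ?thesis by blast
qed

lemma sym_derivation_ex1:
  assumes "clinear d"
  shows "\<exists>!D. sym_derivation D \<and> (\<forall>v. D (sym_inc v) = d v)"
proof -
  have id: "clinear (\<lambda>x :: 'a sym. x)" by (rule clinearI) simp_all
  obtain D where "clinear D" "\<And>s t. D (s * t) = D s * t + s * D t" "\<And>v. D (sym_inc v) = d v"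
    using sym_hom_deriv_ex[OF id _ _ assms] by auto
  moreover have "D s = D' s" if "sym_derivation D" "sym_derivation D'" "\<And>v. D (sym_inc v) = D' (sym_inc v)"
    for D D' :: "'a sym \<Rightarrow> 'a sym" and s
  proof -
    have lin: "clinear D" "clinear D'" and m: "D (a * b) = D a * b + a * D b" "D' (a * b) = D' a * b + a * D' b" for a b
      using that by (auto simp: sym_derivation_def)
    have one: "D 1 = 0" "D' 1 = 0" using m(1)[of 1 1] m(2)[of 1 1] by simp_all
    show ?thesis
      by (induction s rule: sym_induct)
        (simp_all add: clinear_simps[OF lin(1)] clinear_simps[OF lin(2)] m one that(3))
  qed
  ultimately show ?thesis
    by (intro ex1I[of _ D]) (auto simp: sym_derivation_def)
qed

section \<open>Laurent polynomials with coefficients in a symmetric algebra\<close>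

text \<open>Unlike in \<open>pm_lift\<close>, coefficients lie in an arbitrary vector space, so they
  are fed to \<open>F k\<close> instead of scaling it.\<close>

definition pm_ext :: "('k \<Rightarrow> 'a::comm_monoid_add \<Rightarrow> 'b::comm_monoid_add) \<Rightarrow> ('k \<Rightarrow>\<^sub>0 'a) \<Rightarrow> 'b" where
  "pm_ext F p = (\<Sum>k\<in>keys p. F k (lookup p k))"

lemma pm_ext:
  assumes "\<And>k. clinear (F k)"
  shows clinear_pm_ext: "clinear (pm_ext F)"
    and pm_ext_single: "pm_ext F (single k u) = F k u"
proof -
  have sup: "pm_ext F p = (\<Sum>k\<in>A. F k (lookup p k))"
    if "finite A" "keys p \<subseteq> A" for A p
    unfolding pm_ext_def using that
    by (intro sum.mono_neutral_left) (auto simp: in_keys_iff clinear_zero[OF assms])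
  show "clinear (pm_ext F)"
  proof (rule clinearI)
    fix p q :: "'a \<Rightarrow>\<^sub>0 'b" and c
    let ?A = "keys p \<union> keys q"
    show "pm_ext F (p + q) = pm_ext F p + pm_ext F q"
      by (simp add: sup[of ?A] keys_add lookup_add clinear_add[OF assms] sum.distrib)
    have "keys (c *\<^sub>C p) \<subseteq> keys p"
      by (auto simp: in_keys_iff scaleC_simps)
    then show "pm_ext F (c *\<^sub>C p) = c *\<^sub>C pm_ext F p"
      by (simp add: sup[of "keys p"] clinear_scale[OF assms] complex_vector.scale_sum_right)
  qed
  show "pm_ext F (single k u) = F k u"
    by (simp add: sup[of "{k}"])
qed

lemma clinear_single: "clinear (single k)"
  by (rule clinearI) (simp_all add: single_add scaleC_single)

abbreviation lconst :: "'a::zero \<Rightarrow> int \<Rightarrow>\<^sub>0 'a" where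
  "lconst u \<equiv> single 0 u"

abbreviation xpow :: "int \<Rightarrow> int \<Rightarrow>\<^sub>0 'a::zero_neq_one" where
  "xpow n \<equiv> single n 1"

lemma single_split: "single n u = xpow n * lconst (u :: 'a::comm_ring_1)"
  by (simp add: mult_single)

lemma xpow_mult: "xpow m * xpow n = (xpow (m + n) :: int \<Rightarrow>\<^sub>0 'a::comm_ring_1)"
  by (simp add: mult_single)

definition derivation :: "('a::ccalgebra \<Rightarrow> 'a) \<Rightarrow> bool" where
  "derivation D \<longleftrightarrow> clinear D \<and> (\<forall>a b. D (a * b) = D a * b + a * D b)"

lemma derivation_clinear: "derivation D \<Longrightarrow> clinear D"
  and derivation_mult: "derivation D \<Longrightarrow> D (a * b) = D a * b + a * D b"
  by (auto simp: derivation_def)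

lemma sym_derivation_iff: "sym_derivation = derivation"
  by (rule ext) (simp add: sym_derivation_def derivation_def)

lemma derivation_one: "derivation D \<Longrightarrow> D 1 = 0"
  using derivation_mult[of D 1 1] by simp

lemmas derivation_simps = clinear_add[OF derivation_clinear] clinear_scale[OF derivation_clinear]
  clinear_diff[OF derivation_clinear] clinear_zero[OF derivation_clinear]
  clinear_minus[OF derivation_clinear]
  derivation_mult derivation_one

text \<open>The x-linear extension of \<open>d\<close>. It turns homomorphisms on the coefficients
  into homomorphisms, and derivations along \<open>lconst\<close> into derivations.\<close>

definition xlift :: "('a \<Rightarrow> int \<Rightarrow>\<^sub>0 'b) \<Rightarrow> (int \<Rightarrow>\<^sub>0 'a::ccalgebra) \<Rightarrow> int \<Rightarrow>\<^sub>0 'b::ccalgebra" where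
  "xlift d = pm_ext (\<lambda>n u. xpow n * d u)"

lemma xlift:
  fixes d :: "'a::ccalgebra \<Rightarrow> int \<Rightarrow>\<^sub>0 'b::ccalgebra"
  assumes d: "clinear d"
  shows clinear_xlift: "clinear (xlift d)"
    and xlift_single: "xlift d (single n u) = xpow n * d u"
proof -
  have "clinear (\<lambda>u. xpow n * d u)" for n
    by (rule clinearI) (simp_all add: clinear_simps[OF d] distrib_left scaleC_mult)
  note pm = pm_ext[where F = "\<lambda>n u. xpow n * d u", OF this]
  show "clinear (xlift d)" "xlift d (single n u) = xpow n * d u"
    unfolding xlift_def by (rule pm)+
qed

lemma pm_bilinear_induct:
  fixes p q :: "'k \<Rightarrow>\<^sub>0 'a::comm_monoid_add"
  assumes "\<And>p p' q. P p q \<Longrightarrow> P p' q \<Longrightarrow> P (p + p') q" "\<And>p q q'. P p q \<Longrightarrow> P p q' \<Longrightarrow> P p (q + q')"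
    "\<And>k u l v. P (single k u) (single l v)"
  shows "P p q"
proof -
  have "P (single k u) q" for k u
    by (induction q rule: poly_mapping_induct) (use assms(2,3) assms(3)[of k u undefined 0] in simp_all)
  then show ?thesis
    by (induction p rule: poly_mapping_induct) (use assms(1) single_zero in metis)+
qed

lemma xlift_hom:
  assumes d: "clinear d" and m: "\<And>s t. d (s * t) = d s * d t"
  shows "xlift d (p * q) = xlift d p * xlift d q"
proof (induction p q rule: pm_bilinear_induct)
  case (3 k u l v)
  show ?case
    unfolding mult_single[of k u l v] xlift_single[OF d] m xpow_mult[symmetric] by (simp only: mult_ac)
qed (simp_all add: clinear_simps[OF clinear_xlift[OF d]] algebra_simps)

lemma xlift_derivation:
  assumes d: "clinear d" and m: "\<And>s t. d (s * t) = d s * lconst t + lconst s * d t"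
  shows "derivation (xlift d)"
proof -
  have "xlift d (p * q) = xlift d p * q + p * xlift d q" for p q
  proof (induction p q rule: pm_bilinear_induct)
    case (3 k u l v)
    show ?case unfolding mult_single xlift_single[OF d] m
      unfolding single_split[of k u] single_split[of l v] xpow_mult[symmetric]
      by (simp only: algebra_simps)
  qed (simp_all add: clinear_simps[OF clinear_xlift[OF d]] algebra_simps)
  then show ?thesis by (simp add: derivation_def clinear_xlift[OF d])
qed

definition ddx :: "(int \<Rightarrow>\<^sub>0 'a::complex_vector) \<Rightarrow> int \<Rightarrow>\<^sub>0 'a" where
  "ddx = pm_ext (\<lambda>n u. single (n - 1) (of_int n *\<^sub>C u))"

lemma ddx:
  fixes u :: "'a::complex_vector"
  shows clinear_ddx: "clinear (ddx :: (int \<Rightarrow>\<^sub>0 'a) \<Rightarrow> _)"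
    and ddx_single: "ddx (single n u) = single (n - 1) (of_int n *\<^sub>C u)"
proof -
  have "clinear (\<lambda>u :: 'a. single (n - 1) (of_int n *\<^sub>C u))" for n :: int
    by (rule clinearI) (simp_all add: scaleC_simps single_add scaleC_single mult.commute)
  note pm = pm_ext[where F = "\<lambda>n (u :: 'a). single (n - 1) (of_int n *\<^sub>C u)", OF this]
  show "clinear (ddx :: (int \<Rightarrow>\<^sub>0 'a) \<Rightarrow> _)"
    "ddx (single n u) = single (n - 1) (of_int n *\<^sub>C u)"
    unfolding ddx_def by (rule pm)+
qed

lemma ddx_derivation: "derivation (ddx :: (int \<Rightarrow>\<^sub>0 'a::ccalgebra) \<Rightarrow> _)"
proof -
  have "ddx (p * q) = ddx p * q + p * ddx q" for p q :: "int \<Rightarrow>\<^sub>0 'a"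
  proof (induction p q rule: pm_bilinear_induct)
    case (3 k u l v)
    show ?case
      by (simp add: mult_single ddx_single scaleC_mult scaleC_add_left diff_add_eq add_diff_eq flip: single_add)
  qed (simp_all add: clinear_simps[OF clinear_ddx] algebra_simps)
  then show ?thesis by (simp add: derivation_def clinear_ddx)
qed

lemma ddx_xpow: "ddx (xpow n :: int \<Rightarrow>\<^sub>0 'a::ccalgebra) = of_int n *\<^sub>C xpow (n - 1)"
  by (simp add: ddx_single scaleC_single)

lemma ddx_lconst: "ddx (lconst u) = 0"
  by (simp add: ddx_single complex_vector.scale_zero_left)

section \<open>Modes h(-n) and derivations of their symmetric algebra\<close>

definition hm_lift :: "(nat \<Rightarrow> 'l cplx \<Rightarrow> 'c) \<Rightarrow> 'l::ab_group_add hminus \<Rightarrow> 'c::complex_vector" where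
  "hm_lift F = tensor_lift (\<lambda>h. pm_lift (\<lambda>k. F k h))"

text \<open>Prescribing a map mode by mode determines it. The index is shifted: \<open>F k\<close>
  is the value on h(-k-1), because the basis vector of index \<open>k\<close> stands for the power
  -k-1 of t.\<close>

lemma hm_lift:
  assumes "\<And>k. clinear (F k)"
  shows clinear_hm_lift: "clinear (hm_lift F)"
    and hm_lift_tens: "hm_lift F (h \<otimes>\<^sub>C single k 1) = F k h"
proof -
  have b: "cbilinear (\<lambda>h. pm_lift (\<lambda>k. F k h))"
    unfolding cbilinear_def
    by (auto intro: clinear_pm_lift clinear_pm_lift_fun[where F = "\<lambda>h k. F k h", OF assms])
  show "clinear (hm_lift F)" unfolding hm_lift_def by (rule clinear_tensor_lift[OF b])
  show "hm_lift F (h \<otimes>\<^sub>C single k 1) = F k h"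
    by (simp add: hm_lift_def tensor_lift_tens[OF b] scaleC_one del: single_one)
qed

text \<open>\<open>osc \<alpha> k\<close> is \<open>\<alpha>(-k-1)\<close>.\<close>

definition osc :: "'l::ab_group_add \<Rightarrow> nat \<Rightarrow> 'l hminus" where
  "osc \<alpha> k = cplx_inc \<alpha> \<otimes>\<^sub>C single k 1"

lemma hneg_osc: "hneg (cplx_inc \<alpha>) (Suc k) = sym_inc (osc \<alpha> k)"
  by (simp add: hneg_def osc_def)

lemma clinear_hneg: "clinear (\<lambda>h. hneg h n)"
  unfolding hneg_def
  by (rule clinear_compose[OF clinear_sym_inc cbilinear_left[OF cbilinear_tens]])

lemma osc_add: "osc (\<alpha> + \<beta>) k = osc \<alpha> k + osc \<beta> k"
  by (simp add: osc_def cplx_inc_add tens_simps)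

lemma osc_zero: "osc 0 k = 0"
  using osc_add[of 0 0 k] by simp

lemma hminus_induct [case_names add scale osc]:
  assumes add: "\<And>s t. P s \<Longrightarrow> P t \<Longrightarrow> P (s + t)" and scale: "\<And>c s. P s \<Longrightarrow> P (c *\<^sub>C s)"
    and osc: "\<And>\<alpha> k. P (osc \<alpha> k)"
  shows "P (t :: 'l::ab_group_add hminus)"
proof (induction t rule: tensor_induct)
  case (tens h p)
  have "P (h \<otimes>\<^sub>C single k 1)" for k
    by (induction h rule: cplx_induct) (use assms in \<open>simp_all add: tens_simps osc_def\<close>)
  then have s: "P (h \<otimes>\<^sub>C single k c)" for k c
    by (subst single_eq_scaleC) (simp add: tens_simps scale del: single_one)
  show ?case
    by (induction p rule: poly_mapping_induct) (use s[of 0 0] s add in \<open>simp_all add: tens_simps\<close>)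
qed (rule add)

lemma clinear_hminus_eqI:
  assumes "clinear f" "clinear g" "\<And>\<alpha> k. f (osc \<alpha> k) = g (osc \<alpha> k)"
  shows "f (t :: 'l::ab_group_add hminus) = g t"
  by (induction t rule: hminus_induct)
    (simp_all only: assms(3) clinear_add[OF assms(1)] clinear_add[OF assms(2)]
      clinear_scale[OF assms(1)] clinear_scale[OF assms(2)])

lemma heis_induct [case_names add scale one mult]:
  assumes add: "\<And>s t. P s \<Longrightarrow> P t \<Longrightarrow> P (s + t)" and scale: "\<And>c s. P s \<Longrightarrow> P (c *\<^sub>C s)"
    and one: "P 1" and mult: "\<And>\<alpha> k s. P s \<Longrightarrow> P (sym_inc (osc \<alpha> k) * s)"
  shows "P (u :: 'l::ab_group_add heis)"
proof (induction u rule: sym_induct)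
  case (mult v s)
  show ?case
    by (induction v rule: hminus_induct)
      (use mult assms in \<open>simp_all add: clinear_simps[OF clinear_sym_inc] distrib_right scaleC_mult\<close>)
qed (use assms in auto)

lemma laurent_induct [case_names add scale xpow mult]:
  fixes p :: "int \<Rightarrow>\<^sub>0 'l::ab_group_add heis"
  assumes add: "\<And>s t. P s \<Longrightarrow> P t \<Longrightarrow> P (s + t)" and scale: "\<And>c s. P s \<Longrightarrow> P (c *\<^sub>C s)"
    and one: "\<And>n. P (xpow n)" and mult: "\<And>\<alpha> k s. P s \<Longrightarrow> P (lconst (sym_inc (osc \<alpha> k)) * s)"
  shows "P p"
proof (induction p rule: poly_mapping_induct)
  case zero
  show ?case using scale[OF one, of 0] by (simp add: complex_vector.scale_zero_left)
next
  case (single n u)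
  show ?case
  proof (induction u rule: heis_induct)
    case (mult \<alpha> k s)
    then show ?case using assms(4)[OF mult] by (simp add: mult_single)
  qed (use assms in \<open>simp_all add: single_add flip: scaleC_single\<close>)
qed (rule add)

text \<open>Both \<open>heis_trans\<close> and the positive \<open>heis_mode\<close> are
  descriptions of this shape. Prescribing values on all h(-n) with n at least 1 amounts to
  prescribing one linear map on \<open>hminus\<close>, and for such data a derivation exists
  uniquely.\<close>

lemma heis_derivation:
  fixes F :: "nat \<Rightarrow> 'l::ab_group_add cplx \<Rightarrow> 'l heis"
  assumes F: "\<And>k. clinear (F k)"
  defines "D \<equiv> (THE D. sym_derivation D \<and> (\<forall>h. \<forall>n\<ge>1. D (hneg h n) = F n h))"
  shows "derivation D" and "D (sym_inc (osc \<alpha> k)) = F (Suc k) (cplx_inc \<alpha>)"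
proof -
  have iff: "(\<forall>h. \<forall>n\<ge>1. D (hneg h n) = F n h) \<longleftrightarrow>
    (\<forall>v. D (sym_inc v) = hm_lift (\<lambda>k. F (Suc k)) v)" if "sym_derivation D" for D
  proof
    assume *: "\<forall>h. \<forall>n\<ge>1. D (hneg h n) = F n h"
    have lin: "clinear (\<lambda>v. D (sym_inc v))"
      using that by (intro clinear_compose[OF _ clinear_sym_inc]) (simp add: sym_derivation_def)
    have "D (sym_inc (osc \<alpha> k)) = F (Suc k) (cplx_inc \<alpha>)" for \<alpha> k
      using *[rule_format, of "Suc k" "cplx_inc \<alpha>"] by (simp add: hneg_osc)
    moreover have "hm_lift (\<lambda>k. F (Suc k)) (osc \<alpha> k) = F (Suc k) (cplx_inc \<alpha>)" for \<alpha> k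
      unfolding osc_def by (rule hm_lift_tens) (rule F)
    ultimately show "\<forall>v. D (sym_inc v) = hm_lift (\<lambda>k. F (Suc k)) v"
      using clinear_hminus_eqI[OF lin clinear_hm_lift[of "\<lambda>k. F (Suc k)", OF F]] by metis
  next
    assume "\<forall>v. D (sym_inc v) = hm_lift (\<lambda>k. F (Suc k)) v"
    then show "\<forall>h. \<forall>n\<ge>1. D (hneg h n) = F n h"
      by (auto simp: hneg_def hm_lift_tens[of "\<lambda>k. F (Suc k)", OF F] simp del: single_one)
  qed
  have "\<exists>!D. sym_derivation D \<and> (\<forall>v. D (sym_inc v) = hm_lift (\<lambda>k. F (Suc k)) v)"
    by (rule sym_derivation_ex1) (rule clinear_hm_lift, rule F)
  then have "\<exists>!D. sym_derivation D \<and> (\<forall>h. \<forall>n\<ge>1. D (hneg h n) = F n h)"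
    using iff by metis
  from theI'[OF this] have "sym_derivation D \<and> (\<forall>h. \<forall>n\<ge>1. D (hneg h n) = F n h)"
    unfolding D_def .
  then show "derivation D" "D (sym_inc (osc \<alpha> k)) = F (Suc k) (cplx_inc \<alpha>)"
    by (simp_all add: sym_derivation_iff flip: hneg_osc)
qed

lemma heis_trans:
  fixes \<alpha> :: "'a::ab_group_add"
  shows derivation_heis_trans: "derivation (heis_trans :: 'a heis \<Rightarrow> _)"
    and heis_trans_osc: "heis_trans (sym_inc (osc \<alpha> k)) = of_nat (Suc k) *\<^sub>C sym_inc (osc \<alpha> (Suc k))"
proof -
  have "clinear (\<lambda>h :: 'a cplx. of_nat n *\<^sub>C hneg h (n + 1))" for n
    by (rule clinearI) (simp_all add: clinear_simps[OF clinear_hneg] scaleC_simps mult.commute)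
  note * = heis_derivation[of "\<lambda>n h. of_nat n *\<^sub>C hneg h (n + 1)", OF this, folded heis_trans_def]
  show "derivation (heis_trans :: 'a heis \<Rightarrow> _)" by (rule *)
  show "heis_trans (sym_inc (osc \<alpha> k)) = of_nat (Suc k) *\<^sub>C sym_inc (osc \<alpha> (Suc k))"
    using *(2) by (simp add: hneg_osc del: of_nat_Suc)
qed

lemmas heis_trans_simps = derivation_simps[OF derivation_heis_trans] heis_trans_osc

text \<open>Commutation relations between derivations thereby become equalities of derivations,
  which only need checking on powers of x and on the generators.\<close>

lemma derivation_commutator:
  assumes D: "derivation D" and D': "derivation D'"
  shows "derivation (\<lambda>p. D (D' p) - D' (D p))"
  unfolding derivation_def
  by (intro conjI allI clinearI)
    (simp_all add: derivation_simps[OF D] derivation_simps[OF D'] scaleC_simps algebra_simps)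

lemma derivation_diff:
  assumes D: "derivation D" and D': "derivation D'"
  shows "derivation (\<lambda>p. D p - D' p)"
  unfolding derivation_def
  by (intro conjI allI clinearI)
    (simp_all add: derivation_simps[OF D] derivation_simps[OF D'] scaleC_simps algebra_simps)

lemma derivation_scale:
  assumes D: "derivation D"
  shows "derivation (\<lambda>p. c *\<^sub>C D p)"
  unfolding derivation_def
  by (intro conjI allI clinearI)
    (simp_all add: derivation_simps[OF D] scaleC_simps scaleC_mult mult.commute)

lemma derivation_zero: "derivation (\<lambda>p. 0)"
  by (auto simp: derivation_def scaleC_simps intro: clinearI)

type_synonym 'l laurent = "int \<Rightarrow>\<^sub>0 'l heis"

abbreviation gen :: "'l::ab_group_add \<Rightarrow> nat \<Rightarrow> 'l laurent" where
  "gen \<beta> j \<equiv> lconst (sym_inc (osc \<beta> j))"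

lemma derivation_laurent_eqI:
  assumes D: "derivation D" and D': "derivation D'"
    and eq: "\<And>n. D (xpow n) = D' (xpow n)" "\<And>\<beta> j. D (gen \<beta> j) = D' (gen \<beta> j)"
  shows "D (p :: 'l::ab_group_add laurent) = D' p"
  by (induction p rule: laurent_induct)
    (simp_all add: derivation_simps[OF D] derivation_simps[OF D'] eq)

lemma clinear_lconst_sym_inc: "clinear (\<lambda>v. lconst (sym_inc v))"
  by (rule clinear_compose[OF clinear_single clinear_sym_inc])

lemma laurent_hom_ex:
  fixes k :: "'v::complex_vector \<Rightarrow> int \<Rightarrow>\<^sub>0 'v sym"
  assumes "clinear k"
  shows "\<exists>E. clinear E \<and> (\<forall>p q. E (p * q) = E p * E q) \<and> (\<forall>n. E (xpow n) = xpow n) \<and>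
    (\<forall>v. E (lconst (sym_inc v)) = k v)"
proof -
  obtain h where h: "clinear h" "h 1 = 1" "\<And>s t. h (s * t) = h s * h t" "\<And>v. h (sym_inc v) = k v"
    using sym_hom_ex[OF assms] by blast
  show ?thesis
    by (rule exI[of _ "xlift h"])
      (simp add: clinear_xlift[OF h(1)] xlift_hom[OF h(1,3)] xlift_single[OF h(1)] h(2,4))
qed

lemma laurent_derivation_ex:
  fixes k :: "'v::complex_vector \<Rightarrow> int \<Rightarrow>\<^sub>0 'v sym"
  assumes "clinear k"
  shows "\<exists>D. derivation D \<and> (\<forall>n. D (xpow n) = 0) \<and> (\<forall>v. D (lconst (sym_inc v)) = k v)"
proof -
  have m: "lconst (s * t) = lconst s * lconst t" for s t :: "'v sym" by (simp add: mult_single)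
  obtain d where d: "clinear d" "\<And>s t. d (s * t) = d s * lconst t + lconst s * d t" "\<And>v. d (sym_inc v) = k v"
    using sym_hom_deriv_ex[of lconst, OF clinear_single single_one m assms] by blast
  have "d 1 = 0" using d(2)[of 1 1] by simp
  then show ?thesis
    by (intro exI[of _ "xlift d"])
      (simp add: xlift_derivation[OF d(1,2)] xlift_single[OF d(1)] d(3))
qed

definition coeff_trans :: "'l::ab_group_add laurent \<Rightarrow> 'l laurent" where
  "coeff_trans = xlift (\<lambda>u. lconst (heis_trans u))"

lemma coeff_trans:
  shows derivation_coeff_trans: "derivation (coeff_trans :: 'l::ab_group_add laurent \<Rightarrow> _)"
    and coeff_trans_single: "coeff_trans (single n u) = single n (heis_trans u)"
proof -
  have lin: "clinear (\<lambda>u :: 'b::ab_group_add heis. lconst (heis_trans u))"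
    by (rule clinear_compose[OF clinear_single derivation_clinear[OF derivation_heis_trans]])
  show "derivation (coeff_trans :: 'l laurent \<Rightarrow> _)"
    unfolding coeff_trans_def
    by (rule xlift_derivation[OF lin]) (simp add: heis_trans_simps mult_single single_add)
  show "coeff_trans (single n u) = single n (heis_trans u)"
    by (simp add: coeff_trans_def xlift_single[OF lin] mult_single)
qed

text \<open>The part of L(-1) - d/dx common to all components; it is a derivation, and the component
  of \<open>e_basis \<beta>\<close> adds multiplication by \<beta>(-1).\<close>

definition dtot :: "'l::ab_group_add laurent \<Rightarrow> 'l laurent" where
  "dtot p = coeff_trans p - ddx p"

lemma derivation_dtot: "derivation dtot"
  unfolding dtot_def by (rule derivation_diff[OF derivation_coeff_trans ddx_derivation])

lemma dtot_xpow: "dtot (xpow n) = (- of_int n) *\<^sub>C xpow (n - 1)"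
  by (simp add: dtot_def coeff_trans_single heis_trans_simps ddx_xpow scaleC_simps)

lemma dtot_gen: "dtot (gen \<beta> j) = of_nat (Suc j) *\<^sub>C gen \<beta> (Suc j)"
  by (simp add: dtot_def coeff_trans_single heis_trans_osc ddx_lconst scaleC_single del: of_nat_Suc)

lemma gbinomial_Suc_mult: "(a gchoose i) * (a - of_nat i) = of_nat (Suc i) * (a gchoose Suc i :: complex)"
  using gbinomial_mult_1[of a i] by (simp add: algebra_simps)

section \<open>Operators on Laurent polynomials\<close>

locale lattice_form =
  fixes form :: "'l::ab_group_add \<Rightarrow> 'l \<Rightarrow> int"
  assumes form_add_left: "form (\<alpha> + \<beta>) \<gamma> = form \<alpha> \<gamma> + form \<beta> \<gamma>"
    and form_sym: "form \<alpha> \<beta> = form \<beta> \<alpha>"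
begin

lemma form_add_right: "form \<gamma> (\<alpha> + \<beta>) = form \<gamma> \<alpha> + form \<gamma> \<beta>"
  using form_add_left[of \<alpha> \<beta> \<gamma>] form_sym[of \<gamma> "\<alpha> + \<beta>"] form_sym[of \<gamma> \<alpha>] form_sym[of \<gamma> \<beta>] by simp

lemma form_zero: "form 0 \<alpha> = 0" "form \<alpha> 0 = 0"
  using form_add_left[of 0 0 \<alpha>] form_add_right[of \<alpha> 0 0] by simp_all

lemmas form_simps = form_add_left form_add_right form_zero

abbreviation cform :: "'l cplx \<Rightarrow> 'l cplx \<Rightarrow> complex" where
  "cform \<equiv> cplx_form form"

lemma cform: "cbilinear cform" "cform (cplx_inc \<alpha>) (cplx_inc \<beta>) = of_int (form \<alpha> \<beta>)"
  using cbilinear_cplx_form cplx_form_inc form_add_left form_sym by metis+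

lemmas cform_simps = cbilinear_simps[OF cform(1)] cform(2)

text \<open>The algebra homomorphism that \<open>E\<^sup>+(-\<gamma>,x)\<close> induces on Laurent polynomials over \<open>B\<^sub>\<h>\<close>.\<close>

definition vert :: "'l \<Rightarrow> 'l laurent \<Rightarrow> 'l laurent" where
  "vert \<gamma> = (SOME E. clinear E \<and> (\<forall>p q. E (p * q) = E p * E q) \<and> (\<forall>n. E (xpow n) = xpow n) \<and>
    (\<forall>v. E (lconst (sym_inc v)) =
      lconst (sym_inc v) - hm_lift (\<lambda>j h. cform (cplx_inc \<gamma>) h *\<^sub>C xpow (- int j - 1)) v))"

lemma vert:
  shows clinear_vert: "clinear (vert \<gamma>)"
    and vert_mult: "vert \<gamma> (p * q) = vert \<gamma> p * vert \<gamma> q"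
    and vert_xpow: "vert \<gamma> (xpow n) = xpow n"
    and vert_gen: "vert \<gamma> (gen \<beta> j) = gen \<beta> j - of_int (form \<gamma> \<beta>) *\<^sub>C xpow (- int j - 1)"
proof -
  have c: "clinear (\<lambda>h. cform (cplx_inc \<gamma>) h *\<^sub>C (xpow (- int j - 1) :: 'l laurent))" for j
    by (rule clinearI) (simp_all add: cform_simps scaleC_add_left scaleC_simps scaleC_complex_def)
  let ?k = "hm_lift (\<lambda>j h. cform (cplx_inc \<gamma>) h *\<^sub>C (xpow (- int j - 1) :: 'l laurent))"
  note hm = hm_lift[of "\<lambda>j h. cform (cplx_inc \<gamma>) h *\<^sub>C (xpow (- int j - 1) :: 'l laurent)", OF c]
  have "clinear (\<lambda>v. lconst (sym_inc v) - ?k v)"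
    by (rule clinearI) (simp_all add: clinear_simps[OF clinear_lconst_sym_inc] clinear_simps[OF hm(1)] scaleC_simps)
  from someI_ex[OF laurent_hom_ex[OF this], folded vert_def]
  have *: "clinear (vert \<gamma>)" "\<And>p q. vert \<gamma> (p * q) = vert \<gamma> p * vert \<gamma> q"
    "\<And>n. vert \<gamma> (xpow n) = xpow n" "\<And>v. vert \<gamma> (lconst (sym_inc v)) = lconst (sym_inc v) - ?k v"
    by blast+
  show "clinear (vert \<gamma>)" "vert \<gamma> (p * q) = vert \<gamma> p * vert \<gamma> q" "vert \<gamma> (xpow n) = xpow n" by (fact *)+
  show "vert \<gamma> (gen \<beta> j) = gen \<beta> j - of_int (form \<gamma> \<beta>) *\<^sub>C xpow (- int j - 1)"
    by (simp only: *(4)) (simp add: osc_def hm(2) cform_simps del: single_one)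
qed

lemmas vert_simps = clinear_simps[OF clinear_vert] vert_mult vert_xpow vert_gen

lemma vert_one: "vert \<gamma> 1 = 1"
  using vert_xpow[of \<gamma> 0] by simp

lemma vert_zero: "vert 0 p = p"
  by (induction p rule: laurent_induct) (simp_all add: vert_simps form_simps scaleC_simps)

lemma vert_add: "vert (\<gamma> + \<gamma>') p = vert \<gamma> (vert \<gamma>' p)"
  by (induction p rule: laurent_induct)
    (simp_all add: vert_simps form_simps scaleC_add_left algebra_simps)

text \<open>For \<open>g = h(-i-1)\<close>, the value is \<open>(1/i!) (d/dx)\<^sup>i \<Sum>\<^sub>n h(n) x\<^sup>-\<^sup>n\<^sup>-\<^sup>1\<close>, \<open>n \<ge> 1\<close>, applied to
  \<open>b(-j-1)\<close>; \<open>pairing0\<close> below is the contribution of \<open>n = 0\<close> on \<open>e\<^sub>\<beta>\<close>.\<close>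

definition pairing :: "nat \<Rightarrow> 'l cplx \<Rightarrow> 'l hminus \<Rightarrow> 'l laurent" where
  "pairing j b = hm_lift (\<lambda>i h. (of_nat (Suc j) * ((- of_nat j - 2) gchoose i) * cform h b) *\<^sub>C
      xpow (- int i - int j - 2))"

text \<open>Only the mode n = j+1 contracts with b(-j-1), giving (j+1) times the form and the power
  x^(-j-2). The i-th divided derivative of that power contributes the binomial coefficient and
  lowers the exponent by i.\<close>

lemma pairing:
  shows clinear_pairing: "clinear (pairing j b)"
    and pairing_osc: "pairing j (cplx_inc \<beta>) (osc \<alpha> i) =
      (of_nat (Suc j) * ((- of_nat j - 2) gchoose i) * of_int (form \<alpha> \<beta>)) *\<^sub>C xpow (- int i - int j - 2)"
    and clinear_pairing_left: "clinear (\<lambda>b. pairing j b g)"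
proof -
  have c: "clinear (\<lambda>h. (of_nat (Suc j) * ((- of_nat j - 2) gchoose i) * cform h b) *\<^sub>C
      (xpow (- int i - int j - 2) :: 'l laurent))" for i b
    by (rule clinearI)
      (simp_all add: cform_simps scaleC_add_left scaleC_simps scaleC_complex_def algebra_simps del: of_nat_Suc)
  note hm = hm_lift[of "\<lambda>i h. (of_nat (Suc j) * ((- of_nat j - 2) gchoose i) * cform h b) *\<^sub>C
      (xpow (- int i - int j - 2) :: 'l laurent)" for b, OF c, folded pairing_def]
  show "clinear (pairing j b)" by (rule hm(1))
  have osc: "pairing j b (osc \<alpha> i) =
      (of_nat (Suc j) * ((- of_nat j - 2) gchoose i) * cform (cplx_inc \<alpha>) b) *\<^sub>C xpow (- int i - int j - 2)"
    for b \<alpha> i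
    unfolding osc_def by (rule hm(2))
  show "pairing j (cplx_inc \<beta>) (osc \<alpha> i) =
      (of_nat (Suc j) * ((- of_nat j - 2) gchoose i) * of_int (form \<alpha> \<beta>)) *\<^sub>C xpow (- int i - int j - 2)"
    by (simp only: osc cform)
  show "clinear (\<lambda>b. pairing j b g)"
  proof (rule clinearI)
    fix b b' c
    show "pairing j (b + b') g = pairing j b g + pairing j b' g"
      by (induction g rule: hminus_induct)
        (simp_all add: clinear_simps[OF hm(1)] osc cform_simps scaleC_add_left scaleC_simps algebra_simps del: of_nat_Suc)
    show "pairing j (c *\<^sub>C b) g = c *\<^sub>C pairing j b g"
      by (induction g rule: hminus_induct)
        (simp_all add: clinear_simps[OF hm(1)] osc cform_simps scaleC_simps scaleC_complex_def mult_ac del: of_nat_Suc)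
  qed
qed

text \<open>The positive modes of the vertex operator of \<open>g\<close>, as an x-linear
  derivation; the zero mode is kept apart since it acts by multiplication.\<close>

definition lower :: "'l hminus \<Rightarrow> 'l laurent \<Rightarrow> 'l laurent" where
  "lower g = (SOME D. derivation D \<and> (\<forall>n. D (xpow n) = 0) \<and>
    (\<forall>v. D (lconst (sym_inc v)) = hm_lift (\<lambda>j b. pairing j b g) v))"

lemma lower:
  shows derivation_lower: "derivation (lower g)"
    and lower_xpow: "lower g (xpow n) = 0"
    and lower_gen: "lower g (gen \<beta> j) = pairing j (cplx_inc \<beta>) g"
proof -
  note hm = hm_lift[of "\<lambda>j b. pairing j b g", OF clinear_pairing_left]
  from someI_ex[OF laurent_derivation_ex[OF hm(1)], folded lower_def]
  have *: "derivation (lower g)" "\<And>n. lower g (xpow n) = 0"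
    "\<And>v. lower g (lconst (sym_inc v)) = hm_lift (\<lambda>j b. pairing j b g) v"
    by blast+
  show "derivation (lower g)" "lower g (xpow n) = 0" by (fact *)+
  show "lower g (gen \<beta> j) = pairing j (cplx_inc \<beta>) g"
    by (simp only: *(3)) (simp add: osc_def hm(2) del: single_one)
qed

lemmas lower_simps = derivation_simps[OF derivation_lower] lower_xpow lower_gen

lemma cbilinear_lower: "cbilinear lower"
proof (rule cbilinearI)
  fix g g' p c
  show "lower (g + g') p = lower g p + lower g' p"
    by (induction p rule: laurent_induct)
      (simp_all add: lower_simps clinear_simps[OF clinear_pairing] scaleC_simps algebra_simps)
  show "lower (c *\<^sub>C g) p = c *\<^sub>C lower g p"
    by (induction p rule: laurent_induct)
      (simp_all add: lower_simps clinear_simps[OF clinear_pairing] scaleC_simps scaleC_mult mult.commute)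
qed (simp_all add: lower_simps)

text \<open>Contractions have scalar coefficients, and an x-linear derivation kills those. This is
  what makes the operators \<open>lower\<close> commute with each other.\<close>

lemma lower_pairing: "lower g (pairing j b g') = 0"
proof (rule clinear_cplx_eqI[where f = "\<lambda>b. lower g (pairing j b g')" and g = "\<lambda>_. 0"])
  show "clinear (\<lambda>b. lower g (pairing j b g'))"
    by (rule clinear_compose[OF derivation_clinear[OF derivation_lower] clinear_pairing_left])
  show "clinear (\<lambda>_. 0 :: 'l laurent)" by (rule clinearI) (simp_all add: scaleC_simps)
  show "lower g (pairing j (cplx_inc \<beta>) g') = 0" for \<beta>
    by (induction g' rule: hminus_induct)
      (simp_all add: clinear_simps[OF clinear_pairing] lower_simps pairing_osc scaleC_simps del: of_nat_Suc)
qed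

lemma lower_commute: "lower g (lower g' p) = lower g' (lower g p)"
  using derivation_laurent_eqI[OF derivation_commutator[OF derivation_lower derivation_lower] derivation_zero,
      of g g' p]
  by (simp add: lower_simps lower_pairing)

lemma vert_pairing: "vert \<gamma> (pairing j (cplx_inc \<beta>) g) = pairing j (cplx_inc \<beta>) g"
  by (induction g rule: hminus_induct)
    (simp_all add: clinear_simps[OF clinear_pairing] vert_simps pairing_osc del: of_nat_Suc)

lemma vert_lower: "vert \<gamma> (lower g p) = lower g (vert \<gamma> p)"
  by (induction p rule: laurent_induct)
    (simp_all add: vert_simps lower_simps vert_pairing scaleC_simps)

definition pairing0 :: "'l \<Rightarrow> 'l hminus \<Rightarrow> 'l laurent" where
  "pairing0 \<beta> = hm_lift (\<lambda>i h. ((-1 gchoose i) * cform h (cplx_inc \<beta>)) *\<^sub>C xpow (- int i - 1))"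

text \<open>The zero mode h(0) acts on the component of \<open>e_basis \<beta>\<close> as the value
  of the form on h and \<beta>, and comes with x^(-1), whose i-th divided derivative is -1 choose i
  times x^(-i-1).\<close>

lemma pairing0:
  shows clinear_pairing0: "clinear (pairing0 \<beta>)"
    and pairing0_osc: "pairing0 \<beta> (osc \<alpha> i) = ((-1 gchoose i) * of_int (form \<alpha> \<beta>)) *\<^sub>C xpow (- int i - 1)"
proof -
  have c: "clinear (\<lambda>h. ((-1 gchoose i) * cform h (cplx_inc \<beta>)) *\<^sub>C (xpow (- int i - 1) :: 'l laurent))" for i
    by (rule clinearI)
      (simp_all add: cform_simps scaleC_add_left scaleC_simps scaleC_complex_def algebra_simps)
  note hm = hm_lift[of "\<lambda>i h. ((-1 gchoose i) * cform h (cplx_inc \<beta>)) *\<^sub>C (xpow (- int i - 1) :: 'l laurent)",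
      OF c, folded pairing0_def]
  show "clinear (pairing0 \<beta>)" by (rule hm(1))
  show "pairing0 \<beta> (osc \<alpha> i) = ((-1 gchoose i) * of_int (form \<alpha> \<beta>)) *\<^sub>C xpow (- int i - 1)"
    using hm(2)[of "cplx_inc \<alpha>" i] by (simp only: osc_def cform)
qed

lemmas pairing0_simps = clinear_simps[OF clinear_pairing0] pairing0_osc

lemma pairing0_add: "pairing0 (\<beta> + \<beta>') g = pairing0 \<beta> g + pairing0 \<beta>' g"
  by (induction g rule: hminus_induct)
    (simp_all add: pairing0_simps form_simps scaleC_add_left scaleC_simps algebra_simps)

lemma pairing0_zero: "pairing0 0 g = 0"
  by (induction g rule: hminus_induct) (simp_all add: pairing0_simps form_simps scaleC_simps)

lemma lower_pairing0: "lower g (pairing0 \<beta> g') = 0"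
  by (induction g' rule: hminus_induct) (simp_all add: pairing0_simps lower_simps scaleC_simps)

lemma vert_pairing0: "vert \<gamma> (pairing0 \<beta> g) = pairing0 \<beta> g"
  by (induction g rule: hminus_induct) (simp_all add: pairing0_simps vert_simps)

text \<open>The actions of \<open>g\<close> (primitive) and of \<open>e\<^sup>\<gamma>\<close> on the component of \<open>e\<^sub>\<beta>\<close>.\<close>

definition prim_op :: "'l \<Rightarrow> 'l hminus \<Rightarrow> 'l laurent \<Rightarrow> 'l laurent" where
  "prim_op \<beta> g p = pairing0 \<beta> g * p + lower g p"

definition group_op :: "'l \<Rightarrow> 'l \<Rightarrow> 'l laurent \<Rightarrow> 'l laurent" where
  "group_op \<gamma> \<beta> p = xpow (form \<gamma> \<beta>) * vert \<gamma> p"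

lemma cbilinear_prim_op: "cbilinear (prim_op \<beta>)"
  by (rule cbilinearI)
    (simp_all add: prim_op_def pairing0_simps cbilinear_simps[OF cbilinear_lower] algebra_simps scaleC_mult
      scaleC_add_right)

lemma prim_op_commute: "prim_op \<beta> g (prim_op \<beta> g' p) = prim_op \<beta> g' (prim_op \<beta> g p)"
  by (simp add: prim_op_def lower_simps lower_pairing0 lower_commute[of g g'] algebra_simps)

text \<open>The multiplier is additive in the component and the rest is a derivation; together this
  is the Leibniz rule that a primitive coproduct asks for.\<close>

lemma prim_op_mult: "prim_op (\<beta> + \<beta>') g (p * q) = prim_op \<beta> g p * q + p * prim_op \<beta>' g q"
  by (simp add: prim_op_def pairing0_add lower_simps algebra_simps)

lemma prim_op_one: "prim_op 0 g 1 = 0"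
  by (simp add: prim_op_def pairing0_zero lower_simps)

lemma clinear_group_op: "clinear (group_op \<gamma> \<beta>)"
  by (rule clinearI) (simp_all add: group_op_def vert_simps algebra_simps scaleC_mult)

lemmas group_op_simps = clinear_simps[OF clinear_group_op]

lemma group_op_zero: "group_op 0 \<beta> p = p"
  by (simp add: group_op_def form_simps vert_zero)

lemma group_op_add: "group_op (\<gamma> + \<gamma>') \<beta> p = group_op \<gamma> \<beta> (group_op \<gamma>' \<beta> p)"
  by (simp add: group_op_def form_simps vert_add vert_simps mult.assoc[symmetric] xpow_mult)

lemma group_op_mult: "group_op \<gamma> (\<beta> + \<beta>') (p * q) = group_op \<gamma> \<beta> p * group_op \<gamma> \<beta>' q"
  by (simp add: group_op_def form_simps vert_simps xpow_mult[symmetric] mult_ac)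

lemma group_op_one: "group_op \<gamma> 0 1 = 1"
  by (simp add: group_op_def form_simps vert_one)

lemma group_op_prim_op: "group_op \<gamma> \<beta> (prim_op \<beta>' g p) = prim_op \<beta>' g (group_op \<gamma> \<beta> p)"
  by (simp add: group_op_def prim_op_def vert_simps vert_pairing0 vert_lower lower_simps algebra_simps)

section \<open>Commutators with d/dx and with L(-1) - d/dx\<close>

lemma ddx_mult: "ddx (p * q) = ddx p * q + p * ddx (q :: 'l laurent)"
  by (rule derivation_mult[OF ddx_derivation])

text \<open>\<open>vert \<gamma>\<close> is the exponential of the sum of -\<gamma>(n) x^(-n)/n over
  n at least 1. Differentiating the exponent in x gives the sum of \<gamma>(n) x^(-n-1), which is
  \<open>lower (osc \<gamma> 0)\<close>.\<close>

lemma ddx_vert: "ddx (vert \<gamma> p) = vert \<gamma> (ddx p) + vert \<gamma> (lower (osc \<gamma> 0) p)"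
proof (induction p rule: laurent_induct)
  case (mult \<beta> j p)
  have "ddx (vert \<gamma> (gen \<beta> j)) = vert \<gamma> (lower (osc \<gamma> 0) (gen \<beta> j))"
  proof -
    have ex: "- 2 - int j = - int j - 2" by simp
    show ?thesis
      by (simp add: vert_simps derivation_simps[OF ddx_derivation] ddx_lconst ddx_xpow lower_simps
        pairing_osc vert_pairing scaleC_simps flip: scaleC_simps(3)) (simp add: algebra_simps ex)
  qed
  then show ?case using mult
    by (simp only: vert_mult ddx_mult derivation_mult[OF derivation_lower] ddx_lconst vert_simps(1) mult_zero_left add_0_left)
      (simp only: algebra_simps)
qed (simp_all add: vert_simps derivation_simps[OF ddx_derivation] lower_simps ddx_xpow scaleC_add_right)

text \<open>The derivative of the prefactor x^\<open>form \<gamma> \<beta>\<close> supplies the zero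
  mode missing in \<open>ddx_vert\<close>. The second summand is the action of the product of the
  group-like element for \<gamma> with \<gamma>(-1), that is, of L(-1) applied to that group-like
  element.\<close>

lemma ddx_group_op: "ddx (group_op \<gamma> \<beta> p) = group_op \<gamma> \<beta> (ddx p) + group_op \<gamma> \<beta> (prim_op \<beta> (osc \<gamma> 0) p)"
proof -
  have "ddx (xpow (form \<gamma> \<beta>)) = xpow (form \<gamma> \<beta>) * (pairing0 \<beta> (osc \<gamma> 0))"
    by (simp add: ddx_xpow pairing0_osc scaleC_mult xpow_mult)
  then show ?thesis
    by (simp add: group_op_def prim_op_def ddx_mult ddx_vert vert_simps vert_pairing0 algebra_simps)
qed

text \<open>Differentiating the i-th divided derivative gives i+1 times the next one. The factor is
  the same as in L(-1)h(-i-1) = (i+1)h(-i-2), and the same holds for \<open>pairing\<close>.\<close>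

lemma ddx_pairing0: "ddx (pairing0 \<beta> (osc \<alpha> i)) = of_nat (Suc i) *\<^sub>C pairing0 \<beta> (osc \<alpha> (Suc i))"
proof -
  have "(-1 gchoose i) * (- of_nat i - 1) = of_nat (Suc i) * (-1 gchoose Suc i :: complex)"
    unfolding gbinomial_Suc_mult[symmetric] by (simp add: algebra_simps)
  then have "((-1 gchoose i) * (- of_nat i - 1)) * of_int (form \<alpha> \<beta>) =
      (of_nat (Suc i) * (-1 gchoose Suc i :: complex)) * of_int (form \<alpha> \<beta>)"
    by (rule arg_cong)
  then have "(-1 gchoose i) * of_int (form \<alpha> \<beta>) * of_int (- int i - 1) =
      of_nat (Suc i) * ((-1 gchoose Suc i :: complex) * of_int (form \<alpha> \<beta>))"
    by (simp only: of_int_diff of_int_minus of_int_of_nat_eq of_int_1 mult_ac)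
  moreover have "- int i - 1 - 1 = - int (Suc i) - 1" by simp
  ultimately show ?thesis
    by (simp only: pairing0_osc derivation_simps[OF ddx_derivation] ddx_xpow scaleC_scaleC)
qed

lemma ddx_pairing:
  "ddx (pairing j (cplx_inc \<beta>) (osc \<alpha> i)) = of_nat (Suc i) *\<^sub>C pairing j (cplx_inc \<beta>) (osc \<alpha> (Suc i))"
proof -
  have "((- of_nat j - 2) gchoose i) * (- of_nat i - of_nat j - 2) =
      of_nat (Suc i) * ((- of_nat j - 2) gchoose Suc i :: complex)"
    unfolding gbinomial_Suc_mult[symmetric] by (simp add: algebra_simps)
  then have "of_nat (Suc j) * ((- of_nat j - 2) gchoose i) * of_int (form \<alpha> \<beta>) * of_int (- int i - int j - 2) =
     of_nat (Suc i) * (of_nat (Suc j) * ((- of_nat j - 2) gchoose Suc i :: complex) * of_int (form \<alpha> \<beta>))"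
    by (simp only: of_int_diff of_int_minus of_int_of_nat_eq of_int_numeral mult_ac)
  moreover have "- int i - int j - 2 - 1 = - int (Suc i) - int j - 2" by simp
  ultimately show ?thesis
    by (simp only: pairing_osc derivation_simps[OF ddx_derivation] ddx_xpow scaleC_scaleC)
qed

lemma ddx_lower: "ddx (lower (osc \<alpha> i) p) = lower (osc \<alpha> i) (ddx p) + of_nat (Suc i) *\<^sub>C lower (osc \<alpha> (Suc i)) p"
proof -
  have "ddx (lower (osc \<alpha> i) p) - lower (osc \<alpha> i) (ddx p) = of_nat (Suc i) *\<^sub>C lower (osc \<alpha> (Suc i)) p"
    by (rule derivation_laurent_eqI[OF derivation_commutator[OF ddx_derivation derivation_lower]
          derivation_scale[OF derivation_lower]])
      (simp_all add: lower_simps ddx_xpow ddx_pairing ddx_lconst derivation_simps[OF ddx_derivation] scaleC_simps del: of_nat_Suc)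
  then show ?thesis by (simp add: algebra_simps)
qed

lemma ddx_prim_op:
  "ddx (prim_op \<beta> (osc \<alpha> i) p) = prim_op \<beta> (osc \<alpha> i) (ddx p) + of_nat (Suc i) *\<^sub>C prim_op \<beta> (osc \<alpha> (Suc i)) p"
  by (simp add: prim_op_def ddx_mult ddx_pairing0 ddx_lower derivation_simps[OF ddx_derivation]
      scaleC_add_right scaleC_mult algebra_simps del: of_nat_Suc)

text \<open>On a generator b(-n), L(-1) produces n b(-n-1), and -d/dx turns x^(-n) into n x^(-n-1).
  So the correction term of \<open>vert_gen\<close> transforms in the same way as the generator
  itself.\<close>

lemma dtot_vert: "dtot (vert \<gamma> p) = vert \<gamma> (dtot p)"
proof (induction p rule: laurent_induct)
  case (mult \<beta> j p)
  have "dtot (vert \<gamma> (gen \<beta> j)) = vert \<gamma> (dtot (gen \<beta> j))"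
  proof -
    have "- int j - 1 - 1 = - int (Suc j) - 1" by simp
    then show ?thesis
      by (simp add: vert_simps derivation_simps[OF derivation_dtot] dtot_xpow dtot_gen scaleC_simps mult_ac)
  qed
  then show ?case using mult by (simp add: vert_mult derivation_simps[OF derivation_dtot] vert_simps(1))
qed (simp_all add: vert_simps derivation_simps[OF derivation_dtot] dtot_xpow)

lemma dtot_lower: "dtot (lower (osc \<alpha> i) p) = lower (osc \<alpha> i) (dtot p)"
proof -
  have *: "dtot (pairing j (cplx_inc \<beta>) (osc \<alpha> i)) =
    of_nat (Suc j) *\<^sub>C pairing (Suc j) (cplx_inc \<beta>) (osc \<alpha> i)" for \<beta> j
  proof -
    \<comment> \<open>Absorption trades the factor i+j+2, produced by -d/dx on the contraction, for
      the factor j+2 in the contraction with b(-j-2), the mode to which L(-1) moves b(-j-1).\<close>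
    have "(- of_nat j - 2 - of_nat i) * ((- of_nat j - 2) gchoose i) =
       (- of_nat j - 2) * ((- of_nat j - 2 - 1) gchoose i :: complex)"
      by (rule gbinomial_absorb_comp)
    moreover have "- of_nat j - 2 - 1 = - of_nat (Suc j) - (2 :: complex)" by simp
    ultimately have "(- of_nat j - 2 - of_nat i) * ((- of_nat j - 2) gchoose i) =
       (- of_nat (Suc (Suc j))) * ((- of_nat (Suc j) - 2) gchoose i :: complex)"
      by (simp only:) (simp add: algebra_simps)
    then have "of_nat (Suc j) * ((- of_nat j - 2) gchoose i) * of_int (form \<alpha> \<beta>) * (- of_int (- int i - int j - 2)) =
      of_nat (Suc j) * (of_nat (Suc (Suc j)) * ((- of_nat (Suc j) - 2) gchoose i :: complex) * of_int (form \<alpha> \<beta>))"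
      by (simp add: algebra_simps)
    moreover have "- int i - int j - 2 - 1 = - int i - int (Suc j) - 2" by simp
    ultimately show ?thesis
      by (simp only: pairing_osc derivation_simps[OF derivation_dtot] dtot_xpow scaleC_scaleC)
  qed
  have "dtot (lower (osc \<alpha> i) p) - lower (osc \<alpha> i) (dtot p) = 0"
    by (rule derivation_laurent_eqI[OF derivation_commutator[OF derivation_dtot derivation_lower]
          derivation_zero])
      (simp_all add: lower_simps dtot_xpow * dtot_gen derivation_simps[OF derivation_dtot] scaleC_simps del: of_nat_Suc)
  then show ?thesis by simp
qed

text \<open>The operator \<open>L(-1) - d/dx\<close> on the component of \<open>e\<^sub>\<beta>\<close>.\<close>

definition conn :: "'l \<Rightarrow> 'l laurent \<Rightarrow> 'l laurent" where
  "conn \<beta> p = gen \<beta> 0 * p + dtot p"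

lemma clinear_conn: "clinear (conn \<beta>)"
  by (rule clinearI) (simp_all add: conn_def derivation_simps[OF derivation_dtot] algebra_simps scaleC_mult scaleC_add_right)

text \<open>Two defects cancel: -d/dx on the prefactor x^\<open>form \<gamma> \<beta>\<close> yields
  the same term as the shift of \<beta>(-1) under \<open>vert \<gamma>\<close>.\<close>

lemma conn_group_op: "conn \<beta> (group_op \<gamma> \<beta> p) = group_op \<gamma> \<beta> (conn \<beta> p)"
proof -
  \<comment> \<open>The exponent is left as \<open>- int 0 - 1\<close> to match
    \<open>vert_gen\<close> at j = 0 literally.\<close>
  have "dtot (xpow (form \<gamma> \<beta>) :: 'l laurent) = - (xpow (form \<gamma> \<beta>) * of_int (form \<gamma> \<beta>) *\<^sub>C xpow (- int 0 - 1))"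
    by (simp add: dtot_xpow scaleC_mult xpow_mult scaleC_simps)
  then show ?thesis
    by (simp only: conn_def group_op_def derivation_mult[OF derivation_dtot] dtot_vert vert_mult vert_gen
        vert_simps(1)) (simp add: algebra_simps minus_mult_right[symmetric])
qed

text \<open>Again two defects agree: applying \<open>dtot\<close> to the multiplier
  \<open>pairing0\<close> gives the contraction of \<open>osc \<alpha> i\<close> with the term
  \<beta>(-1) in \<open>conn\<close>. The remaining parts commute by
  \<open>dtot_lower\<close>.\<close>

lemma conn_prim_op: "conn \<beta> (prim_op \<beta> (osc \<alpha> i) p) = prim_op \<beta> (osc \<alpha> i) (conn \<beta> p)"
proof -
  have "(-1 - of_nat i) * (-1 gchoose i) = -1 * ((-1 - 1) gchoose i :: complex)"
    by (rule gbinomial_absorb_comp)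
  then have b: "(-2 gchoose i) = (-1 gchoose i) * (of_nat i + 1 :: complex)"
    by (simp add: algebra_simps)
  have ex: "- 2 - int i = - int i - 2" by simp
  have "dtot (pairing0 \<beta> (osc \<alpha> i)) = lower (osc \<alpha> i) (gen \<beta> 0)"
    by (simp add: pairing0_osc lower_simps pairing_osc derivation_simps[OF derivation_dtot] dtot_xpow scaleC_simps b)
      (simp add: algebra_simps ex)
  then show ?thesis
    by (simp add: conn_def prim_op_def derivation_simps[OF derivation_dtot] dtot_lower lower_simps(6) algebra_simps lower_simps(1))
qed

end

section \<open>Differential algebras and nonlocal vertex algebras\<close>

definition dpow :: "('a::complex_vector \<Rightarrow> 'a) \<Rightarrow> nat \<Rightarrow> 'a \<Rightarrow> 'a" where
  "dpow D n a = (1 / fact n) *\<^sub>C (D ^^ n) a"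

lemma dpow_0 [simp]: "dpow D 0 a = a"
  by (simp add: dpow_def scaleC_one)

lemma clinear_funpow:
  fixes D :: "'a::complex_vector \<Rightarrow> 'a"
  shows "clinear D \<Longrightarrow> clinear (D ^^ n)"
proof (induction n)
  case (Suc n)
  show ?case using clinear_compose[OF Suc(2) Suc(1)[OF Suc(2)]] by (simp add: o_def)
qed (simp add: clinearI)

lemma clinear_dpow:
  assumes "clinear D" shows "clinear (dpow D n)"
  by (rule clinearI) (simp_all add: dpow_def clinear_simps[OF clinear_funpow[OF assms]] scaleC_simps mult.commute)

lemma D_dpow:
  assumes "clinear D"
  shows "D (dpow D n a) = of_nat (Suc n) *\<^sub>C dpow D (Suc n) a"
  by (simp add: dpow_def clinear_scale[OF assms] scaleC_scaleC del: of_nat_Suc)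

lemma dpow_dpow:
  assumes "clinear D"
  shows "dpow D m (dpow D n a) = of_nat ((m + n) choose m) *\<^sub>C dpow D (m + n) a"
proof -
  have "(of_nat ((m + n) choose m) :: complex) = fact (m + n) / (fact m * fact n)"
    using binomial_fact[of m "m + n", where 'a = complex] by simp
  then show ?thesis
    by (simp add: dpow_def clinear_simps[OF clinear_funpow[OF assms]] scaleC_scaleC funpow_add)
qed

lemma dpow_commute:
  assumes "clinear f" "\<And>a. f (D a) = D' (f a)"
  shows "f (dpow D n a) = dpow D' n (f a)"
proof -
  have "f ((D ^^ n) a) = (D' ^^ n) (f a)"
    by (induction n) (simp_all add: assms(2))
  then show ?thesis by (simp add: dpow_def clinear_scale[OF assms(1)])
qed

text \<open>The pairing may go between three different spaces with three different operators, so
  that one rule serves products in an algebra, simple tensors, and a scalar Laurent polynomial times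
  a coefficient.\<close>

lemma dpow_leibniz:
  assumes m: "cbilinear m" and lin: "clinear D1" "clinear D2" "clinear D3"
    and D: "\<And>a b. D3 (m a b) = m (D1 a) b + m a (D2 b)"
  shows "dpow D3 n (m a b) = (\<Sum>k\<le>n. m (dpow D1 k a) (dpow D2 (n - k) b))"
proof (induction n)
  case (Suc n)
  let ?g = "\<lambda>k. m (dpow D1 k a) (dpow D2 (Suc n - k) b)"
  have "of_nat (Suc n) *\<^sub>C dpow D3 (Suc n) (m a b) = D3 (\<Sum>k\<le>n. m (dpow D1 k a) (dpow D2 (n - k) b))"
    by (simp only: D_dpow[OF lin(3), symmetric] Suc)
  also have "\<dots> = (\<Sum>k\<le>n. of_nat (Suc k) *\<^sub>C ?g (Suc k)) + (\<Sum>k\<le>n. of_nat (Suc n - k) *\<^sub>C ?g k)"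
    by (simp add: clinear_sum[OF lin(3)] D sum.distrib D_dpow[OF lin(1)] D_dpow[OF lin(2)]
        cbilinear_simps[OF m] Suc_diff_le del: of_nat_Suc)
  also have "(\<Sum>k\<le>n. of_nat (Suc k) *\<^sub>C ?g (Suc k)) = (\<Sum>k\<le>Suc n. of_nat k *\<^sub>C ?g k)"
    by (simp only: sum.atMost_Suc_shift) (simp add: complex_vector.scale_zero_left del: of_nat_Suc)
  also have "(\<Sum>k\<le>n. of_nat (Suc n - k) *\<^sub>C ?g k) = (\<Sum>k\<le>Suc n. of_nat (Suc n - k) *\<^sub>C ?g k)"
    by (simp add: complex_vector.scale_zero_left del: of_nat_Suc)
  \<comment> \<open>The term of index k gets weight k from D1 and n+1-k from D2, hence n+1 in total,
    which is then cancelled.\<close>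
  also have "(\<Sum>k\<le>Suc n. of_nat k *\<^sub>C ?g k) + (\<Sum>k\<le>Suc n. of_nat (Suc n - k) *\<^sub>C ?g k) =
      (\<Sum>k\<le>Suc n. of_nat (Suc n) *\<^sub>C ?g k)"
    unfolding sum.distrib[symmetric]
    by (rule sum.cong[OF refl]) (simp add: scaleC_add_left[symmetric] of_nat_add[symmetric] del: of_nat_Suc of_nat_add)
  finally have "of_nat (Suc n) *\<^sub>C dpow D3 (Suc n) (m a b) = of_nat (Suc n) *\<^sub>C (\<Sum>k\<le>Suc n. ?g k)"
    by (simp only: complex_vector.scale_sum_right)
  then show ?case
    by (simp add: complex_vector.scale_cancel_left del: of_nat_Suc sum.atMost_Suc)
qed simp

lemma Y_of_derivation_nth:
  "Y_of_derivation mul D u v $$ n =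
    (if n < 0 then 0 else (1 / fact (nat n)) *\<^sub>C mul ((D ^^ nat n) u) v)"
  by (simp add: Y_of_derivation_def)

lemma mult_sum_power_0: "mult_sum_power 0 F = F"
  by (intro ext) (simp add: mult_sum_power_def scaleC_one)

lemma Sum_any_finite:
  assumes "finite A" "\<And>a. a \<notin> A \<Longrightarrow> f a = 0"
  shows "Sum_any f = sum f A"
  by (rule Sum_any.expand_superset[OF assms(1)]) (use assms(2) in auto)

lemma gbinomial_of_nat: "(of_int (int n) gchoose k) = (of_nat (n choose k) :: complex)"
  by (simp add: binomial_gbinomial)

locale differential_algebra =
  fixes mul :: "'a::complex_vector \<Rightarrow> 'a \<Rightarrow> 'a" and one :: 'a and D :: "'a \<Rightarrow> 'a"
  assumes mul: "cbilinear mul" and assoc: "mul (mul a b) c = mul a (mul b c)"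
    and one_left: "mul one a = a" and one_right: "mul a one = a"
    and lin: "clinear D" and D_mul: "D (mul a b) = mul (D a) b + mul a (D b)"
begin

abbreviation Y :: "'a \<Rightarrow> 'a \<Rightarrow> 'a fls" where
  "Y \<equiv> Y_of_derivation mul D"

lemmas mul_simps = cbilinear_simps[OF mul]

lemma Y_nat: "Y u v $$ int n = mul (dpow D n u) v"
  by (simp add: Y_of_derivation_nth dpow_def mul_simps)

lemma Y_neg: "n < 0 \<Longrightarrow> Y u v $$ n = 0"
  by (simp add: Y_of_derivation_nth)

lemma D_one: "D one = 0"
  using D_mul[of one one] by (simp add: one_left one_right)

lemma dpow_one: "dpow D n one = (if n = 0 then one else 0)"
proof -
  have "(D ^^ Suc n) one = 0" for n
    by (induction n) (simp_all add: D_one clinear_zero[OF lin])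
  then show ?thesis by (cases n) (auto simp: dpow_def scaleC_simps simp del: funpow.simps)
qed

lemma cbilinear_Y: "cbilinear Y"
  by (rule cbilinearI)
    (simp_all add: fls_eq_iff Y_of_derivation_nth mul_simps clinear_simps[OF clinear_funpow[OF lin]] scaleC_simps mult.commute)

text \<open>Since e^(xD) is multiplicative, e^(x_2 D)((e^(x_0 D)u)v) is the product of
  e^((x_0+x_2)D)u and e^(x_2 D)v. Weak associativity therefore holds without any factor, that is,
  with l = 0.\<close>

lemma Y_shifted_eq_nested:
  "iterate_shifted Y u v w a b =
   iterate_nested Y Y u v w a b"
proof (cases "b < 0")
  case True
  then show ?thesis
    by (simp add: iterate_shifted_def iterate_nested_def Y_neg cbilinear_simps[OF cbilinear_Y] scaleC_simps)
next
  case False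
  then obtain n where b: "b = int n" by (metis nat_0_le not_less)
  have shifted: "iterate_shifted Y u v w a b =
    (\<Sum>k\<le>n. (of_int (a + int k) gchoose k) *\<^sub>C
      (Y u (mul (dpow D (n - k) v) w) $$ (a + int k)))"
  proof -
    have "Y v w $$ (b - int k) = mul (dpow D (n - k) v) w" if "k \<le> n" for k
      using Y_nat[of v w "n - k"] that by (simp add: b of_nat_diff)
    then show ?thesis
      unfolding iterate_shifted_def
      by (subst Sum_any_finite[of "{..n}"]) (auto simp: b Y_neg cbilinear_simps[OF cbilinear_Y] scaleC_simps)
  qed
  show ?thesis
  proof (cases "a < 0")
    case True
    \<comment> \<open>Nonnegative powers of x_0+x_2 contain no negative power of x_0: if a+k = m is
      nonnegative and a negative, then m < k and the binomial coefficient vanishes.\<close>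
    have "(of_int (a + int k) gchoose k) *\<^sub>C
      (Y u (mul (dpow D (n - k) v) w) $$ (a + int k)) = 0" for k
    proof (cases "a + int k < 0")
      case False
      then obtain m where m: "a + int k = int m" by (metis nat_0_le not_less)
      then have "m < k" using True by simp
      then show ?thesis by (simp add: m gbinomial_of_nat binomial_eq_0 scaleC_simps del: of_int_of_nat_eq)
    qed (simp add: Y_neg scaleC_simps)
    then have "iterate_shifted Y u v w a b = 0"
      unfolding shifted by (intro sum.neutral ballI)
    then show ?thesis using True
      by (simp add: iterate_nested_def Y_neg cbilinear_simps[OF cbilinear_Y])
  next
    case False
    then obtain m where a: "a = int m" by (metis nat_0_le not_less)
    have "iterate_nested Y Y u v w a b =
      (\<Sum>k\<le>n. of_nat ((m + k) choose k) *\<^sub>C mul (dpow D (m + k) u) (mul (dpow D (n - k) v) w))"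
      by (simp add: iterate_nested_def a b Y_nat dpow_leibniz[OF mul lin lin lin D_mul] mul_simps assoc
          dpow_dpow[OF lin] add.commute)
    moreover have "of_int (a + int k) gchoose k = (of_nat ((m + k) choose k) :: complex)" for k
      using gbinomial_of_nat[of "m + k" k] by (simp add: a)
    moreover have "Y u x $$ (a + int k) = mul (dpow D (m + k) u) x" for k x
      using Y_nat[of u x "m + k"] by (simp add: a)
    ultimately show ?thesis by (simp only: shifted)
  qed
qed

lemma nonlocal_vertex_algebra: "nonlocal_vertex_algebra Y one"
proof
  fix u v w n
  show "cbilinear Y" by (rule cbilinear_Y)
  show "Y one v = fls_const v"
  proof (rule fls_eqI)
    fix n
    show "Y one v $$ n = fls_const v $$ n"
    proof (cases "n < 0")
      case False
      then obtain m where "n = int m" by (metis nat_0_le not_less)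
      then show ?thesis by (auto simp: Y_nat dpow_one one_left mul_simps)
    qed (auto simp: Y_neg)
  qed
  show "n < 0 \<Longrightarrow> Y v one $$ n = 0" by (rule Y_neg)
  show "Y v one $$ 0 = v" using Y_nat[of v one 0] by (simp add: one_right)
  show "\<exists>l. mult_sum_power l (iterate_shifted Y u v w) =
    mult_sum_power l (iterate_nested Y Y u v w)"
    by (rule exI[of _ 0]) (simp add: mult_sum_power_0 fun_eq_iff Y_shifted_eq_nested)
qed

end

section \<open>The lattice space as a differential algebra\<close>

abbreviation bas :: "'l \<Rightarrow> 'l::ab_group_add heis \<Rightarrow> 'l lattice_alg" where
  "bas \<alpha> u \<equiv> e_basis \<alpha> \<otimes>\<^sub>C u"

lemma lattice_alg_induct [case_names add bas]:
  assumes add: "\<And>s t. P s \<Longrightarrow> P t \<Longrightarrow> P (s + t)" and bas: "\<And>\<alpha> u. P (bas \<alpha> u)"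
  shows "P (v :: 'l::ab_group_add lattice_alg)"
proof (induction v rule: tensor_induct)
  case (tens a u)
  show ?case
  proof (induction a rule: poly_mapping_induct)
    case zero
    show ?case using bas[of 0 0] by (simp add: tens_simps)
  next
    case (single \<alpha> c)
    show ?case using bas[of \<alpha> "c *\<^sub>C u"]
      by (subst single_eq_scaleC) (simp add: tens_simps e_basis_def del: single_one)
  qed (simp add: tens_simps add)
qed (rule add)

lemma B_lift:
  assumes F: "\<And>\<alpha>. clinear (F \<alpha>)"
  shows clinear_B_lift: "clinear (B_lift F)" and B_lift_bas: "B_lift F (bas \<alpha> u) = F \<alpha> u"
proof -
  have b: "cbilinear (\<lambda>a u. pm_lift (\<lambda>\<alpha>. F \<alpha> u) a)"
    unfolding cbilinear_def
    by (auto intro: clinear_pm_lift clinear_pm_lift_fun[where F = "\<lambda>u \<alpha>. F \<alpha> u", OF F])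
  have *: "B_lift F = tensor_lift (\<lambda>a u. pm_lift (\<lambda>\<alpha>. F \<alpha> u) a)"
    by (simp add: B_lift_def pm_lift_def)
  show "clinear (B_lift F)" "B_lift F (bas \<alpha> u) = F \<alpha> u"
    by (simp_all add: * clinear_tensor_lift[OF b] tensor_lift_tens[OF b] e_basis_def scaleC_one del: single_one)
qed

lemma group_alg_mult:
  shows cbilinear_group_alg_mult: "cbilinear (group_alg_mult eps)"
    and group_alg_mult_basis: "group_alg_mult eps (e_basis \<alpha>) (e_basis \<beta>) = eps \<alpha> \<beta> *\<^sub>C e_basis (\<alpha> + \<beta>)"
proof -
  have *: "group_alg_mult eps = (\<lambda>a b. pm_lift (\<lambda>\<alpha>. pm_lift (\<lambda>\<beta>. eps \<alpha> \<beta> *\<^sub>C e_basis (\<alpha> + \<beta>)) b) a)"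
    by (intro ext) (simp add: group_alg_mult_def pm_lift_def complex_vector.scale_sum_right scaleC_scaleC mult.assoc)
  show "cbilinear (group_alg_mult eps)"
    unfolding cbilinear_def * by (auto intro: clinear_pm_lift clinear_pm_lift_fun)
  show "group_alg_mult eps (e_basis \<alpha>) (e_basis \<beta>) = eps \<alpha> \<beta> *\<^sub>C e_basis (\<alpha> + \<beta>)"
    unfolding * e_basis_def[of \<alpha>] e_basis_def[of \<beta>] by (simp add: scaleC_one del: single_one)
qed

lemma cbilinear_times: "cbilinear ((*) :: 'a::ccalgebra \<Rightarrow> 'a \<Rightarrow> 'a)"
  by (rule cbilinearI) (simp_all add: algebra_simps scaleC_mult)

lemma B_mult:
  shows cbilinear_B_mult: "cbilinear (B_mult eps)"
    and B_mult_bas: "B_mult eps (bas \<alpha> u) (bas \<beta> w) = eps \<alpha> \<beta> *\<^sub>C bas (\<alpha> + \<beta>) (u * w)"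
  unfolding B_mult_def
  by (rule cbilinear_tensor_mult[OF cbilinear_group_alg_mult cbilinear_times])
    (simp add: tensor_mult_tens[OF cbilinear_group_alg_mult cbilinear_times] group_alg_mult_basis tens_simps)

lemmas B_mult_simps = cbilinear_simps[OF cbilinear_B_mult]

text \<open>L(-1) on the component of \<open>e_basis \<alpha>\<close>, with the basis vector
  stripped off. It is not a derivation for fixed \<alpha>, but satisfies a Leibniz rule in which the
  components add up.\<close>

definition heis_conn :: "'l::ab_group_add \<Rightarrow> 'l heis \<Rightarrow> 'l heis" where
  "heis_conn \<alpha> u = sym_inc (osc \<alpha> 0) * u + heis_trans u"

lemma clinear_heis_conn: "clinear (heis_conn \<alpha>)"
  by (rule clinearI) (simp_all add: heis_conn_def heis_trans_simps algebra_simps scaleC_mult scaleC_add_right)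

lemma B_trans:
  fixes u :: "'l::ab_group_add heis"
  shows clinear_B_trans: "clinear (B_trans :: 'l lattice_alg \<Rightarrow> _)"
    and B_trans_bas: "B_trans (bas \<alpha> u) = bas \<alpha> (heis_conn \<alpha> u)"
proof -
  have "B_trans = B_lift (\<lambda>\<alpha> (u :: 'l heis). bas \<alpha> (heis_conn \<alpha> u))"
    by (simp add: B_trans_def heis_conn_def tens_simps(1) hneg_osc[of _ 0, simplified])
  moreover have "clinear (\<lambda>u :: 'l heis. bas \<alpha> (heis_conn \<alpha> u))" for \<alpha>
    by (rule clinear_compose[OF cbilinear_right[OF cbilinear_tens] clinear_heis_conn])
  ultimately show "clinear (B_trans :: 'l lattice_alg \<Rightarrow> _)" "B_trans (bas \<alpha> u) = bas \<alpha> (heis_conn \<alpha> u)"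
    using B_lift[of "\<lambda>\<alpha> (u :: 'l heis). bas \<alpha> (heis_conn \<alpha> u)"] by simp_all
qed

lemma heis_conn_mult: "heis_conn (\<alpha> + \<beta>) (u * w) = heis_conn \<alpha> u * w + u * heis_conn \<beta> w"
  by (simp add: heis_conn_def osc_add clinear_simps[OF clinear_sym_inc] heis_trans_simps algebra_simps)

lemma B_mult_assoc:
  assumes "normalized_cocycle eps"
  shows "B_mult eps (B_mult eps a b) c = B_mult eps a (B_mult eps b c)"
proof (induction a rule: lattice_alg_induct)
  case (bas \<alpha> u)
  show ?case
  proof (induction b rule: lattice_alg_induct)
    case (bas \<beta> v)
    show ?case
    proof (induction c rule: lattice_alg_induct)
      case (bas \<gamma> w)
      have "eps \<alpha> \<beta> * eps (\<alpha> + \<beta>) \<gamma> = eps \<beta> \<gamma> * eps \<alpha> (\<beta> + \<gamma>)"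
        using assms by (simp add: normalized_cocycle_def mult.commute)
      then show ?case by (simp add: B_mult_bas B_mult_simps scaleC_scaleC add.assoc mult.assoc)
    qed (simp add: B_mult_simps)
  qed (simp add: B_mult_simps)
qed (simp add: B_mult_simps)

lemma differential_algebra_B:
  fixes eps :: "'l::ab_group_add \<Rightarrow> 'l \<Rightarrow> complex"
  assumes "normalized_cocycle eps"
  shows "differential_algebra (B_mult eps) B_one B_trans"
proof (rule differential_algebra.intro)
  fix a b c :: "'l lattice_alg"
  show "cbilinear (B_mult eps)" by (rule cbilinear_B_mult)
  show "B_mult eps (B_mult eps a b) c = B_mult eps a (B_mult eps b c)" by (rule B_mult_assoc[OF assms])
  show "B_mult eps B_one a = a"
    by (induction a rule: lattice_alg_induct)
      (use assms in \<open>simp_all add: B_mult_simps B_one_def B_mult_bas normalized_cocycle_def scaleC_one\<close>)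
  show "B_mult eps a B_one = a"
    by (induction a rule: lattice_alg_induct)
      (use assms in \<open>simp_all add: B_mult_simps B_one_def B_mult_bas normalized_cocycle_def scaleC_one\<close>)
  show "clinear (B_trans :: 'l lattice_alg \<Rightarrow> _)" by (rule clinear_B_trans)
  show "B_trans (B_mult eps a b) = B_mult eps (B_trans a) b + B_mult eps a (B_trans b)"
  proof (induction a rule: lattice_alg_induct)
    case (bas \<alpha> u)
    show ?case
      by (induction b rule: lattice_alg_induct)
        (simp_all add: B_mult_simps clinear_simps[OF clinear_B_trans] B_mult_bas B_trans_bas heis_conn_mult
          tens_simps scaleC_add_right)
  qed (simp add: B_mult_simps clinear_simps[OF clinear_B_trans])
qed

lemma trivial_cocycle: "normalized_cocycle trivial_cocycle"
  by (simp add: normalized_cocycle_def)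

lemma B_mult_commute: "B_mult trivial_cocycle a b = B_mult trivial_cocycle b a"
proof (induction a rule: lattice_alg_induct)
  case (bas \<alpha> u)
  show ?case
    by (induction b rule: lattice_alg_induct)
      (simp_all add: B_mult_simps B_mult_bas add.commute mult.commute)
qed (simp add: B_mult_simps)

section \<open>The vertex bialgebra of a lattice\<close>

lemma tensor_mult_assoc:
  assumes "cbilinear m" "cbilinear m'"
    and a: "\<And>a b c. m (m a b) c = m a (m b c)" and a': "\<And>a b c. m' (m' a b) c = m' a (m' b c)"
  shows "tensor_mult m m' (tensor_mult m m' r s) t = tensor_mult m m' r (tensor_mult m m' s t)"
proof -
  note [simp] = cbilinear_simps[OF cbilinear_tensor_mult(1)[OF assms(1,2)]] tensor_mult_tens[OF assms(1,2)] a a'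
  show ?thesis
  proof (induction r rule: tensor_induct)
    case (tens a b)
    show ?case
    proof (induction s rule: tensor_induct)
      case (tens c d)
      show ?case by (induction t rule: tensor_induct) simp_all
    qed simp
  qed simp
qed

lemma tensor_mult_commute:
  assumes "cbilinear m" "cbilinear m'"
    and c: "\<And>a b. m a b = m b a" and c': "\<And>a b. m' a b = m' b a"
  shows "tensor_mult m m' s t = tensor_mult m m' t s"
proof (induction s rule: tensor_induct)
  case (tens a b)
  show ?case
    by (induction t rule: tensor_induct)
      (simp_all add: cbilinear_simps[OF cbilinear_tensor_mult(1)[OF assms(1,2)]] tensor_mult_tens[OF assms(1,2)]
        c[of a] c'[of b])
qed (simp add: cbilinear_simps[OF cbilinear_tensor_mult(1)[OF assms(1,2)]])

definition tensor_deriv ::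
  "('a \<Rightarrow> 'a) \<Rightarrow> ('b \<Rightarrow> 'b) \<Rightarrow> ('a::complex_vector, 'b::complex_vector) tensor \<Rightarrow> ('a, 'b) tensor" where
  "tensor_deriv D D' = tensor_lift (\<lambda>a b. D a \<otimes>\<^sub>C b + a \<otimes>\<^sub>C D' b)"

lemma tensor_deriv:
  assumes "clinear D" "clinear D'"
  shows clinear_tensor_deriv: "clinear (tensor_deriv D D')"
    and tensor_deriv_tens: "tensor_deriv D D' (a \<otimes>\<^sub>C b) = D a \<otimes>\<^sub>C b + a \<otimes>\<^sub>C D' b"
proof -
  have b: "cbilinear (\<lambda>a b. D a \<otimes>\<^sub>C b + a \<otimes>\<^sub>C D' b)"
    by (rule cbilinearI)
      (simp_all add: clinear_simps[OF assms(1)] clinear_simps[OF assms(2)] tens_simps scaleC_add_right)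
  show "clinear (tensor_deriv D D')" "tensor_deriv D D' (a \<otimes>\<^sub>C b) = D a \<otimes>\<^sub>C b + a \<otimes>\<^sub>C D' b"
    unfolding tensor_deriv_def by (rule clinear_tensor_lift[OF b] tensor_lift_tens[OF b])+
qed

lemma differential_algebra_tensor:
  assumes "differential_algebra m e D" "differential_algebra m' e' D'"
  shows "differential_algebra (tensor_mult m m') (e \<otimes>\<^sub>C e') (tensor_deriv D D')"
proof -
  interpret A: differential_algebra m e D by fact
  interpret B: differential_algebra m' e' D' by fact
  note bil = cbilinear_tensor_mult(1)[OF A.mul B.mul]
  note [simp] = cbilinear_simps[OF bil] tensor_mult_tens[OF A.mul B.mul]
    clinear_simps[OF clinear_tensor_deriv[OF A.lin B.lin]] tensor_deriv_tens[OF A.lin B.lin]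
  show ?thesis
  proof (rule differential_algebra.intro)
    fix r s t
    show "cbilinear (tensor_mult m m')" by (rule bil)
    show "tensor_mult m m' (tensor_mult m m' r s) t = tensor_mult m m' r (tensor_mult m m' s t)"
      by (rule tensor_mult_assoc[OF A.mul B.mul A.assoc B.assoc])
    show "tensor_mult m m' (e \<otimes>\<^sub>C e') s = s"
      by (induction s rule: tensor_induct) (simp_all add: A.one_left B.one_left)
    show "tensor_mult m m' s (e \<otimes>\<^sub>C e') = s"
      by (induction s rule: tensor_induct) (simp_all add: A.one_right B.one_right)
    show "clinear (tensor_deriv D D')" by (rule clinear_tensor_deriv[OF A.lin B.lin])
    show "tensor_deriv D D' (tensor_mult m m' s t) =
      tensor_mult m m' (tensor_deriv D D' s) t + tensor_mult m m' s (tensor_deriv D D' t)"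
    proof (induction s rule: tensor_induct)
      case (tens a b)
      show ?case
        by (induction t rule: tensor_induct) (simp_all add: A.D_mul B.D_mul tens_simps)
    qed simp
  qed
qed

text \<open>The tensor product of two such vertex algebras is again given by a derivation, acting by
  the Leibniz rule on both factors. So the coproduct respects vertex operators as soon as it is an
  algebra homomorphism that intertwines the derivations.\<close>

lemma tensor_Y_of_derivation:
  assumes "differential_algebra m e D" "differential_algebra m' e' D'"
  shows "tensor_Y (Y_of_derivation m D) (Y_of_derivation m' D') =
    Y_of_derivation (tensor_mult m m') (tensor_deriv D D')"
proof (intro ext)
  fix s t
  interpret A: differential_algebra m e D by fact
  interpret B: differential_algebra m' e' D' by fact
  interpret T: differential_algebra "tensor_mult m m'" "e \<otimes>\<^sub>C e'" "tensor_deriv D D'"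
    by (rule differential_algebra_tensor[OF assms])
  let ?Y = "Y_of_derivation m D" and ?Y' = "Y_of_derivation m' D'"
  let ?Y2 = "Y_of_derivation (tensor_mult m m') (tensor_deriv D D')"
  have *: "Sum_any (\<lambda>i::int. (?Y a c $$ i) \<otimes>\<^sub>C (?Y' b d $$ (n - i))) = ?Y2 (a \<otimes>\<^sub>C b) (c \<otimes>\<^sub>C d) $$ n"
    for a b c d n
  proof (cases "n < 0")
    case True
    have "(?Y a c $$ i) \<otimes>\<^sub>C (?Y' b d $$ (n - i)) = 0" for i
      using True by (cases "i < 0") (simp_all add: A.Y_neg B.Y_neg tens_simps)
    then show ?thesis using True by (simp add: T.Y_neg)
  next
    case False
    then obtain N where n: "n = int N" by (metis nat_0_le not_less)
    have "Sum_any (\<lambda>i::int. (?Y a c $$ i) \<otimes>\<^sub>C (?Y' b d $$ (n - i))) =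
      (\<Sum>i\<in>int ` {..N}. (?Y a c $$ i) \<otimes>\<^sub>C (?Y' b d $$ (n - i)))"
    proof (rule Sum_any_finite)
      fix i assume "i \<notin> int ` {..N}"
      then have "i < 0 \<or> n - i < 0"
        using image_eqI[of i int "nat i" "{..N}"] by (cases "i < 0") (auto simp: n nat_le_iff)
      then show "(?Y a c $$ i) \<otimes>\<^sub>C (?Y' b d $$ (n - i)) = 0"
        by (auto simp: A.Y_neg B.Y_neg tens_simps)
    qed simp
    also have "\<dots> = (\<Sum>k\<le>N. (?Y a c $$ int k) \<otimes>\<^sub>C (?Y' b d $$ (n - int k)))"
      by (rule sum.reindex_cong[of int]) simp_all
    also have "\<dots> = (\<Sum>k\<le>N. m (dpow D k a) c \<otimes>\<^sub>C m' (dpow D' (N - k) b) d)"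
    proof (rule sum.cong[OF refl])
      fix k assume "k \<in> {..N}"
      then show "(?Y a c $$ int k) \<otimes>\<^sub>C (?Y' b d $$ (n - int k)) =
          m (dpow D k a) c \<otimes>\<^sub>C m' (dpow D' (N - k) b) d"
        using B.Y_nat[of b d "N - k"] by (simp add: n of_nat_diff A.Y_nat)
    qed
    also have "\<dots> = ?Y2 (a \<otimes>\<^sub>C b) (c \<otimes>\<^sub>C d) $$ n"
      unfolding n T.Y_nat
      by (simp add: dpow_leibniz[OF cbilinear_tens A.lin B.lin T.lin tensor_deriv_tens[OF A.lin B.lin]]
          T.mul_simps tensor_mult_tens[OF A.mul B.mul])
    finally show ?thesis .
  qed
  have "tensor_Y ?Y ?Y' s t =
      tensor_lift (\<lambda>a b. tensor_lift (\<lambda>c d. ?Y2 (a \<otimes>\<^sub>C b) (c \<otimes>\<^sub>C d)) t) s"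
    unfolding tensor_Y_def by (simp only: * fls_nth_inverse)
  also have "\<dots> = tensor_lift (\<lambda>a b. ?Y2 (a \<otimes>\<^sub>C b) t) s"
    by (simp only: tensor_lift_unique[OF cbilinear_right[OF T.cbilinear_Y]])
  also have "\<dots> = ?Y2 s t"
    by (rule tensor_lift_unique[OF cbilinear_left[OF T.cbilinear_Y]])
  finally show "tensor_Y ?Y ?Y' s t = ?Y2 s t" .
qed

abbreviation BL_mult :: "'l::ab_group_add lattice_alg \<Rightarrow> 'l lattice_alg \<Rightarrow> 'l lattice_alg" where
  "BL_mult \<equiv> B_mult trivial_cocycle"

abbreviation BL2_mult :: "('l::ab_group_add lattice_alg, 'l lattice_alg) tensor \<Rightarrow>
    ('l lattice_alg, 'l lattice_alg) tensor \<Rightarrow> ('l lattice_alg, 'l lattice_alg) tensor" where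
  "BL2_mult \<equiv> tensor_mult BL_mult BL_mult"

global_interpretation BL: differential_algebra BL_mult B_one B_trans
  by (rule differential_algebra_B[OF trivial_cocycle])

global_interpretation BL2: differential_algebra BL2_mult "B_one \<otimes>\<^sub>C B_one" "tensor_deriv B_trans B_trans"
  by (rule differential_algebra_tensor[OF BL.differential_algebra_axioms BL.differential_algebra_axioms])

lemma BL_mult_bas: "BL_mult (bas \<alpha> u) (bas \<beta> w) = bas (\<alpha> + \<beta>) (u * w)"
  by (simp add: B_mult_bas scaleC_one)

lemma BL2_mult_commute: "BL2_mult s t = BL2_mult t s"
  by (rule tensor_mult_commute[OF BL.mul BL.mul B_mult_commute B_mult_commute])

lemma BL2_mult_tens: "BL2_mult (a \<otimes>\<^sub>C b) (c \<otimes>\<^sub>C d) = BL_mult a c \<otimes>\<^sub>C BL_mult b d"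
  by (rule tensor_mult_tens[OF BL.mul BL.mul])

text \<open>Products of arbitrary elements are allowed in the last case, so statements that are
  multiplicative in the element reduce to group-like and primitive generators.\<close>

lemma BL_gen_induct [case_names add scale group prim mult]:
  assumes add: "\<And>s t. P s \<Longrightarrow> P t \<Longrightarrow> P (s + t)" and scale: "\<And>c s. P s \<Longrightarrow> P (c *\<^sub>C s)"
    and group: "\<And>\<alpha>. P (bas \<alpha> 1)" and prim: "\<And>\<alpha> k. P (bas 0 (sym_inc (osc \<alpha> k)))"
    and mult: "\<And>s t. P s \<Longrightarrow> P t \<Longrightarrow> P (BL_mult s t)"
  shows "P (v :: 'l::ab_group_add lattice_alg)"
proof (induction v rule: lattice_alg_induct)
  case (bas \<alpha> u)
  have "P (bas 0 u)"
  proof (induction u rule: heis_induct)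
    case (mult \<alpha> k s)
    then show ?case using assms(5)[OF prim mult, of \<alpha> k] by (simp add: BL_mult_bas)
  qed (use assms in \<open>simp_all add: tens_simps\<close>)
  then show ?case using mult[OF group, of "bas 0 u" \<alpha>] by (simp add: BL_mult_bas)
qed (rule add)

lemma BL_hom_eqI:
  assumes "clinear F" "clinear G" "\<And>a b. F (BL_mult a b) = mm (F a) (F b)" "\<And>a b. G (BL_mult a b) = mm (G a) (G b)"
    and "\<And>\<alpha>. F (bas \<alpha> 1) = G (bas \<alpha> 1)" "\<And>\<alpha> k. F (bas 0 (sym_inc (osc \<alpha> k))) = G (bas 0 (sym_inc (osc \<alpha> k)))"
  shows "F v = G v"
  by (induction v rule: BL_gen_induct)
    (simp_all only: assms(3-) clinear_add[OF assms(1)] clinear_add[OF assms(2)]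
      clinear_scale[OF assms(1)] clinear_scale[OF assms(2)])

section \<open>The coproduct and the counit\<close>

definition is_BL_comult :: "('l::ab_group_add lattice_alg \<Rightarrow> ('l lattice_alg, 'l lattice_alg) tensor) \<Rightarrow> bool" where
  "is_BL_comult \<Delta> \<longleftrightarrow> clinear \<Delta> \<and> \<Delta> B_one = B_one \<otimes>\<^sub>C B_one \<and>
     (\<forall>a b. \<Delta> (BL_mult a b) = BL2_mult (\<Delta> a) (\<Delta> b)) \<and>
     (\<forall>\<alpha>. \<Delta> (bas \<alpha> 1) = bas \<alpha> 1 \<otimes>\<^sub>C bas \<alpha> 1) \<and>
     (\<forall>v. \<Delta> (bas 0 (sym_inc v)) = bas 0 (sym_inc v) \<otimes>\<^sub>C B_one + B_one \<otimes>\<^sub>C bas 0 (sym_inc v))"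

text \<open>The symmetric algebra acts on the tensor square by multiplication with the prescribed
  coproducts \<open>d v\<close> of primitive elements. The value on \<open>bas \<alpha> u\<close> is
  this action of \<open>u\<close> on the group-like element \<open>e \<alpha>\<close>.\<close>

lemma is_BL_comult_ex: "\<exists>\<Delta>. is_BL_comult (\<Delta> :: 'l::ab_group_add lattice_alg \<Rightarrow> _)"
proof -
  define d where "d v = bas 0 (sym_inc v) \<otimes>\<^sub>C B_one + B_one \<otimes>\<^sub>C bas 0 (sym_inc v)" for v :: "'l hminus"
  have d: "clinear d"
    by (rule clinearI) (simp_all add: d_def clinear_simps[OF clinear_sym_inc] tens_simps scaleC_add_right)
  have b: "cbilinear (\<lambda>v t. BL2_mult (d v) t)"
    by (rule cbilinearI) (simp_all add: BL2.mul_simps clinear_simps[OF d])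
  have comm: "BL2_mult (d v) (BL2_mult (d w) t) = BL2_mult (d w) (BL2_mult (d v) t)" for v w t
    by (simp add: BL2.assoc[symmetric] BL2_mult_commute[of "d v" "d w"])
  obtain g where g: "cbilinear g" "\<And>x. g 1 x = x" "\<And>s t x. g (s * t) x = g s (g t x)"
    "\<And>v x. g (sym_inc v) x = BL2_mult (d v) x"
    using sym_action_ex[OF b comm] by blast
  have gm: "g s (BL2_mult x y) = BL2_mult (g s x) y" for s x y
    by (induction s arbitrary: x rule: sym_induct)
      (simp_all add: g cbilinear_simps[OF g(1)] BL2.mul_simps BL2.assoc)
  have gm': "g s (BL2_mult x y) = BL2_mult x (g s y)" for s x y
    using gm[of s y x] BL2_mult_commute by metis
  define e where "e \<alpha> = (bas \<alpha> 1 \<otimes>\<^sub>C bas \<alpha> 1 :: ('l lattice_alg, 'l lattice_alg) tensor)" for \<alpha>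
  have e: "BL2_mult (e \<alpha>) (e \<beta>) = e (\<alpha> + \<beta>)" for \<alpha> \<beta>
    by (simp add: e_def BL2_mult_tens BL_mult_bas)
  \<comment> \<open>The action slides out of either factor of a product by \<open>gm\<close> and
    \<open>gm'\<close>, leaving the product of the two group-like elements.\<close>
  have ge: "BL2_mult (g u (e \<alpha>)) (g w (e \<beta>)) = g u (g w (e (\<alpha> + \<beta>)))" for u w \<alpha> \<beta>
    by (subst gm[symmetric], subst gm'[symmetric]) (simp only: e)
  have lin: "clinear (\<lambda>u. g u (e \<alpha>))" for \<alpha> by (rule cbilinear_left[OF g(1)])
  define \<Delta> where "\<Delta> = B_lift (\<lambda>\<alpha> u. g u (e \<alpha>))"
  have \<Delta>: "clinear \<Delta>" "\<Delta> (bas \<alpha> u) = g u (e \<alpha>)" for \<alpha> u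
    unfolding \<Delta>_def by (rule B_lift[of "\<lambda>\<alpha> u. g u (e \<alpha>)", OF lin])+
  have "\<Delta> (BL_mult a b) = BL2_mult (\<Delta> a) (\<Delta> b)" for a b
  proof (induction a rule: lattice_alg_induct)
    case (bas \<alpha> u)
    show ?case
      by (induction b rule: lattice_alg_induct)
        (simp_all add: \<Delta> BL_mult_bas clinear_simps[OF \<Delta>(1)] BL.mul_simps BL2.mul_simps g(3) ge)
  qed (simp add: clinear_simps[OF \<Delta>(1)] BL.mul_simps BL2.mul_simps)
  moreover have "\<Delta> B_one = B_one \<otimes>\<^sub>C B_one"
    using \<Delta>(2)[of 0 1] by (simp add: g e_def flip: B_one_def)
  moreover have "BL2_mult (d v) (e 0) = d v" for v
    by (simp add: e_def BL2.one_right flip: B_one_def)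
  ultimately have "is_BL_comult \<Delta>"
    by (simp add: is_BL_comult_def \<Delta> g) (simp add: e_def d_def)
  then show ?thesis by blast
qed

lemma BL_comult: "is_BL_comult (BL_comult :: 'l::ab_group_add lattice_alg \<Rightarrow> _)"
proof -
  have "\<Delta> = \<Delta>'" if "is_BL_comult \<Delta>" "is_BL_comult \<Delta>'" for \<Delta> \<Delta>' :: "'l lattice_alg \<Rightarrow> _"
    by (rule ext, rule BL_hom_eqI[of \<Delta> \<Delta>' BL2_mult]) (use that in \<open>simp_all add: is_BL_comult_def\<close>)
  then have "\<exists>!\<Delta> :: 'l lattice_alg \<Rightarrow> _. is_BL_comult \<Delta>"
    using is_BL_comult_ex by blast
  from theI'[OF this] show ?thesis unfolding BL_comult_def is_BL_comult_def .
qed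

lemma BL_comult_simps:
  shows clinear_BL_comult: "clinear BL_comult"
    and BL_comult_one: "BL_comult B_one = B_one \<otimes>\<^sub>C B_one"
    and BL_comult_mult: "BL_comult (BL_mult a b) = BL2_mult (BL_comult a) (BL_comult b)"
    and BL_comult_group: "BL_comult (bas \<alpha> 1) = bas \<alpha> 1 \<otimes>\<^sub>C bas \<alpha> 1"
    and BL_comult_prim: "BL_comult (bas 0 (sym_inc v)) = bas 0 (sym_inc v) \<otimes>\<^sub>C B_one + B_one \<otimes>\<^sub>C bas 0 (sym_inc v)"
  using BL_comult unfolding is_BL_comult_def by blast+

definition is_BL_counit :: "('l::ab_group_add lattice_alg \<Rightarrow> complex) \<Rightarrow> bool" where
  "is_BL_counit \<epsilon> \<longleftrightarrow> clinear \<epsilon> \<and> \<epsilon> B_one = 1 \<and> (\<forall>a b. \<epsilon> (BL_mult a b) = \<epsilon> a * \<epsilon> b) \<and>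
     (\<forall>\<alpha>. \<epsilon> (bas \<alpha> 1) = 1) \<and> (\<forall>v. \<epsilon> (bas 0 (sym_inc v)) = 0)"

lemma is_BL_counit_ex: "\<exists>\<epsilon>. is_BL_counit (\<epsilon> :: 'l::ab_group_add lattice_alg \<Rightarrow> _)"
proof -
  have "clinear (\<lambda>_ :: 'l hminus. 0 :: complex)" by (rule clinearI) (simp_all add: scaleC_simps)
  from sym_hom_ex[OF this] obtain h :: "'l heis \<Rightarrow> complex" where
    h: "clinear h" "h 1 = 1" "\<And>s t. h (s * t) = h s * h t" "\<And>v. h (sym_inc v) = 0" by blast
  define \<epsilon> where "\<epsilon> = B_lift (\<lambda>\<alpha> :: 'l. h)"
  have \<epsilon>: "clinear \<epsilon>" "\<epsilon> (bas \<alpha> u) = h u" for \<alpha> u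
    unfolding \<epsilon>_def by (rule B_lift[of "\<lambda>\<alpha>. h", OF h(1)])+
  have "\<epsilon> (BL_mult a b) = \<epsilon> a * \<epsilon> b" for a b
  proof (induction a rule: lattice_alg_induct)
    case (bas \<alpha> u)
    show ?case
      by (induction b rule: lattice_alg_induct)
        (simp_all add: \<epsilon> BL_mult_bas clinear_simps[OF \<epsilon>(1)] BL.mul_simps h(3) algebra_simps)
  qed (simp add: clinear_simps[OF \<epsilon>(1)] BL.mul_simps algebra_simps)
  then have "is_BL_counit \<epsilon>"
    by (simp add: is_BL_counit_def \<epsilon> h B_one_def)
  then show ?thesis by blast
qed

lemma BL_counit: "is_BL_counit (BL_counit :: 'l::ab_group_add lattice_alg \<Rightarrow> _)"
proof -
  have "\<epsilon> = \<epsilon>'" if "is_BL_counit \<epsilon>" "is_BL_counit \<epsilon>'" for \<epsilon> \<epsilon>' :: "'l lattice_alg \<Rightarrow> _"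
    by (rule ext, rule BL_hom_eqI[of \<epsilon> \<epsilon>' "(*)"]) (use that in \<open>simp_all add: is_BL_counit_def\<close>)
  then have "\<exists>!\<epsilon> :: 'l lattice_alg \<Rightarrow> _. is_BL_counit \<epsilon>"
    using is_BL_counit_ex by blast
  from theI'[OF this] show ?thesis unfolding BL_counit_def is_BL_counit_def .
qed

lemma BL_counit_simps:
  shows clinear_BL_counit: "clinear BL_counit"
    and BL_counit_one: "BL_counit B_one = 1"
    and BL_counit_mult: "BL_counit (BL_mult a b) = BL_counit a * BL_counit b"
    and BL_counit_group: "BL_counit (bas \<alpha> 1) = 1"
    and BL_counit_prim: "BL_counit (bas 0 (sym_inc v)) = 0"
  using BL_counit unfolding is_BL_counit_def by blast+

text \<open>Both sides are algebra homomorphisms into the threefold tensor product with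
  multiplication \<open>?m3\<close>, so generators suffice. Multiplicativity of the right side goes
  through that of the inner lift \<open>?Q\<close>.\<close>

lemma BL_coassoc:
  "tensor_lift (\<lambda>a b. BL_comult a \<otimes>\<^sub>C b) (BL_comult h) =
   tensor_lift (\<lambda>a b. tensor_lift (\<lambda>c d. (a \<otimes>\<^sub>C c) \<otimes>\<^sub>C d) (BL_comult b)) (BL_comult (h :: 'l::ab_group_add lattice_alg))"
proof -
  let ?m3 = "tensor_mult BL2_mult (BL_mult :: 'l lattice_alg \<Rightarrow> _)"
  note m3 = cbilinear_simps[OF cbilinear_tensor_mult(1)[OF BL2.mul BL.mul]] tensor_mult_tens[OF BL2.mul BL.mul]
  let ?L = "tensor_lift (\<lambda>a b. BL_comult a \<otimes>\<^sub>C (b :: 'l lattice_alg))"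
  let ?Q = "\<lambda>a :: 'l lattice_alg. tensor_lift (\<lambda>(c :: 'l lattice_alg) (d :: 'l lattice_alg). (a \<otimes>\<^sub>C c) \<otimes>\<^sub>C d)"
  let ?R = "tensor_lift (\<lambda>a b. ?Q a (BL_comult b))"
  note c = clinear_simps[OF clinear_BL_comult]
  have bL: "cbilinear (\<lambda>a b. BL_comult a \<otimes>\<^sub>C (b :: 'l lattice_alg))"
    by (rule cbilinearI) (simp_all add: c tens_simps)
  have bQ: "cbilinear (\<lambda>(c :: 'l lattice_alg) (d :: 'l lattice_alg). (a \<otimes>\<^sub>C c) \<otimes>\<^sub>C d)" for a :: "'l lattice_alg"
    by (rule cbilinearI) (simp_all add: tens_simps)
  note Q = tensor_lift_tens[OF bQ] clinear_simps[OF clinear_tensor_lift[OF bQ]]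
  have Qlin: "clinear (\<lambda>a. ?Q a t)" for t
    by (rule clinear_tensor_lift_fun[where f = "\<lambda>(a :: 'l lattice_alg) (c :: 'l lattice_alg) (d :: 'l lattice_alg).
        (a \<otimes>\<^sub>C c) \<otimes>\<^sub>C d", OF bQ]) (rule clinearI; simp only: tens_simps)
  have Q1: "?Q (a + a') t = ?Q a t + ?Q a' t" for a a' t
    by (rule clinear_add[OF Qlin])
  have Q2: "?Q (k *\<^sub>C a) t = k *\<^sub>C ?Q a t" for a t k
    by (rule clinear_scale[OF Qlin])
  have bR: "cbilinear (\<lambda>a b. ?Q a (BL_comult b))"
    by (rule cbilinearI) (simp_all only: c Q Q1 Q2)
  note L = tensor_lift_tens[OF bL] clinear_simps[OF clinear_tensor_lift[OF bL]]
  note Q = Q Q1 Q2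
  note R = tensor_lift_tens[OF bR] clinear_simps[OF clinear_tensor_lift[OF bR]]
  have Lm: "?L (BL2_mult s t) = ?m3 (?L s) (?L t)" for s t
  proof (induction s rule: tensor_induct)
    case (tens a b)
    show ?case
      by (induction t rule: tensor_induct) (simp_all only: L m3 BL2_mult_tens BL_comult_mult BL2.mul_simps)
  qed (simp only: L m3 BL2.mul_simps)
  have Qm: "?Q (BL_mult a b) (BL2_mult s t) = ?m3 (?Q a s) (?Q b t)" for a b s t
  proof (induction s rule: tensor_induct)
    case (tens a' b')
    show ?case
      by (induction t rule: tensor_induct) (simp_all only: Q m3 BL2_mult_tens BL2.mul_simps)
  qed (simp only: Q m3 BL2.mul_simps)
  have Rm: "?R (BL2_mult s t) = ?m3 (?R s) (?R t)" for s t
  proof (induction s rule: tensor_induct)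
    case (tens a b)
    show ?case
      by (induction t rule: tensor_induct) (simp_all only: R m3 BL2_mult_tens BL_comult_mult BL2.mul_simps Qm)
  qed (simp only: R m3 BL2.mul_simps)
  show ?thesis
  proof (rule BL_hom_eqI[where F = "\<lambda>h. ?L (BL_comult h)" and G = "\<lambda>h. ?R (BL_comult h)" and mm = ?m3])
    show "clinear (\<lambda>h. ?L (BL_comult h))" "clinear (\<lambda>h. ?R (BL_comult h))"
      by (rule clinearI; simp only: c L R)+
  qed (simp_all only: BL_comult_simps Lm Rm L R Q tens_simps add.assoc)
qed

lemma BL_coalgebra: "coalgebra BL_comult (BL_counit :: 'l::ab_group_add lattice_alg \<Rightarrow> _)"
proof -
  note c = clinear_simps[OF clinear_BL_comult] and e = clinear_simps[OF clinear_BL_counit]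
  have id: "clinear (\<lambda>h :: 'l lattice_alg. h)" by (rule clinearI) simp_all
  have b1: "cbilinear (\<lambda>a b :: 'l lattice_alg. BL_counit a *\<^sub>C b)"
    and b2: "cbilinear (\<lambda>a b :: 'l lattice_alg. BL_counit b *\<^sub>C a)"
    by (rule cbilinearI; simp add: e scaleC_simps scaleC_add_left scaleC_complex_def mult.commute)+
  note l1 = tensor_lift_tens[OF b1] clinear_simps[OF clinear_tensor_lift[OF b1]]
  note l2 = tensor_lift_tens[OF b2] clinear_simps[OF clinear_tensor_lift[OF b2]]
  let ?L1 = "tensor_lift (\<lambda>a b :: 'l lattice_alg. BL_counit a *\<^sub>C b)"
  let ?L2 = "tensor_lift (\<lambda>a b :: 'l lattice_alg. BL_counit b *\<^sub>C a)"
  have m1: "?L1 (BL2_mult s t) = BL_mult (?L1 s) (?L1 t)" for s t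
  proof (induction s rule: tensor_induct)
    case (tens a b)
    show ?case
      by (induction t rule: tensor_induct)
        (simp_all only: l1 BL2_mult_tens BL_counit_mult BL2.mul_simps BL.mul_simps scaleC_scaleC mult.commute)
  qed (simp only: l1 BL2.mul_simps BL.mul_simps)
  have m2: "?L2 (BL2_mult s t) = BL_mult (?L2 s) (?L2 t)" for s t
  proof (induction s rule: tensor_induct)
    case (tens a b)
    show ?case
      by (induction t rule: tensor_induct)
        (simp_all only: l2 BL2_mult_tens BL_counit_mult BL2.mul_simps BL.mul_simps scaleC_scaleC mult.commute)
  qed (simp only: l2 BL2.mul_simps BL.mul_simps)
  have "?L1 (BL_comult h) = h" for h
  proof (rule BL_hom_eqI[where F = "\<lambda>h. ?L1 (BL_comult h)" and G = "\<lambda>h. h" and mm = BL_mult])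
    show "clinear (\<lambda>h. ?L1 (BL_comult h))" by (rule clinearI; simp only: c l1)
  qed (simp_all add: BL_comult_simps m1 l1 BL_counit_simps id scaleC_simps)
  moreover have "?L2 (BL_comult h) = h" for h
  proof (rule BL_hom_eqI[where F = "\<lambda>h. ?L2 (BL_comult h)" and G = "\<lambda>h. h" and mm = BL_mult])
    show "clinear (\<lambda>h. ?L2 (BL_comult h))" by (rule clinearI; simp only: c l2)
  qed (simp_all add: BL_comult_simps m2 l2 BL_counit_simps id scaleC_simps)
  ultimately show ?thesis
    by (simp add: coalgebra_def clinear_BL_comult clinear_BL_counit BL_coassoc)
qed

lemma B_trans_group: "B_trans (bas \<alpha> 1) = BL_mult (bas \<alpha> 1) (bas 0 (sym_inc (osc \<alpha> 0)))"
  by (simp add: B_trans_bas heis_conn_def heis_trans_simps BL_mult_bas)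

lemma B_trans_prim: "B_trans (bas 0 (sym_inc (osc \<alpha> k))) = of_nat (Suc k) *\<^sub>C bas 0 (sym_inc (osc \<alpha> (Suc k)))"
  by (simp add: B_trans_bas heis_conn_def heis_trans_osc osc_zero clinear_simps[OF clinear_sym_inc] tens_simps del: of_nat_Suc)

lemma BL_comult_trans: "BL_comult (B_trans h) = tensor_deriv B_trans B_trans (BL_comult h)"
proof (induction h rule: BL_gen_induct)
  case (group \<alpha>)
  show ?case
    by (simp add: B_trans_group BL_comult_simps BL2.mul_simps BL2_mult_tens BL.one_right
        tensor_deriv_tens[OF BL.lin BL.lin])
next
  case (prim \<alpha> k)
  show ?case
    by (simp add: B_trans_prim BL_comult_simps clinear_simps[OF clinear_BL_comult] clinear_simps[OF BL2.lin]
        tensor_deriv_tens[OF BL.lin BL.lin] tens_simps scaleC_add_right BL.D_one del: of_nat_Suc)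
next
  case (mult s t)
  then show ?case
    by (simp add: BL.D_mul BL2.D_mul BL_comult_simps clinear_simps[OF clinear_BL_comult])
qed (simp_all add: clinear_simps[OF clinear_BL_comult] clinear_simps[OF BL2.lin] clinear_simps[OF BL.lin])

lemma BL_counit_trans: "BL_counit (B_trans h) = 0"
proof (induction h rule: BL_gen_induct)
  case (mult s t)
  then show ?case
    by (simp add: BL.D_mul BL_counit_simps clinear_simps[OF clinear_BL_counit])
qed (simp_all add: B_trans_group B_trans_prim BL_counit_simps clinear_simps[OF clinear_BL_counit]
    clinear_simps[OF BL.lin] scaleC_simps del: of_nat_Suc)

lemma BL_vertex_bialgebra:
  "vertex_bialgebra (B_Y trivial_cocycle) B_one BL_comult (BL_counit :: 'l::ab_group_add lattice_alg \<Rightarrow> _)"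
proof -
  interpret nonlocal_vertex_algebra "B_Y trivial_cocycle" "B_one :: 'l lattice_alg"
    unfolding B_Y_def by (rule BL.nonlocal_vertex_algebra)
  show ?thesis
  proof
    show "coalgebra BL_comult (BL_counit :: 'l lattice_alg \<Rightarrow> _)" by (rule BL_coalgebra)
    show "nonlocal_va_hom (B_Y trivial_cocycle) B_one (tensor_Y (B_Y trivial_cocycle) (B_Y trivial_cocycle))
      (B_one \<otimes>\<^sub>C B_one) (BL_comult :: 'l lattice_alg \<Rightarrow> _)"
      unfolding nonlocal_va_hom_def B_Y_def
        tensor_Y_of_derivation[OF BL.differential_algebra_axioms BL.differential_algebra_axioms]
    proof (intro conjI allI clinear_BL_comult BL_comult_one)
      fix u v :: "'l lattice_alg" and n
      show "BL_comult (Y_of_derivation BL_mult B_trans u v $$ n) =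
        Y_of_derivation BL2_mult (tensor_deriv B_trans B_trans) (BL_comult u) (BL_comult v) $$ n"
      proof (cases "n < 0")
        case True
        then show ?thesis by (simp add: BL.Y_neg BL2.Y_neg clinear_zero[OF clinear_BL_comult])
      next
        case False
        then obtain N where "n = int N" by (metis nat_0_le not_less)
        then show ?thesis
          by (simp add: BL.Y_nat BL2.Y_nat BL_comult_mult
              dpow_commute[of BL_comult B_trans "tensor_deriv B_trans B_trans", OF clinear_BL_comult BL_comult_trans])
      qed
    qed
    show "nonlocal_va_hom (B_Y trivial_cocycle) B_one (\<lambda>a b. fls_const (a * b)) 1 (BL_counit :: 'l lattice_alg \<Rightarrow> _)"
      unfolding nonlocal_va_hom_def B_Y_def
    proof (intro conjI allI clinear_BL_counit BL_counit_one)
      fix u v :: "'l lattice_alg" and n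
      \<comment> \<open>The counit kills the image of L(-1), so only the constant term of Y(u,x)v
        survives, as the vertex algebra of constants requires.\<close>
      have d: "BL_counit (dpow B_trans N u) = (if N = 0 then BL_counit u else 0)" for N
        by (cases N) (simp_all add: dpow_def BL_counit_trans clinear_simps[OF clinear_BL_counit] scaleC_simps)
      show "BL_counit (Y_of_derivation BL_mult B_trans u v $$ n) = fls_const (BL_counit u * BL_counit v) $$ n"
      proof (cases "n < 0")
        case True
        then show ?thesis by (simp add: BL.Y_neg clinear_zero[OF clinear_BL_counit])
      next
        case False
        then obtain N where "n = int N" by (metis nat_0_le not_less)
        then show ?thesis by (simp add: BL.Y_nat BL_counit_mult d)
      qed
    qed
  qed
qed

section \<open>The module structure\<close>

lemma nth_Abs_fls_finite:
  assumes "finite {n. f n \<noteq> 0}"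
  shows "Abs_fls f $$ n = f n"
proof -
  have "finite ((\<lambda>n :: nat. - int n) -` {n. f n \<noteq> 0})"
    by (rule finite_vimageI[OF assms]) (auto intro: injI)
  then have "\<forall>\<^sub>\<infinity>n. f (- int n) = 0"
    by (simp add: eventually_cofinite vimage_def)
  then show ?thesis by (simp add: Abs_fls_inverse)
qed

lemma finite_fls_neg: "finite {k :: nat. F $$ (b - int k) \<noteq> 0}"
proof (rule finite_subset)
  show "{k :: nat. F $$ (b - int k) \<noteq> 0} \<subseteq> {..nat (b - fls_subdegree F)}"
  proof
    fix k :: nat assume "k \<in> {k. F $$ (b - int k) \<noteq> 0}"
    then have "\<not> b - int k < fls_subdegree F" by auto
    then show "k \<in> {..nat (b - fls_subdegree F)}" by (auto simp: le_nat_iff)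
  qed
qed simp

section \<open>Multiplication by powers of x_0+x_2 and expansion of binomials\<close>

lemma sum_binomial_Suc:
  "(\<Sum>t\<le>Suc l. of_nat (Suc l choose t) *\<^sub>C g t) =
   (\<Sum>t\<le>l. of_nat (l choose t) *\<^sub>C g t) + (\<Sum>t\<le>l. of_nat (l choose t) *\<^sub>C g (Suc t))"
proof -
  have "(\<Sum>t\<le>Suc l. of_nat (Suc l choose t) *\<^sub>C g t) =
      g 0 + (\<Sum>t\<le>l. of_nat (l choose Suc t) *\<^sub>C g (Suc t)) + (\<Sum>t\<le>l. of_nat (l choose t) *\<^sub>C g (Suc t))"
    by (simp only: sum.atMost_Suc_shift binomial_Suc_Suc of_nat_add scaleC_add_left sum.distrib)
      (simp add: scaleC_one algebra_simps)
  also have "g 0 + (\<Sum>t\<le>l. of_nat (l choose Suc t) *\<^sub>C g (Suc t)) = (\<Sum>t\<le>Suc l. of_nat (l choose t) *\<^sub>C g t)"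
    by (simp only: sum.atMost_Suc_shift) (simp add: scaleC_one)
  also have "\<dots> = (\<Sum>t\<le>l. of_nat (l choose t) *\<^sub>C g t)"
    by (simp add: binomial_eq_0 scaleC_simps)
  finally show ?thesis .
qed

lemma mult_sum_power_Suc:
  "mult_sum_power (Suc l) F a b = mult_sum_power l F (a - 1) b + mult_sum_power l F a (b - 1)"
proof -
  have "a - int (Suc l - t) = a - 1 - int (l - t)" if "t \<le> l" for t
    using that by (simp add: Suc_diff_le)
  then show ?thesis
    unfolding mult_sum_power_def sum_binomial_Suc by (simp add: algebra_simps)
qed

lemma mult_sum_power_mono:
  assumes "mult_sum_power l F = mult_sum_power l G" "l \<le> l'"
  shows "mult_sum_power l' F = mult_sum_power l' G"
  using assms(2) by (induction l' rule: dec_induct) (simp_all add: assms(1) fun_eq_iff mult_sum_power_Suc)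

lemma mult_sum_power_diff:
  "mult_sum_power l (\<lambda>a b. F a b - G a b) a b = mult_sum_power l F a b - mult_sum_power l G a b"
  by (simp add: mult_sum_power_def sum_subtractf scaleC_simps)

lemma mult_sum_power_add:
  "mult_sum_power l (\<lambda>a b. F a b + G a b) a b = mult_sum_power l F a b + mult_sum_power l G a b"
  by (simp add: mult_sum_power_def sum.distrib scaleC_simps)

text \<open>The difference of the two series involves only nonnegative powers of x_0. Multiplying by
  (x_0+x_2)^l multiplies its lowest coefficient in x_0 by x_2^l, so the difference must
  vanish.\<close>

lemma mult_sum_power_cancel:
  assumes eq: "mult_sum_power l F = mult_sum_power l G" and neg: "\<And>a b. a < 0 \<Longrightarrow> F a b = G a b"
  shows "F a b = G a b"
proof -
  let ?d = "\<lambda>a b. F a b - G a b"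
  have "?d (int n) b = 0 \<and> (\<forall>m<n. \<forall>b. ?d (int m) b = 0)" for n b
  proof (induction n arbitrary: b rule: less_induct)
    case (less n)
    have IH: "F a b = G a b" if "a < int n" for a b
    proof (cases "a < 0")
      case False
      then show ?thesis using less[of "nat a" b] that by auto
    qed (simp add: neg)
    \<comment> \<open>The shift by l in the second exponent selects the summand j = l, where only
      x_2 is used. All other summands involve a smaller power of x_0 and vanish by
      induction.\<close>
    have "0 = mult_sum_power l ?d (int n) (b + int l)"
      by (simp add: mult_sum_power_diff eq)
    also have "\<dots> = (\<Sum>j\<le>l. if j = l then ?d (int n) b else 0)"
      unfolding mult_sum_power_def
      by (rule sum.cong[OF refl]) (auto simp: scaleC_one scaleC_simps IH)
    finally show ?case using IH by auto
  qed
  then show ?thesis by (cases "a < 0") (use neg in \<open>auto simp: not_less dest: zero_le_imp_eq_int\<close>)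
qed

text \<open>The value zero at negative lower index lets sums run over the whole support of a Laurent
  polynomial, with no constraint on the exponents.\<close>

definition ibinom :: "int \<Rightarrow> int \<Rightarrow> complex" where
  "ibinom i k = (if k < 0 then 0 else of_int i gchoose nat k)"

lemma ibinom_Suc: "ibinom (i + 1) k = ibinom i k + ibinom i (k - 1)"
proof (cases "k \<le> 0")
  case False
  then have "nat k = Suc (nat (k - 1))" by simp
  then show ?thesis
    using False gbinomial_Suc_Suc[of "of_int i :: complex" "nat (k - 1)"] by (simp add: ibinom_def)
qed (auto simp: ibinom_def)

text \<open>Multiplying an expanded power of x_0+x_2 by (x_0+x_2)^l adds l to the exponent, also
  when the exponent is negative.\<close>

lemma ibinom_vandermonde:
  "(\<Sum>t\<le>l. of_nat (l choose t) *\<^sub>C ibinom i (k - int t)) = ibinom (i + int l) k"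
proof (induction l arbitrary: k)
  case 0
  show ?case by (simp add: scaleC_one)
next
  case (Suc l)
  have "(\<Sum>t\<le>l. of_nat (l choose t) *\<^sub>C ibinom i (k - int (Suc t))) = ibinom (i + int l) (k - 1)"
    using Suc[of "k - 1"] by (simp add: diff_diff_eq)
  then show ?case
    using ibinom_Suc[of "i + int l" k] by (simp add: sum_binomial_Suc Suc algebra_simps del: sum.atMost_Suc binomial_Suc_Suc)
qed

text \<open>Nonnegative powers of x_0+x_2 have the same expansion in either direction. This is where
  the two sides of weak associativity are brought together.\<close>

lemma ibinom_symmetric:
  assumes "N \<ge> 0"
  shows "ibinom N (N - k) = ibinom N k"
proof -
  obtain n where n: "N = int n" using assms nonneg_int_cases by blast
  have b: "ibinom (int n) k = (if k < 0 then 0 else of_nat (n choose nat k))" for k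
    by (simp add: ibinom_def gbinomial_of_nat del: of_int_of_nat_eq)
  show ?thesis
  proof (cases "0 \<le> k \<and> k \<le> N")
    case True
    then have "nat (int n - k) = n - nat k" "nat k \<le> n" "\<not> k < 0" "\<not> int n - k < 0"
      by (auto simp: n nat_diff_distrib)
    then show ?thesis unfolding n b by (simp add: binomial_symmetric[of "nat k"])
  next
    case False
    then show ?thesis unfolding b n by (auto simp: binomial_eq_0)
  qed
qed

lemma lookup_single_mult:
  fixes q :: "int \<Rightarrow>\<^sub>0 'a::ccalgebra"
  shows "lookup (single m u * q) n = u * lookup q (n - m)"
  by (induction q rule: poly_mapping_induct)
    (auto simp: distrib_left lookup_add mult_single lookup_single when_def)

lemmas lookup_xpow_mult = lookup_single_mult[of _ 1, simplified]

lemma lookup_mult_lconst: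
  fixes q :: "int \<Rightarrow>\<^sub>0 'a::ccalgebra"
  shows "lookup (q * lconst u) k = lookup q k * u"
  using lookup_single_mult[of 0 u q k] by (simp add: mult.commute)

lemma pm_sum_single:
  fixes p :: "'k \<Rightarrow>\<^sub>0 'a::comm_monoid_add"
  shows "p = (\<Sum>k\<in>keys p. single k (lookup p k))"
  by (rule poly_mapping_eqI)
    (simp add: lookup_sum lookup_single when_def in_keys_iff flip: sum.inter_filter)

lemma laurent_sum: "(p :: int \<Rightarrow>\<^sub>0 'a::ccalgebra) =
    (\<Sum>j\<in>keys p. xpow j * lconst (lookup p j))"
  using pm_sum_single[of p] by (simp add: mult_single)

lemma lookup_dpow_ddx:
  "lookup (dpow ddx n p) m = (of_int (m + int n) gchoose n) *\<^sub>C lookup p (m + int n)"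
proof (induction n arbitrary: m)
  case 0
  show ?case by (simp add: scaleC_one)
next
  case (Suc n)
  have lookup_ddx: "lookup (ddx q) m = of_int (m + 1) *\<^sub>C lookup q (m + 1)"
    for q :: "int \<Rightarrow>\<^sub>0 'a" and m
  proof (induction q rule: poly_mapping_induct)
    case (single k u)
    show ?case by (auto simp: ddx_single lookup_single when_def scaleC_simps)
  qed (simp_all add: clinear_simps[OF clinear_ddx] lookup_add scaleC_simps)
  have "of_nat (Suc n) *\<^sub>C lookup (dpow ddx (Suc n) p) m = lookup (ddx (dpow ddx n p)) m"
    by (simp add: D_dpow[OF clinear_ddx] del: of_nat_Suc)
  also have "\<dots> = (of_int (m + 1) * (of_int (m + 1 + int n) gchoose n)) *\<^sub>C lookup p (m + 1 + int n)"
    by (simp only: lookup_ddx Suc scaleC_scaleC)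
  also have "of_int (m + 1) * (of_int (m + 1 + int n) gchoose n) =
      of_nat (Suc n) * (of_int (m + int (Suc n)) gchoose (Suc n) :: complex)"
  proof -
    have "of_int (m + 1) = (of_int (m + 1 + int n) - of_nat n :: complex)" by simp
    then show ?thesis
      using gbinomial_Suc_mult[of "of_int (m + 1 + int n)" n] by (simp add: mult.commute add.assoc add.commute[of 1])
  qed
  finally have "of_nat (Suc n) *\<^sub>C lookup (dpow ddx (Suc n) p) m =
      of_nat (Suc n) *\<^sub>C (of_int (m + int (Suc n)) gchoose (Suc n)) *\<^sub>C lookup p (m + int (Suc n))"
    by (simp only: scaleC_scaleC) (simp add: algebra_simps)
  then show ?case
    by (simp only: complex_vector.scale_cancel_left of_nat_eq_0_iff nat.distinct simp_thms)
qed

definition laurent_fls :: "'l::ab_group_add \<Rightarrow> 'l laurent \<Rightarrow> 'l lattice_alg fls" where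
  "laurent_fls \<beta> p = Abs_fls (\<lambda>n. bas \<beta> (lookup p n))"

lemma laurent_fls_nth [simp]: "laurent_fls \<beta> p $$ n = bas \<beta> (lookup p n)"
  unfolding laurent_fls_def
proof (rule nth_Abs_fls_finite)
  show "finite {n. bas \<beta> (lookup p n) \<noteq> 0}"
    by (rule finite_subset[OF _ finite_keys[of p]]) (auto simp: in_keys_iff tens_simps)
qed

lemma clinear_laurent_fls: "clinear (laurent_fls \<beta>)"
  by (rule clinearI) (simp_all add: fls_eq_iff lookup_add tens_simps)

section \<open>The action of B_L on Laurent polynomials of one component\<close>

context lattice_form
begin

definition sym_op :: "'l \<Rightarrow> 'l heis \<Rightarrow> 'l laurent \<Rightarrow> 'l laurent" where
  "sym_op \<beta> = (SOME g. cbilinear g \<and> (\<forall>x. g 1 x = x) \<and> (\<forall>s t x. g (s * t) x = g s (g t x)) \<and>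
    (\<forall>v x. g (sym_inc v) x = prim_op \<beta> v x))"

lemma sym_op:
  shows cbilinear_sym_op: "cbilinear (sym_op \<beta>)" and sym_op_one: "sym_op \<beta> 1 p = p"
    and sym_op_mult: "sym_op \<beta> (s * t) p = sym_op \<beta> s (sym_op \<beta> t p)"
    and sym_op_inc: "sym_op \<beta> (sym_inc v) p = prim_op \<beta> v p"
  using someI_ex[OF sym_action_ex[OF cbilinear_prim_op prim_op_commute], folded sym_op_def] by blast+

lemmas sym_op_simps = cbilinear_simps[OF cbilinear_sym_op] sym_op_one sym_op_mult sym_op_inc

lemma group_op_sym_op: "group_op \<gamma> \<beta> (sym_op \<beta> s p) = sym_op \<beta> s (group_op \<gamma> \<beta> p)"
  by (induction s arbitrary: p rule: heis_induct) (simp_all add: sym_op_simps group_op_simps group_op_prim_op)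

text \<open>\<open>BL_op \<beta>\<close> is the action of \<open>B\<^sub>L\<close> on the component of \<open>e\<^sub>\<beta>\<close>.\<close>

definition BL_op :: "'l \<Rightarrow> 'l lattice_alg \<Rightarrow> 'l laurent \<Rightarrow> 'l laurent" where
  "BL_op \<beta> h p = B_lift (\<lambda>\<gamma> s. group_op \<gamma> \<beta> (sym_op \<beta> s p)) h"

lemma BL_op_lift: "clinear (\<lambda>h. BL_op \<beta> h p)" "BL_op \<beta> (bas \<gamma> s) p = group_op \<gamma> \<beta> (sym_op \<beta> s p)"
proof -
  have lin: "clinear (\<lambda>s. group_op \<gamma> \<beta> (sym_op \<beta> s p))" for \<gamma>
    by (rule clinear_compose[OF clinear_group_op cbilinear_left[OF cbilinear_sym_op]])
  note B_lift[of "\<lambda>\<gamma> s. group_op \<gamma> \<beta> (sym_op \<beta> s p)", OF lin]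
  then show "clinear (\<lambda>h. BL_op \<beta> h p)" "BL_op \<beta> (bas \<gamma> s) p = group_op \<gamma> \<beta> (sym_op \<beta> s p)"
    by (simp_all add: BL_op_def)
qed

lemma cbilinear_BL_op: "cbilinear (BL_op \<beta>)"
proof (rule cbilinearI)
  fix h p q c
  show "BL_op \<beta> h (p + q) = BL_op \<beta> h p + BL_op \<beta> h q"
    by (induction h rule: lattice_alg_induct)
      (simp_all add: BL_op_lift clinear_simps[OF BL_op_lift(1)] sym_op_simps group_op_simps)
  show "BL_op \<beta> h (c *\<^sub>C p) = c *\<^sub>C BL_op \<beta> h p"
    by (induction h rule: lattice_alg_induct)
      (simp_all add: BL_op_lift clinear_simps[OF BL_op_lift(1)] sym_op_simps group_op_simps scaleC_simps)
qed (simp_all add: clinear_simps[OF BL_op_lift(1)])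

lemma BL_op_mult: "BL_op \<beta> (BL_mult a b) p = BL_op \<beta> a (BL_op \<beta> b p)"
proof (induction a rule: lattice_alg_induct)
  case (bas \<gamma> s)
  show ?case
    by (induction b rule: lattice_alg_induct)
      (simp_all add: BL_op_lift(2) cbilinear_simps[OF cbilinear_BL_op] BL.mul_simps BL_mult_bas
        sym_op_simps group_op_add group_op_sym_op group_op_simps)
qed (simp add: cbilinear_simps[OF cbilinear_BL_op] BL.mul_simps)

lemma BL_op_group: "BL_op \<beta> (bas \<gamma> 1) p = group_op \<gamma> \<beta> p"
  by (simp add: BL_op_lift(2) sym_op_simps)

lemma BL_op_prim: "BL_op \<beta> (bas 0 (sym_inc g)) p = prim_op \<beta> g p"
  by (simp add: BL_op_lift(2) sym_op_simps group_op_zero)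

lemma BL_op_one: "BL_op \<beta> B_one p = p"
  by (simp add: B_one_def BL_op_group group_op_zero)

lemmas BL_op_simps = cbilinear_simps[OF cbilinear_BL_op] BL_op_mult BL_op_group BL_op_prim BL_op_one

text \<open>x-linearity lets the value on a Laurent polynomial be computed from its coefficients, so
  that a composite can be compared with successive applications to vectors.\<close>

lemma BL_op_xpow: "BL_op \<beta> h (xpow n * p) = xpow n * BL_op \<beta> h p"
proof (induction h arbitrary: p rule: BL_gen_induct)
  case (group \<alpha>)
  show ?case by (simp add: BL_op_simps group_op_def vert_simps mult_ac)
next
  case (prim \<alpha> k)
  show ?case by (simp add: BL_op_simps prim_op_def lower_simps algebra_simps)
qed (simp_all add: BL_op_simps distrib_left scaleC_mult)

lemma ddx_BL_op: "ddx (BL_op \<beta> h p) = BL_op \<beta> h (ddx p) + BL_op \<beta> (B_trans h) p"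
proof (induction h arbitrary: p rule: BL_gen_induct)
  case (group \<alpha>)
  show ?case by (simp add: BL_op_simps B_trans_group ddx_group_op)
next
  case (prim \<alpha> k)
  show ?case by (simp add: BL_op_simps B_trans_prim ddx_prim_op del: of_nat_Suc)
next
  case (mult s t)
  then show ?case by (simp add: BL_op_simps BL.D_mul)
qed (simp_all add: BL_op_simps clinear_simps[OF clinear_ddx] clinear_simps[OF BL.lin] scaleC_add_right)

lemma conn_BL_op: "conn \<beta> (BL_op \<beta> h p) = BL_op \<beta> h (conn \<beta> p)"
  by (induction h arbitrary: p rule: BL_gen_induct)
    (simp_all add: BL_op_simps clinear_simps[OF clinear_conn] conn_group_op conn_prim_op)

lemma BL_op_vac: "BL_op 0 h 1 = BL_counit h *\<^sub>C 1"
  by (induction h rule: BL_gen_induct)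
    (simp_all add: BL_op_simps clinear_simps[OF clinear_BL_counit] BL_counit_simps scaleC_simps
      scaleC_add_left scaleC_complex_def group_op_one prim_op_one mult.commute)

text \<open>The induction keeps \<open>p\<close> and \<open>q\<close> arbitrary: in the product case
  the second factor has already acted on them when the hypothesis for the first one is used.\<close>

lemma BL_op_comult:
  "BL_op (\<beta> + \<beta>') h (p * q) = tensor_lift (\<lambda>a b. BL_op \<beta> a p * BL_op \<beta>' b q) (BL_comult h)"
proof -
  have bil: "cbilinear (\<lambda>a b. BL_op \<beta> a p * BL_op \<beta>' b q)" for p q
    by (rule cbilinearI) (simp_all add: BL_op_simps algebra_simps scaleC_mult)
  let ?S = "\<lambda>p q. tensor_lift (\<lambda>a b. BL_op \<beta> a p * BL_op \<beta>' b q)"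
  note S = tensor_lift_tens[OF bil] clinear_simps[OF clinear_tensor_lift[OF bil]]
  \<comment> \<open>Multiplying the coproduct on the right by a simple tensor means letting its two
    factors act first, one on each argument.\<close>
  have shift: "?S p q (BL2_mult s (c \<otimes>\<^sub>C d)) = ?S (BL_op \<beta> c p) (BL_op \<beta>' d q) s" for s c d p q
    by (induction s rule: tensor_induct) (simp_all only: S BL2.mul_simps BL2_mult_tens BL_op_mult)
  show ?thesis
  proof (induction h arbitrary: p q rule: BL_gen_induct)
    case (group \<alpha>)
    show ?case by (simp add: BL_comult_simps S BL_op_simps group_op_mult)
  next
    case (prim \<alpha> k)
    show ?case by (simp add: BL_comult_simps S BL_op_simps prim_op_mult)
  next
    case (mult a b)
    have "BL_op (\<beta> + \<beta>') a (?S p q t) = ?S p q (BL2_mult (BL_comult a) t)" for t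
      by (induction t rule: tensor_induct)
        (simp_all only: S BL_op_simps mult(1) shift BL2.mul_simps)
    then show ?case by (simp add: BL_op_simps mult(2) BL_comult_simps)
  qed (simp_all only: clinear_simps[OF clinear_BL_comult] S BL_op_simps)
qed

section \<open>The module map and its weak associativity\<close>

definition BL_Y :: "'l lattice_alg \<Rightarrow> 'l lattice_alg \<Rightarrow> 'l lattice_alg fls" where
  "BL_Y h = B_lift (\<lambda>\<beta> u. laurent_fls \<beta> (BL_op \<beta> h (lconst u)))"

lemma BL_Y_lift: "clinear (BL_Y h)" "BL_Y h (bas \<beta> u) = laurent_fls \<beta> (BL_op \<beta> h (lconst u))"
proof -
  have lin: "clinear (\<lambda>u. laurent_fls \<beta> (BL_op \<beta> h (lconst u)))" for \<beta>
    by (rule clinear_compose[OF clinear_laurent_fls clinear_compose[OF cbilinear_right[OF cbilinear_BL_op] clinear_single]])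
  note B_lift[of "\<lambda>\<beta> u. laurent_fls \<beta> (BL_op \<beta> h (lconst u))", OF lin]
  then show "clinear (BL_Y h)" "BL_Y h (bas \<beta> u) = laurent_fls \<beta> (BL_op \<beta> h (lconst u))"
    by (simp_all add: BL_Y_def)
qed

lemma cbilinear_BL_Y: "cbilinear BL_Y"
proof (rule cbilinearI)
  fix a a' b c
  show "BL_Y (a + a') b = BL_Y a b + BL_Y a' b"
    by (induction b rule: lattice_alg_induct)
      (simp_all add: BL_Y_lift clinear_simps[OF BL_Y_lift(1)] BL_op_simps clinear_simps[OF clinear_laurent_fls])
  show "BL_Y (c *\<^sub>C a) b = c *\<^sub>C BL_Y a b"
    by (induction b rule: lattice_alg_induct)
      (simp_all add: BL_Y_lift clinear_simps[OF BL_Y_lift(1)] BL_op_simps clinear_simps[OF clinear_laurent_fls]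
        scaleC_simps)
qed (simp_all add: clinear_simps[OF BL_Y_lift(1)])

lemmas BL_Y_simps = cbilinear_simps[OF cbilinear_BL_Y] BL_Y_lift(2)

lemma BL_Y_one: "BL_Y B_one w = fls_const w"
proof (induction w rule: lattice_alg_induct)
  case (bas \<beta> u)
  show ?case by (auto simp: BL_Y_simps BL_op_simps fls_eq_iff lookup_single when_def tens_simps)
qed (simp add: BL_Y_simps fls_plus_const)

lemma iterate_shifted_BL_Y_add:
  "iterate_shifted BL_Y u v (w + w') a b = iterate_shifted BL_Y u v w a b + iterate_shifted BL_Y u v w' a b"
proof -
  have fin: "finite {k :: nat. (of_int (a + int k) gchoose k) *\<^sub>C (BL_Y u (BL_Y v w $$ (b - int k)) $$ (a + int k)) \<noteq> 0}"
    for w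
    by (rule finite_subset[OF _ finite_fls_neg[of "BL_Y v w" b]]) (auto simp: BL_Y_simps scaleC_simps)
  show ?thesis
    unfolding iterate_shifted_def
    by (subst Sum_any.distrib[OF fin fin, symmetric]) (simp add: BL_Y_simps scaleC_add_right)
qed

text \<open>Here j is the power of x_2 coming from \<open>v\<close>. The total degree is a+b, so
  \<open>u\<close> contributes (x_0+x_2)^(a+b-j), expanded in nonnegative powers of x_2, and the
  coefficient of x_2^(b-j) is wanted.\<close>

lemma iterate_shifted_BL_Y_bas:
  defines "P \<equiv> \<lambda>v \<beta> e. BL_op \<beta> v (lconst e)"
  defines "W \<equiv> \<lambda>u v \<beta> e j. lookup (P u \<beta> (lookup (P v \<beta> e) j))"
  shows "iterate_shifted BL_Y u v (bas \<beta> e) a b =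
    (\<Sum>j\<in>keys (P v \<beta> e). ibinom (a + b - j) (b - j) *\<^sub>C bas \<beta> (W u v \<beta> e j (a + b - j)))"
proof -
  let ?K = "keys (P v \<beta> e)"
  let ?f = "\<lambda>k::nat. (of_int (a + int k) gchoose k) *\<^sub>C bas \<beta> (W u v \<beta> e (b - int k) (a + int k))"
  let ?g = "\<lambda>j. ibinom (a + b - j) (b - j) *\<^sub>C bas \<beta> (W u v \<beta> e j (a + b - j))"
  have W0: "W u v \<beta> e j i = 0" if "j \<notin> ?K" for i j
    using that by (simp add: W_def P_def in_keys_iff BL_op_simps)
  let ?J = "{j \<in> ?K. j \<le> b}"
  have "iterate_shifted BL_Y u v (bas \<beta> e) a b = Sum_any ?f"
    by (simp add: iterate_shifted_def BL_Y_simps W_def P_def)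
  also have "\<dots> = sum ?f ((\<lambda>j. nat (b - j)) ` ?J)"
  proof (rule Sum_any_finite)
    fix k assume k: "k \<notin> (\<lambda>j. nat (b - j)) ` ?J"
    have "b - int k \<notin> ?K"
    proof
      assume "b - int k \<in> ?K"
      then have "nat (b - (b - int k)) \<in> (\<lambda>j. nat (b - j)) ` ?J" by (intro imageI) simp
      then show False using k by simp
    qed
    then show "?f k = 0" by (simp add: W0 tens_simps scaleC_simps)
  qed simp
  also have "\<dots> = sum ?g ?J"
    by (rule sum.reindex_cong[of "\<lambda>j. nat (b - j)"]) (auto intro!: inj_onI simp: ibinom_def add_diff_eq)
  also have "\<dots> = sum ?g ?K"
    by (rule sum.mono_neutral_left) (auto simp: ibinom_def scaleC_simps)
  finally show ?thesis .
qed

text \<open>Taylor's formula gives the same powers of x_0+x_2 with the same coefficients, now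
  expanded in nonnegative powers of x_0. Only the lower index of the binomial coefficient
  differs.\<close>

lemma iterate_nested_BL_Y_bas:
  defines "P \<equiv> \<lambda>v \<beta> e. BL_op \<beta> v (lconst e)"
  defines "W \<equiv> \<lambda>u v \<beta> e j. lookup (P u \<beta> (lookup (P v \<beta> e) j))"
  shows "iterate_nested (B_Y trivial_cocycle) BL_Y u v (bas \<beta> e) a b =
    (\<Sum>j\<in>keys (P v \<beta> e). ibinom (a + b - j) a *\<^sub>C bas \<beta> (W u v \<beta> e j (a + b - j)))"
proof (cases "a < 0")
  case True
  then show ?thesis
    by (simp add: iterate_nested_def B_Y_def BL.Y_neg cbilinear_simps[OF cbilinear_BL_Y] ibinom_def scaleC_simps)
next
  case False
  then obtain n where a: "a = int n" by (metis nat_0_le not_less)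
  have P: "BL_op \<beta> v (lconst e) = P v \<beta> e" for v e by (simp add: P_def)
  \<comment> \<open>On a constant d/dx vanishes, so the commutator relation \<open>ddx_BL_op\<close>
    turns divided powers of L(-1) on \<open>u\<close> into divided derivatives of the
    result.\<close>
  have D: "BL_op \<beta> (dpow B_trans n u) (lconst x) = dpow ddx n (P u \<beta> x)" for x
    unfolding P_def
    by (rule dpow_commute[OF BL_op_lift(1)]) (simp add: ddx_BL_op ddx_lconst BL_op_simps)
  have "BL_op \<beta> (dpow B_trans n u) (P v \<beta> e) =
      (\<Sum>j\<in>keys (P v \<beta> e). xpow j * dpow ddx n (P u \<beta> (lookup (P v \<beta> e) j)))"
    by (subst laurent_sum[of "P v \<beta> e"]) (simp add: BL_op_simps(5) BL_op_xpow D)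
  then show ?thesis
    by (simp add: iterate_nested_def B_Y_def a BL.Y_nat BL_Y_simps BL_op_mult lookup_sum lookup_xpow_mult
        lookup_dpow_ddx tens_simps ibinom_def W_def P) (simp add: algebra_simps)
qed

text \<open>For a single component the power l is read off from the finitely many exponents that
  occur; for a sum of vectors the larger of two powers works for both.\<close>

lemma BL_Y_weak_assoc:
  "\<exists>l. mult_sum_power l (iterate_shifted BL_Y u v w) =
       mult_sum_power l (iterate_nested (B_Y trivial_cocycle) BL_Y u v w)"
proof (induction w rule: lattice_alg_induct)
  case (add w w')
  then obtain l l' where
    "mult_sum_power l (iterate_shifted BL_Y u v w) = mult_sum_power l (iterate_nested (B_Y trivial_cocycle) BL_Y u v w)"
    "mult_sum_power l' (iterate_shifted BL_Y u v w') = mult_sum_power l' (iterate_nested (B_Y trivial_cocycle) BL_Y u v w')"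
    by blast
  note eq = mult_sum_power_mono[OF this(1), of "max l l'"] mult_sum_power_mono[OF this(2), of "max l l'"]
  have "mult_sum_power (max l l') (iterate_shifted BL_Y u v (w + w')) a b =
    mult_sum_power (max l l') (iterate_nested (B_Y trivial_cocycle) BL_Y u v (w + w')) a b" for a b
  proof -
    have "iterate_shifted BL_Y u v (w + w') = (\<lambda>a b. iterate_shifted BL_Y u v w a b + iterate_shifted BL_Y u v w' a b)"
      by (intro ext) (rule iterate_shifted_BL_Y_add)
    moreover have "iterate_nested (B_Y trivial_cocycle) BL_Y u v (w + w') =
      (\<lambda>a b. iterate_nested (B_Y trivial_cocycle) BL_Y u v w a b + iterate_nested (B_Y trivial_cocycle) BL_Y u v w' a b)"
      by (intro ext) (simp add: iterate_nested_def BL_Y_simps)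
    ultimately show ?thesis
      by (simp add: mult_sum_power_add eq)
  qed
  then show ?case by blast
next
  case (bas \<beta> e)
  define P where "P v e = BL_op \<beta> v (lconst e)" for v e
  define W where "W j = lookup (P u (lookup (P v e) j))" for j
  let ?K = "keys (P v e)"
  define A where "A = (\<Union>j\<in>?K. keys (P u (lookup (P v e) j)))"
  \<comment> \<open>Including 0 keeps the minimum defined for empty \<open>A\<close> and makes
    \<open>L\<close> at most 0, so that \<open>l\<close> is exactly its negative.\<close>
  define L where "L = Min (insert 0 A)"
  have L: "L \<le> i" if "i \<in> A" for i
    unfolding L_def by (rule Min_le) (use that in \<open>auto simp: A_def\<close>)
  define l where "l = nat (- L)"
  have Wl: "W j i = 0" if "j \<in> ?K" "i + int l < 0" for i j
  proof (rule ccontr)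
    assume "W j i \<noteq> 0"
    then have "i \<in> keys (P u (lookup (P v e) j))"
      by (simp add: W_def in_keys_iff)
    then have "L \<le> i" using that(1) by (intro L) (auto simp: A_def)
    then show False using that(2) by (simp add: l_def split: if_splits)
  qed
  have "mult_sum_power l (iterate_shifted BL_Y u v (bas \<beta> e)) a b =
    mult_sum_power l (iterate_nested (B_Y trivial_cocycle) BL_Y u v (bas \<beta> e)) a b" for a b
  proof -
    let ?i = "\<lambda>j. a + b - int l - j"
    have il: "?i j + int l = a + b - j" for j by simp
    have e: "a - int (l - t) + (b - int t) - j = ?i j" if "t \<le> l" for t j
      using that by (simp add: of_nat_diff)
    have "mult_sum_power l (iterate_shifted BL_Y u v (bas \<beta> e)) a b =
      (\<Sum>t\<le>l. of_nat (l choose t) *\<^sub>C (\<Sum>j\<in>?K. ibinom (?i j) (b - j - int t) *\<^sub>C bas \<beta> (W j (?i j))))"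
      unfolding mult_sum_power_def iterate_shifted_BL_Y_bas P_def[symmetric] W_def[symmetric]
    proof (rule sum.cong[OF refl], rule arg_cong[where f = "scaleC _"], rule sum.cong[OF refl])
      fix t j assume "t \<in> {..l}"
      then have "a - int (l - t) + (b - int t) - j = ?i j" "b - int t - j = b - j - int t"
        using e by simp_all
      then show "ibinom (a - int (l - t) + (b - int t) - j) (b - int t - j) *\<^sub>C
          bas \<beta> (W j (a - int (l - t) + (b - int t) - j)) = ibinom (?i j) (b - j - int t) *\<^sub>C bas \<beta> (W j (?i j))"
        by (simp only:)
    qed
    also have "\<dots> = (\<Sum>j\<in>?K. (\<Sum>t\<le>l. of_nat (l choose t) *\<^sub>C ibinom (?i j) (b - j - int t)) *\<^sub>C bas \<beta> (W j (?i j)))"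
      unfolding complex_vector.scale_sum_right complex_vector.scale_sum_left
      by (subst sum.swap) (simp add: scaleC_scaleC scaleC_complex_def)
    also have "\<dots> = (\<Sum>j\<in>?K. ibinom (a + b - j) (b - j) *\<^sub>C bas \<beta> (W j (?i j)))"
      by (simp only: ibinom_vandermonde il)
    \<comment> \<open>After multiplication the exponent is a+b-j. If it is nonnegative the two
      expansions agree; if it is negative, \<open>Wl\<close> says that the coefficient is
      zero.\<close>
    also have "\<dots> = (\<Sum>j\<in>?K. ibinom (a + b - j) a *\<^sub>C bas \<beta> (W j (?i j)))"
    proof (rule sum.cong[OF refl])
      fix j assume j: "j \<in> ?K"
      show "ibinom (a + b - j) (b - j) *\<^sub>C bas \<beta> (W j (?i j)) = ibinom (a + b - j) a *\<^sub>C bas \<beta> (W j (?i j))"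
      proof (cases "a + b - j \<ge> 0")
        case True
        then show ?thesis using ibinom_symmetric[of "a + b - j" a] by (simp add: algebra_simps)
      next
        case False
        then show ?thesis using Wl[OF j, of "?i j"] by (simp add: tens_simps scaleC_simps)
      qed
    qed
    also have "\<dots> = (\<Sum>j\<in>?K. (\<Sum>t\<le>l. of_nat (l choose t) *\<^sub>C ibinom (?i j) (a - int t)) *\<^sub>C bas \<beta> (W j (?i j)))"
      by (simp only: ibinom_vandermonde il)
    also have "\<dots> = (\<Sum>j\<in>?K. (\<Sum>t\<le>l. of_nat (l choose t) *\<^sub>C ibinom (?i j) (a - int (l - t))) *\<^sub>C bas \<beta> (W j (?i j)))"
    proof -
      have "(\<Sum>t\<le>l. of_nat (l choose t) *\<^sub>C ibinom (?i j) (a - int t)) =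
        (\<Sum>t\<le>l. of_nat (l choose t) *\<^sub>C ibinom (?i j) (a - int (l - t)))" for j
        by (rule sum.reindex_bij_witness[of _ "\<lambda>t. l - t" "\<lambda>t. l - t"])
          (auto simp: binomial_symmetric[symmetric])
      then show ?thesis by (simp only:)
    qed
    also have "\<dots> = (\<Sum>t\<le>l. of_nat (l choose t) *\<^sub>C (\<Sum>j\<in>?K. ibinom (?i j) (a - int (l - t)) *\<^sub>C bas \<beta> (W j (?i j))))"
      unfolding complex_vector.scale_sum_right complex_vector.scale_sum_left
      by (subst sum.swap) (simp add: scaleC_scaleC scaleC_complex_def)
    also have "\<dots> = mult_sum_power l (iterate_nested (B_Y trivial_cocycle) BL_Y u v (bas \<beta> e)) a b"
      unfolding mult_sum_power_def iterate_nested_BL_Y_bas P_def[symmetric] W_def[symmetric]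
    proof (rule sum.cong[OF refl], rule arg_cong[where f = "scaleC _"], rule sum.cong[OF refl])
      fix t j assume "t \<in> {..l}"
      then have "a - int (l - t) + (b - int t) - j = ?i j" using e by simp
      then show "ibinom (?i j) (a - int (l - t)) *\<^sub>C bas \<beta> (W j (?i j)) =
          ibinom (a - int (l - t) + (b - int t) - j) (a - int (l - t)) *\<^sub>C
          bas \<beta> (W j (a - int (l - t) + (b - int t) - j))"
        by (simp only:)
    qed
    finally show ?thesis .
  qed
  then show ?case by blast
qed

lemma BL_Y_module: "nonlocal_va_module (B_Y trivial_cocycle) B_one BL_Y"
proof -
  interpret nonlocal_vertex_algebra "B_Y trivial_cocycle" "B_one :: 'l lattice_alg"
    unfolding B_Y_def by (rule BL.nonlocal_vertex_algebra)
  show ?thesis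
    by unfold_locales (rule cbilinear_BL_Y BL_Y_one BL_Y_weak_assoc)+
qed

end

section \<open>The operators \<open>E\<^sup>+(-\<alpha>,x)x\<^sup>\<alpha>\<^sup>(\<^sup>0\<^sup>)\<close>\<close>

definition fls_finite :: "'a::zero fls \<Rightarrow> bool" where
  "fls_finite F \<longleftrightarrow> finite {n. F $$ n \<noteq> 0}"

lemma fls_finite_add: "fls_finite F \<Longrightarrow> fls_finite G \<Longrightarrow> fls_finite (F + G :: 'a::comm_monoid_add fls)"
  unfolding fls_finite_def
  by (rule rev_finite_subset[of "{n. F $$ n \<noteq> 0} \<union> {n. G $$ n \<noteq> 0}"]) auto

lemma fls_finite_laurent_fls: "fls_finite (laurent_fls \<beta> p)"
  unfolding fls_finite_def
  by (rule finite_subset[OF _ finite_keys[of p]]) (auto simp: in_keys_iff tens_simps)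

text \<open>On such operator series the infinite sum and \<open>Abs_fls\<close> in
  \<open>op_comp\<close> behave as intended: additivity removes the terms with zero coefficient and
  finiteness bounds the support. The class is closed under \<open>op_comp\<close>.\<close>

definition finite_additive :: "('v::ab_group_add \<Rightarrow> 'w::ab_group_add fls) \<Rightarrow> bool" where
  "finite_additive A \<longleftrightarrow> (\<forall>v w. A (v + w) = A v + A w) \<and> (\<forall>v. fls_finite (A v))"

lemma finite_support_shift:
  assumes "finite_additive A"
  shows "finite {n. A v $$ (n - i) \<noteq> 0}"
proof -
  have "finite {n. A v $$ n \<noteq> 0}" using assms by (simp add: finite_additive_def fls_finite_def)
  then have "finite ((\<lambda>n. n - i) -` {n. A v $$ n \<noteq> 0})"
    by (rule finite_vimageI) (auto intro: injI)
  then show ?thesis by (simp add: vimage_def)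
qed

lemma op_comp_nth:
  assumes A: "finite_additive A" and B: "fls_finite (B w)"
    and S: "finite S" "\<And>i. B w $$ i \<noteq> 0 \<Longrightarrow> i \<in> S"
  shows "op_comp A B w $$ n = (\<Sum>i\<in>S. A (B w $$ i) $$ (n - i))"
proof -
  have A0: "A 0 = 0" using A by (metis add_cancel_right_right finite_additive_def)
  have sum: "Sum_any (\<lambda>i. A (B w $$ i) $$ (n - i)) = (\<Sum>i\<in>S. A (B w $$ i) $$ (n - i))" for n
  proof (rule Sum_any_finite[OF S(1)])
    fix i assume "i \<notin> S"
    then have "B w $$ i = 0" using S(2) by blast
    then show "A (B w $$ i) $$ (n - i) = 0" by (simp add: A0)
  qed
  have "finite (\<Union>i\<in>S. {n. A (B w $$ i) $$ (n - i) \<noteq> 0})"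
    using S(1) finite_support_shift[OF A] by blast
  then have "finite {n. (\<Sum>i\<in>S. A (B w $$ i) $$ (n - i)) \<noteq> 0}"
    by (rule rev_finite_subset) (auto dest: sum.not_neutral_contains_not_neutral)
  then show ?thesis
    unfolding op_comp_def sum by (rule nth_Abs_fls_finite)
qed

lemma finite_additive_op_comp:
  assumes A: "finite_additive A" and B: "finite_additive B"
  shows "finite_additive (op_comp A B)"
  unfolding finite_additive_def
proof (intro conjI allI)
  have Bfin: "fls_finite (B w)" for w using B by (simp add: finite_additive_def)
  have Aadd: "A (x + y) = A x + A y" for x y using A by (simp add: finite_additive_def)
  have Badd: "B (x + y) = B x + B y" for x y using B by (simp add: finite_additive_def)
  fix v w
  let ?S = "{i. B v $$ i \<noteq> 0} \<union> {i. B w $$ i \<noteq> 0}"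
  have S: "finite ?S" using Bfin by (simp add: fls_finite_def)
  have nth: "op_comp A B x $$ n = (\<Sum>i\<in>?S. A (B x $$ i) $$ (n - i))" if "x = v \<or> x = w \<or> x = v + w" for x n
    by (rule op_comp_nth[OF A Bfin S]) (use that in \<open>auto simp: Badd\<close>)
  show "op_comp A B (v + w) = op_comp A B v + op_comp A B w"
    by (rule fls_eqI) (simp add: nth Badd Aadd sum.distrib)
  let ?S' = "{i. B v $$ i \<noteq> 0}"
  have S': "finite ?S'" using Bfin by (simp add: fls_finite_def)
  have "finite (\<Union>i\<in>?S'. {n. A (B v $$ i) $$ (n - i) \<noteq> 0})"
    using S' finite_support_shift[OF A] by blast
  then show "fls_finite (op_comp A B v)"
    unfolding fls_finite_def
    by (rule rev_finite_subset)
      (auto simp: op_comp_nth[OF A Bfin S'] dest: sum.not_neutral_contains_not_neutral)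
qed

text \<open>An operator series that maps each component to itself is an x-linear operator on Laurent
  polynomials, and \<open>op_comp\<close> becomes ordinary composition there.\<close>

lemma op_comp_laurent_fls:
  assumes A: "finite_additive A" and Aw: "\<And>u. A (bas \<beta> u) = laurent_fls \<beta> (a (lconst u))"
    and a: "clinear a" "\<And>n p. a (xpow n * p) = xpow n * a p"
    and B: "B w = laurent_fls \<beta> q"
  shows "op_comp A B w = laurent_fls \<beta> (a q)"
proof (rule fls_eqI)
  fix n
  have "op_comp A B w $$ n = (\<Sum>i\<in>keys q. A (B w $$ i) $$ (n - i))"
    by (rule op_comp_nth[OF A]) (auto simp: B fls_finite_laurent_fls in_keys_iff tens_simps)
  also have "\<dots> = bas \<beta> (lookup (\<Sum>i\<in>keys q. xpow i * a (lconst (lookup q i))) n)"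
    by (simp add: B Aw lookup_sum lookup_xpow_mult tens_simps)
  also have "(\<Sum>i\<in>keys q. xpow i * a (lconst (lookup q i))) = a q"
    by (subst (3) laurent_sum[of q]) (simp add: clinear_sum[OF a(1)] a(2))
  finally show "op_comp A B w $$ n = laurent_fls \<beta> (a q) $$ n" by simp
qed

context lattice_form
begin

text \<open>The exponent of \<open>E\<^sup>+(-\<gamma>,x)\<close> as a derivation of Laurent polynomials over \<open>B\<^sub>\<h>\<close>.\<close>

definition annih :: "'l \<Rightarrow> 'l laurent \<Rightarrow> 'l laurent" where
  "annih \<gamma> = (SOME D. derivation D \<and> (\<forall>n. D (xpow n) = 0) \<and>
    (\<forall>v. D (lconst (sym_inc v)) = hm_lift (\<lambda>j h. (- cform (cplx_inc \<gamma>) h) *\<^sub>C xpow (- int j - 1)) v))"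

lemma annih:
  shows derivation_annih: "derivation (annih \<gamma>)"
    and annih_xpow: "annih \<gamma> (xpow n) = 0"
    and annih_gen: "annih \<gamma> (gen \<beta> j) = (- of_int (form \<gamma> \<beta>)) *\<^sub>C xpow (- int j - 1)"
proof -
  have c: "clinear (\<lambda>h. (- cform (cplx_inc \<gamma>) h) *\<^sub>C (xpow (- int j - 1) :: 'l laurent))" for j
    by (rule clinearI) (simp_all add: cform_simps scaleC_add_left scaleC_simps scaleC_complex_def)
  note hm = hm_lift[of "\<lambda>j h. (- cform (cplx_inc \<gamma>) h) *\<^sub>C (xpow (- int j - 1) :: 'l laurent)", OF c]
  from someI_ex[OF laurent_derivation_ex[OF hm(1)], folded annih_def]
  have *: "derivation (annih \<gamma>)" "\<And>n. annih \<gamma> (xpow n) = 0"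
    "\<And>v. annih \<gamma> (lconst (sym_inc v)) = hm_lift (\<lambda>j h. (- cform (cplx_inc \<gamma>) h) *\<^sub>C xpow (- int j - 1)) v"
    by blast+
  show "derivation (annih \<gamma>)" "annih \<gamma> (xpow n) = 0" by (fact *)+
  show "annih \<gamma> (gen \<beta> j) = (- of_int (form \<gamma> \<beta>)) *\<^sub>C xpow (- int j - 1)"
    by (simp only: *(3) osc_def hm(2) cform(2))
qed

lemmas annih_simps = derivation_simps[OF derivation_annih] annih_xpow annih_gen

lemma clinear_annih: "clinear (annih \<gamma>)"
  by (rule derivation_clinear[OF derivation_annih])

lemma annih_xpow_mult: "annih \<gamma> (xpow n * p) = xpow n * annih \<gamma> p"
  by (simp add: annih_simps)

text \<open>A generator goes to a scalar multiple of a power of x, which is killed next, so only two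
  terms of the Leibniz rule survive.\<close>

lemma dpow_annih_gen_mult:
  "dpow (annih \<gamma>) (Suc k) (gen \<beta> j * p) =
    gen \<beta> j * dpow (annih \<gamma>) (Suc k) p + annih \<gamma> (gen \<beta> j) * dpow (annih \<gamma>) k p"
proof -
  have z: "dpow (annih \<gamma>) (Suc (Suc i)) (gen \<beta> j) = 0" for i
  proof -
    have "(annih \<gamma> ^^ Suc (Suc i)) (gen \<beta> j) = 0"
      by (induction i) (simp_all add: annih_simps scaleC_simps)
    then show ?thesis by (simp add: dpow_def scaleC_simps)
  qed
  have "dpow (annih \<gamma>) (Suc k) (gen \<beta> j * p) =
      (\<Sum>i\<le>Suc k. dpow (annih \<gamma>) i (gen \<beta> j) * dpow (annih \<gamma>) (Suc k - i) p)"
    by (rule dpow_leibniz[OF cbilinear_times clinear_annih clinear_annih clinear_annih])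
      (rule derivation_mult[OF derivation_annih])
  also have "\<dots> = (\<Sum>i\<in>{0, Suc 0}. dpow (annih \<gamma>) i (gen \<beta> j) * dpow (annih \<gamma>) (Suc k - i) p)"
  proof (rule sum.mono_neutral_right)
    show "\<forall>i\<in>{..Suc k} - {0, Suc 0}. dpow (annih \<gamma>) i (gen \<beta> j) * dpow (annih \<gamma>) (Suc k - i) p = 0"
    proof
      fix i assume "i \<in> {..Suc k} - {0, Suc 0}"
      then obtain i' where "i = Suc (Suc i')" by (cases i; cases "i - 1") auto
      then show "dpow (annih \<gamma>) i (gen \<beta> j) * dpow (annih \<gamma>) (Suc k - i) p = 0" by (simp add: z)
    qed
  qed auto
  also have "\<dots> = gen \<beta> j * dpow (annih \<gamma>) (Suc k) p + dpow (annih \<gamma>) (Suc 0) (gen \<beta> j) * dpow (annih \<gamma>) k p"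
    by simp
  finally show ?thesis by (simp add: dpow_def[of _ "Suc 0"] scaleC_one)
qed

text \<open>The exponential of a locally nilpotent derivation is a homomorphism, hence determined on
  generators. Equality with all long partial sums is asserted, because differences of consecutive
  ones then show that the later terms vanish.\<close>

lemma vert_eq_exp: "\<exists>N. \<forall>M\<ge>N. vert \<gamma> p = (\<Sum>k<M. dpow (annih \<gamma>) k p)"
proof (induction p rule: laurent_induct)
  case (add p q)
  then obtain N N' where N: "\<And>M. N \<le> M \<Longrightarrow> vert \<gamma> p = (\<Sum>k<M. dpow (annih \<gamma>) k p)"
    and N': "\<And>M. N' \<le> M \<Longrightarrow> vert \<gamma> q = (\<Sum>k<M. dpow (annih \<gamma>) k q)" by blast
  have "vert \<gamma> (p + q) = (\<Sum>k<M. dpow (annih \<gamma>) k (p + q))" if "max N N' \<le> M" for M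
    using N[of M] N'[of M] that
    by (simp add: vert_simps clinear_simps[OF clinear_dpow[OF clinear_annih]] sum.distrib)
  then show ?case by blast
next
  case (scale c p)
  then obtain N where N: "\<And>M. N \<le> M \<Longrightarrow> vert \<gamma> p = (\<Sum>k<M. dpow (annih \<gamma>) k p)" by blast
  have "vert \<gamma> (c *\<^sub>C p) = (\<Sum>k<M. dpow (annih \<gamma>) k (c *\<^sub>C p))" if "N \<le> M" for M
    using N[of M] that
    by (simp add: vert_simps clinear_simps[OF clinear_dpow[OF clinear_annih]] complex_vector.scale_sum_right)
  then show ?case by blast
next
  case (xpow n)
  have z: "dpow (annih \<gamma>) (Suc i) (xpow n) = 0" for i
  proof -
    have "(annih \<gamma> ^^ Suc i) (xpow n) = 0"
      by (induction i) (simp_all add: annih_simps)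
    then show ?thesis by (simp add: dpow_def scaleC_simps)
  qed
  have "vert \<gamma> (xpow n) = (\<Sum>k<M. dpow (annih \<gamma>) k (xpow n))" if "1 \<le> M" for M
  proof -
    obtain M' where "M = Suc M'" using \<open>1 \<le> M\<close> by (cases M) auto
    then show ?thesis by (simp only: sum.lessThan_Suc_shift z vert_xpow) simp
  qed
  then show ?case by blast
next
  case (mult \<beta> j p)
  then obtain N where N: "\<And>M. N \<le> M \<Longrightarrow> vert \<gamma> p = (\<Sum>k<M. dpow (annih \<gamma>) k p)" by blast
  \<comment> \<open>The generator multiplies a partial sum of length M and its derivative one
    shorter by one, so the bound for \<open>p\<close> has to grow by one.\<close>
  have "vert \<gamma> (gen \<beta> j * p) = (\<Sum>k<M'. dpow (annih \<gamma>) k (gen \<beta> j * p))" if "Suc N \<le> M'" for M'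
  proof -
    obtain M where M: "M' = Suc M" "N \<le> M" using \<open>Suc N \<le> M'\<close> by (cases M') auto
    have "(\<Sum>k<Suc M. dpow (annih \<gamma>) k (gen \<beta> j * p)) =
      gen \<beta> j * (\<Sum>k<Suc M. dpow (annih \<gamma>) k p) + annih \<gamma> (gen \<beta> j) * (\<Sum>k<M. dpow (annih \<gamma>) k p)"
      by (simp only: sum.lessThan_Suc_shift dpow_annih_gen_mult)
        (simp add: sum.distrib sum_distrib_left algebra_simps del: sum.lessThan_Suc)
    also have "\<dots> = gen \<beta> j * vert \<gamma> p + annih \<gamma> (gen \<beta> j) * vert \<gamma> p"
      using N[of M] N[of "Suc M"] M(2) by simp
    also have "\<dots> = vert \<gamma> (gen \<beta> j * p)"
      by (simp add: vert_simps annih_simps algebra_simps scaleC_simps)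
    finally show ?thesis by (simp only: M(1))
  qed
  then show ?case by blast
qed

lemma heis_mode_nat:
  assumes "n \<ge> 1"
  shows derivation_heis_mode: "derivation (heis_mode form h (int n))"
    and heis_mode_osc: "heis_mode form h (int n) (sym_inc (osc \<beta> j)) =
      (if n = Suc j then (of_nat n * cform h (cplx_inc \<beta>)) *\<^sub>C 1 else 0)"
proof -
  have "clinear (\<lambda>b. if int n = int m then (of_int (int n) * cform h b) *\<^sub>C 1 else (0 :: 'l heis))" for m
    by (rule clinearI) (auto simp: cform_simps scaleC_add_left scaleC_simps scaleC_complex_def algebra_simps)
  note * = heis_derivation[of "\<lambda>m b. if int n = int m then (of_int (int n) * cform h b) *\<^sub>C 1 else 0", OF this]
  have eq: "heis_mode form h (int n) = (THE D. sym_derivation D \<and> (\<forall>b. \<forall>m\<ge>1. D (hneg b m) =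
      (if int n = int m then (of_int (int n) * cform h b) *\<^sub>C 1 else 0)))"
    by (simp add: heis_mode_def)
  show "derivation (heis_mode form h (int n))" unfolding eq by (rule *(1))
  show "heis_mode form h (int n) (sym_inc (osc \<beta> j)) =
      (if n = Suc j then (of_nat n * cform h (cplx_inc \<beta>)) *\<^sub>C 1 else 0)"
    unfolding eq *(2) by simp
qed

text \<open>Each coefficient of a derivation on constants obeys the Leibniz rule, so generators
  suffice. There the factor n in \<gamma>(n)b(-n) cancels the denominator of the exponent.\<close>

lemma annih_eq_modes:
  "lookup (annih \<gamma> (lconst u)) k =
    (if k < 0 then (- 1 / of_int (- k)) *\<^sub>C heis_mode form (cplx_inc \<gamma>) (- k) u else 0)"
proof (cases "k < 0")
  case True
  then obtain n where n: "k = - int n" "n \<ge> 1" by (metis add.inverse_inverse neg_0_less_iff_less zero_less_imp_eq_int less_eq_Suc_le One_nat_def)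
  let ?D = "heis_mode form (cplx_inc \<gamma>) (int n)"
  note D = derivation_simps[OF derivation_heis_mode[OF n(2)]] heis_mode_osc[OF n(2)]
  have gen: "lookup (annih \<gamma> (gen \<beta> j)) (- int n) = (- 1 / of_nat n) *\<^sub>C ?D (sym_inc (osc \<beta> j))" for \<beta> j
    using n(2) by (auto simp: annih_simps D lookup_single when_def cform_simps scaleC_simps simp del: of_nat_Suc)
  have "lookup (annih \<gamma> (lconst u)) (- int n) = (- 1 / of_nat n) *\<^sub>C ?D u"
  proof (induction u rule: heis_induct)
    case (mult \<alpha> j s)
    have "annih \<gamma> (lconst (sym_inc (osc \<alpha> j) * s)) =
      annih \<gamma> (gen \<alpha> j) * lconst s + annih \<gamma> (lconst s) * gen \<alpha> j"
      using derivation_mult[OF derivation_annih, of \<gamma> "gen \<alpha> j" "lconst s"] by (simp add: mult_single mult.commute)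
    then show ?case
      by (simp only: lookup_add lookup_mult_lconst gen mult D(6) scaleC_add_right scaleC_mult)
        (simp add: mult.commute)
  qed (simp_all add: annih_simps D single_add lookup_add scaleC_simps mult.commute flip: scaleC_single)
  then show ?thesis using True by (simp add: n)
next
  case False
  have "lookup (annih \<gamma> (lconst u)) k = 0"
  proof (induction u rule: heis_induct)
    case (mult \<alpha> j s)
    have "annih \<gamma> (lconst (sym_inc (osc \<alpha> j) * s)) =
      annih \<gamma> (gen \<alpha> j) * lconst s + annih \<gamma> (lconst s) * gen \<alpha> j"
      using derivation_mult[OF derivation_annih, of \<gamma> "gen \<alpha> j" "lconst s"] by (simp add: mult_single mult.commute)
    moreover have "lookup (annih \<gamma> (gen \<alpha> j)) k = 0"
      using False by (auto simp: annih_simps lookup_single when_def scaleC_simps)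
    ultimately show ?case
      by (simp only: lookup_add lookup_mult_lconst mult mult_zero_left add_0_left)
  qed (simp_all add: annih_simps single_add lookup_add scaleC_simps flip: scaleC_single)
  then show ?thesis using False by simp
qed

definition E_exponent :: "'l \<Rightarrow> 'l lattice_alg \<Rightarrow> 'l lattice_alg fls" where
  "E_exponent \<gamma> w = Abs_fls (\<lambda>k.
     if k < 0 then (- 1 / of_int (- k)) *\<^sub>C B_mode form (cplx_inc \<gamma>) (- k) w else 0)"

lemma B_mode_neg:
  assumes "k < 0"
  shows "clinear (B_mode form h (- k))" "B_mode form h (- k) (bas \<beta> u) = bas \<beta> (heis_mode form h (- k) u)"
proof -
  obtain n where n: "k = - int n" "n \<ge> 1"
    using assms by (metis add.inverse_inverse neg_0_less_iff_less zero_less_imp_eq_int less_eq_Suc_le One_nat_def)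
  have eq: "B_mode form h (- k) = B_lift (\<lambda>\<alpha> u. bas \<alpha> (heis_mode form h (- k) u))"
    using assms by (simp add: B_mode_def)
  have "clinear (\<lambda>u. bas \<alpha> (heis_mode form h (- k) u))" for \<alpha>
    unfolding n(1) minus_minus
    by (rule clinear_compose[OF cbilinear_right[OF cbilinear_tens] derivation_clinear[OF derivation_heis_mode[OF n(2)]]])
  note * = B_lift[of "\<lambda>\<alpha> u. bas \<alpha> (heis_mode form h (- k) u)", OF this]
  show "clinear (B_mode form h (- k))" "B_mode form h (- k) (bas \<beta> u) = bas \<beta> (heis_mode form h (- k) u)"
    unfolding eq by (rule *)+
qed

lemma E_exponent_bas: "E_exponent \<gamma> (bas \<beta> u) = laurent_fls \<beta> (annih \<gamma> (lconst u))"
proof -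
  have "(\<lambda>k. if k < 0 then (- 1 / of_int (- k)) *\<^sub>C B_mode form (cplx_inc \<gamma>) (- k) (bas \<beta> u) else 0) =
     (\<lambda>k. bas \<beta> (lookup (annih \<gamma> (lconst u)) k))"
    by (auto simp: fun_eq_iff annih_eq_modes B_mode_neg(2) tens_simps)
  then show ?thesis by (simp only: E_exponent_def laurent_fls_def)
qed

text \<open>\<open>Abs_fls\<close> returns the given coefficients only if almost all of those at
  negative exponents vanish. Finiteness is therefore proved for the bare coefficient function
  \<open>f\<close> before any coefficient of the series is read off.\<close>

lemma finite_additive_E_exponent: "finite_additive (E_exponent \<gamma>)"
proof -
  define f where "f w k = (if k < 0 then (- 1 / of_int (- k)) *\<^sub>C B_mode form (cplx_inc \<gamma>) (- k) w else 0)"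
    for w k
  have f_add: "f (v + w) k = f v k + f w k" for v w k
    by (simp add: f_def clinear_simps[OF B_mode_neg(1)] scaleC_add_right)
  have fin: "finite {k. f w k \<noteq> 0}" for w
  proof (induction w rule: lattice_alg_induct)
    case (add v w)
    show ?case
      by (rule finite_subset[OF _ finite_UnI[OF add]]) (use f_add[of v w] in auto)
  next
    case (bas \<beta> u)
    have "f (bas \<beta> u) = (\<lambda>k. bas \<beta> (lookup (annih \<gamma> (lconst u)) k))"
      by (auto simp: f_def fun_eq_iff annih_eq_modes B_mode_neg(2) tens_simps)
    moreover have "finite {k. bas \<beta> (lookup (annih \<gamma> (lconst u)) k) \<noteq> 0}"
      using fls_finite_laurent_fls[of \<beta> "annih \<gamma> (lconst u)"] by (simp add: fls_finite_def)
    ultimately show ?case by simp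
  qed
  have nth: "E_exponent \<gamma> w $$ k = f w k" for w k
    unfolding E_exponent_def f_def[symmetric] by (rule nth_Abs_fls_finite[OF fin])
  show ?thesis
    unfolding finite_additive_def fls_finite_def fls_eq_iff fls_plus_nth nth
    by (intro conjI allI f_add fin)
qed

definition vert_Y :: "'l \<Rightarrow> 'l lattice_alg \<Rightarrow> 'l lattice_alg fls" where
  "vert_Y \<gamma> = B_lift (\<lambda>\<beta> u. laurent_fls \<beta> (vert \<gamma> (lconst u)))"

lemma vert_Y: "clinear (vert_Y \<gamma>)" "vert_Y \<gamma> (bas \<beta> u) = laurent_fls \<beta> (vert \<gamma> (lconst u))"
proof -
  have "clinear (\<lambda>u. laurent_fls \<beta> (vert \<gamma> (lconst u)))" for \<beta>
    by (rule clinear_compose[OF clinear_laurent_fls clinear_compose[OF clinear_vert clinear_single]])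
  from B_lift[of "\<lambda>\<beta> u. laurent_fls \<beta> (vert \<gamma> (lconst u))", OF this]
  show "clinear (vert_Y \<gamma>)" "vert_Y \<gamma> (bas \<beta> u) = laurent_fls \<beta> (vert \<gamma> (lconst u))"
    by (simp_all add: vert_Y_def)
qed

lemma finite_additive_fls_const: "finite_additive fls_const"
  by (auto simp: finite_additive_def fls_finite_def fls_plus_const)

text \<open>On a component the k-th term of the exponential series is the divided power
  \<open>dpow (annih \<gamma>) k\<close>. Splitting the series over a sum of vectors requires finite
  support for every vector, so \<open>fin\<close> is proved separately.\<close>

lemma E_plus_neg_eq: "E_plus_neg form \<gamma> w = vert_Y \<gamma> w"
proof -
  let ?A = "\<lambda>k. (op_comp (E_exponent \<gamma>) ^^ k) fls_const"
  have fa: "finite_additive (?A k)" for k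
    by (induction k) (simp_all add: finite_additive_fls_const finite_additive_op_comp[OF finite_additive_E_exponent])
  have A_bas: "?A k (bas \<beta> u) = laurent_fls \<beta> ((annih \<gamma> ^^ k) (lconst u))" for k \<beta> u
  proof (induction k)
    case 0
    show ?case by (auto simp: fls_eq_iff lookup_single when_def tens_simps)
  next
    case (Suc k)
    show ?case
      using op_comp_laurent_fls[where A = "E_exponent \<gamma>" and B = "?A k" and a = "annih \<gamma>",
          OF finite_additive_E_exponent E_exponent_bas clinear_annih annih_xpow_mult Suc]
      by simp
  qed
  have E: "E_plus_neg form \<gamma> w = Sum_any (\<lambda>k. (1 / fact k) *\<^sub>C ?A k w)" for w
    by (simp add: E_plus_neg_def op_exp_def E_exponent_def[abs_def])
  have A_dpow: "(1 / fact k) *\<^sub>C ?A k (bas \<beta> u) = laurent_fls \<beta> (dpow (annih \<gamma>) k (lconst u))" for k \<beta> u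
    by (simp add: A_bas dpow_def clinear_scale[OF clinear_laurent_fls])
  have nil: "\<exists>N. \<forall>k\<ge>N. dpow (annih \<gamma>) k p = 0" for p
  proof -
    obtain N where N: "\<And>M. N \<le> M \<Longrightarrow> vert \<gamma> p = (\<Sum>k<M. dpow (annih \<gamma>) k p)"
      using vert_eq_exp by blast
    have "dpow (annih \<gamma>) k p = 0" if "N \<le> k" for k
      using N[of k] N[of "Suc k"] that by simp
    then show ?thesis by blast
  qed
  have fin: "finite {k. (1 / fact k) *\<^sub>C ?A k w \<noteq> 0}" for w
  proof (induction w rule: lattice_alg_induct)
    case (add v w)
    have "?A k (v + w) = ?A k v + ?A k w" for k using fa by (simp add: finite_additive_def)
    then show ?case
      by (intro finite_subset[OF _ finite_UnI[OF add]]) (auto simp: scaleC_add_right)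
  next
    case (bas \<beta> u)
    obtain N where N: "\<And>k. N \<le> k \<Longrightarrow> dpow (annih \<gamma>) k (lconst u) = 0" using nil by blast
    have "{k. laurent_fls \<beta> (dpow (annih \<gamma>) k (lconst u)) \<noteq> 0} \<subseteq> {..<N}"
    proof
      fix k assume "k \<in> {k. laurent_fls \<beta> (dpow (annih \<gamma>) k (lconst u)) \<noteq> 0}"
      then have "\<not> N \<le> k" using N[of k] by (auto simp: clinear_zero[OF clinear_laurent_fls])
      then show "k \<in> {..<N}" by simp
    qed
    then show ?case unfolding A_dpow by (rule finite_subset) simp
  qed
  show ?thesis
  proof (induction w rule: lattice_alg_induct)
    case (add v w)
    have "?A k (v + w) = ?A k v + ?A k w" for k using fa by (simp add: finite_additive_def)
    then have "E_plus_neg form \<gamma> (v + w) = Sum_any (\<lambda>k. (1 / fact k) *\<^sub>C ?A k v + (1 / fact k) *\<^sub>C ?A k w)"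
      by (simp only: E scaleC_add_right)
    also have "\<dots> = E_plus_neg form \<gamma> v + E_plus_neg form \<gamma> w"
      unfolding E by (rule Sum_any.distrib[OF fin fin])
    finally show ?case by (simp add: add clinear_simps[OF vert_Y(1)])
  next
    case (bas \<beta> u)
    obtain N where N: "\<And>M. N \<le> M \<Longrightarrow> vert \<gamma> (lconst u) = (\<Sum>k<M. dpow (annih \<gamma>) k (lconst u))"
      using vert_eq_exp by blast
    obtain N' where N': "\<And>k. N' \<le> k \<Longrightarrow> dpow (annih \<gamma>) k (lconst u) = 0" using nil by blast
    have "E_plus_neg form \<gamma> (bas \<beta> u) = Sum_any (\<lambda>k. laurent_fls \<beta> (dpow (annih \<gamma>) k (lconst u)))"
      unfolding E A_dpow ..
    also have "\<dots> = (\<Sum>k<max N N'. laurent_fls \<beta> (dpow (annih \<gamma>) k (lconst u)))"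
      by (rule Sum_any_finite) (auto simp: N' clinear_zero[OF clinear_laurent_fls])
    also have "\<dots> = laurent_fls \<beta> (vert \<gamma> (lconst u))"
      using N[of "max N N'"] by (simp add: clinear_sum[OF clinear_laurent_fls])
    finally show ?case by (simp add: vert_Y)
  qed
qed

text \<open>The power of x produced by the zero mode passes through \<open>vert \<gamma>\<close> by
  x-linearity, which leaves the operator \<open>group_op\<close> of the group-like element.\<close>

lemma E_x_operator_eq: "E_x_operator form \<gamma> = BL_Y (bas \<gamma> 1)"
proof
  fix w
  let ?X = "x_pow_zero_mode form \<gamma>"
  have "clinear (\<lambda>u. fls_shift (- form \<gamma> \<beta>) (fls_const (bas \<beta> u)))" for \<beta>
    by (rule clinearI) (auto simp: fls_eq_iff tens_simps scaleC_simps)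
  note X = B_lift[of "\<lambda>\<beta> u. fls_shift (- form \<gamma> \<beta>) (fls_const (bas \<beta> u))", OF this, folded x_pow_zero_mode_def]
  have X_bas: "?X (bas \<beta> u) = laurent_fls \<beta> (xpow (form \<gamma> \<beta>) * lconst u)" for \<beta> u
    by (auto simp: X(2) fls_eq_iff mult_single lookup_single when_def tens_simps)
  have X_fin: "finite_additive ?X"
  proof -
    have "fls_finite (?X w)" for w
      by (induction w rule: lattice_alg_induct)
        (simp_all add: clinear_simps[OF X(1)] fls_finite_add X_bas fls_finite_laurent_fls)
    then show ?thesis by (simp add: finite_additive_def clinear_simps[OF X(1)])
  qed
  have V_fin: "finite_additive (vert_Y \<gamma>)"
  proof -
    have "fls_finite (vert_Y \<gamma> w)" for w
      by (induction w rule: lattice_alg_induct)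
        (simp_all add: clinear_simps[OF vert_Y(1)] fls_finite_add vert_Y(2) fls_finite_laurent_fls)
    then show ?thesis by (simp add: finite_additive_def clinear_simps[OF vert_Y(1)])
  qed
  have E: "E_x_operator form \<gamma> = op_comp (vert_Y \<gamma>) ?X"
    unfolding E_x_operator_def ext[of "E_plus_neg form \<gamma>" "vert_Y \<gamma>", OF E_plus_neg_eq] ..
  have add: "E_x_operator form \<gamma> (v + w) = E_x_operator form \<gamma> v + E_x_operator form \<gamma> w" for v w
    using finite_additive_op_comp[OF V_fin X_fin] by (simp add: E finite_additive_def)
  show "E_x_operator form \<gamma> w = BL_Y (bas \<gamma> 1) w"
  proof (induction w rule: lattice_alg_induct)
    case (bas \<beta> u)
    have "E_x_operator form \<gamma> (bas \<beta> u) = laurent_fls \<beta> (vert \<gamma> (xpow (form \<gamma> \<beta>) * lconst u))"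
      unfolding E
      by (rule op_comp_laurent_fls[where a = "vert \<gamma>"])
        (simp_all add: V_fin vert_Y clinear_vert vert_mult vert_xpow X_bas)
    then show ?case
      by (simp only: BL_Y_lift(2) BL_op_group group_op_def vert_mult vert_xpow)
  qed (simp only: add BL_Y_simps)
qed

end

section \<open>Compatibility with products\<close>

text \<open>A Laurent polynomial is a finite sum of monomials; its support is enumerated by natural
  numbers because the definition of \<open>tensor_laurent\<close> indexes its terms that
  way.\<close>

lemma fls_finite_tensor_laurent:
  assumes "fls_finite F"
  shows "F \<in> tensor_laurent"
proof -
  let ?K = "{n. F $$ n \<noteq> 0}"
  obtain h where h: "bij_betw h {0..<card ?K} ?K"
    using ex_bij_betw_nat_finite assms by (auto simp: fls_finite_def)
  have "F $$ n = (\<Sum>i<card ?K. (fls_shift (- h i) (1 :: complex fls) $$ n) *\<^sub>C (F $$ h i))" for n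
  proof -
    have "(\<Sum>i<card ?K. (fls_shift (- h i) (1 :: complex fls) $$ n) *\<^sub>C (F $$ h i)) =
        (\<Sum>i\<in>{0..<card ?K}. (\<lambda>k. if n = k then F $$ k else 0) (h i))"
      by (rule sum.cong) (auto simp: scaleC_simps)
    also have "\<dots> = (\<Sum>k\<in>?K. if n = k then F $$ k else 0)"
      by (rule sum.reindex_bij_betw[OF h])
    also have "\<dots> = F $$ n"
      using assms by (simp add: fls_finite_def)
    finally show ?thesis by simp
  qed
  then show ?thesis
    unfolding tensor_laurent_def
    by (intro CollectI exI[of _ "card ?K"] exI[of _ "\<lambda>i. F $$ h i"] exI[of _ "\<lambda>i. fls_shift (- h i) 1"] allI)
qed

lemma tensor_lift_add_fun:
  assumes f: "cbilinear f" and g: "cbilinear g"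
  shows "tensor_lift (\<lambda>a b. f a b + g a b) t = tensor_lift f t + tensor_lift g t"
proof -
  have fg: "cbilinear (\<lambda>a b. f a b + g a b)"
    by (rule cbilinearI) (simp_all add: cbilinear_simps[OF f] cbilinear_simps[OF g] scaleC_add_right)
  show ?thesis
    by (induction t rule: tensor_induct)
      (simp_all add: tensor_lift_tens[OF fg] tensor_lift_tens[OF f] tensor_lift_tens[OF g]
        clinear_add[OF clinear_tensor_lift[OF fg]] clinear_add[OF clinear_tensor_lift[OF f]]
        clinear_add[OF clinear_tensor_lift[OF g]])
qed

lemma tensor_lift_zero: "tensor_lift (\<lambda>_ _. 0) t = (0 :: 'c::complex_vector)"
proof -
  have "clinear (\<lambda>_ :: ('a, 'b) tensor. 0 :: 'c)" by (rule clinearI) (simp_all add: scaleC_simps)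
  from tensor_lift_unique[OF this] show ?thesis by simp
qed

section \<open>Coefficients of Y(f(x_1-x_2),x_2)g(x_1)\<close>

context differential_algebra
begin

lemma twisted_coeff_neg: "b < 0 \<Longrightarrow> twisted_coeff Y f g a b = 0"
  unfolding twisted_coeff_def by (simp add: Y_neg scaleC_simps split_beta)

lemma twisted_coeff_sum:
  assumes S: "finite S" "\<And>n. f $$ n \<noteq> 0 \<Longrightarrow> n \<in> S"
  shows "twisted_coeff Y f g a (int N) =
    (\<Sum>n\<in>S. \<Sum>k\<le>N. ((-1) ^ k * (of_int n gchoose k)) *\<^sub>C mul (dpow D (N - k) (f $$ n)) (g $$ (a - (n - int k))))"
proof -
  let ?f = "\<lambda>(n::int, k::nat). ((-1) ^ k * (of_int n gchoose k)) *\<^sub>C (Y (f $$ n) (g $$ (a - (n - int k))) $$ (int N - int k))"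
  have "twisted_coeff Y f g a (int N) = sum ?f (S \<times> {..N})"
    unfolding twisted_coeff_def
  proof (rule Sum_any_finite)
    fix x assume "x \<notin> S \<times> {..N}"
    then obtain n k where x: "x = (n, k)" "f $$ n = 0 \<or> N < k" using S(2) by (cases x) auto
    then show "?f x = 0" by (auto simp: Y_neg cbilinear_simps[OF cbilinear_Y] scaleC_simps)
  qed (use S in simp)
  also have "\<dots> = (\<Sum>n\<in>S. \<Sum>k\<le>N. ?f (n, k))"
    by (simp add: sum.cartesian_product)
  also have "\<dots> = (\<Sum>n\<in>S. \<Sum>k\<le>N. ((-1) ^ k * (of_int n gchoose k)) *\<^sub>C mul (dpow D (N - k) (f $$ n)) (g $$ (a - (n - int k))))"
  proof (intro sum.cong refl)
    fix n k assume "k \<in> {..N}"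
    then have "Y u v $$ (int N - int k) = mul (dpow D (N - k) u) v" for u v
      using Y_nat[of u v "N - k"] by (simp add: of_nat_diff)
    then show "?f (n, k) = ((-1) ^ k * (of_int n gchoose k)) *\<^sub>C mul (dpow D (N - k) (f $$ n)) (g $$ (a - (n - int k)))"
      by simp
  qed
  finally show ?thesis .
qed

text \<open>A common finite set containing both supports serves as index set on all sides, so the
  identities hold term by term.\<close>

lemma twisted_coeff_linear:
  assumes f: "fls_finite f" and f': "fls_finite f'"
  shows twisted_coeff_add_left: "twisted_coeff Y (f + f') g a b = twisted_coeff Y f g a b + twisted_coeff Y f' g a b"
    and twisted_coeff_add_right: "twisted_coeff Y f (g + g') a b = twisted_coeff Y f g a b + twisted_coeff Y f g' a b"
    and twisted_coeff_scale_left: "twisted_coeff Y (c *\<^sub>C f) g a b = c *\<^sub>C twisted_coeff Y f g a b"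
    and twisted_coeff_scale_right: "twisted_coeff Y f (c *\<^sub>C g) a b = c *\<^sub>C twisted_coeff Y f g a b"
proof -
  let ?S = "{n. f $$ n \<noteq> 0} \<union> {n. f' $$ n \<noteq> 0}"
  have S: "finite ?S" using f f' by (simp add: fls_finite_def)
  note tw = twisted_coeff_sum[OF S]
  have "twisted_coeff Y (f + f') g a (int N) = twisted_coeff Y f g a (int N) + twisted_coeff Y f' g a (int N)"
    "twisted_coeff Y f (g + g') a (int N) = twisted_coeff Y f g a (int N) + twisted_coeff Y f g' a (int N)"
    "twisted_coeff Y (c *\<^sub>C f) g a (int N) = c *\<^sub>C twisted_coeff Y f g a (int N)"
    "twisted_coeff Y f (c *\<^sub>C g) a (int N) = c *\<^sub>C twisted_coeff Y f g a (int N)" for N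
    by (subst tw, force simp: scaleC_simps, (subst tw, force)+,
      simp add: clinear_simps[OF clinear_dpow[OF lin]] mul_simps scaleC_add_right sum.distrib
        complex_vector.scale_sum_right scaleC_scaleC mult.commute)+
  then show "twisted_coeff Y (f + f') g a b = twisted_coeff Y f g a b + twisted_coeff Y f' g a b"
    "twisted_coeff Y f (g + g') a b = twisted_coeff Y f g a b + twisted_coeff Y f g' a b"
    "twisted_coeff Y (c *\<^sub>C f) g a b = c *\<^sub>C twisted_coeff Y f g a b"
    "twisted_coeff Y f (c *\<^sub>C g) a b = c *\<^sub>C twisted_coeff Y f g a b"
    by (cases "b < 0"; simp add: twisted_coeff_neg scaleC_simps; metis nat_0_le not_less)+
qed

end

text \<open>These are the coefficients of (x_1-x_2)^n, obtained by applying the exponential of -x_2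
  d/dx_1 to x_1^n.\<close>

lemma dpow_neg_ddx_xpow:
  "dpow (\<lambda>p :: int \<Rightarrow>\<^sub>0 complex. - ddx p) k (xpow n) = ((-1) ^ k * (of_int n gchoose k)) *\<^sub>C xpow (n - int k)"
proof (induction k)
  case 0
  show ?case by (simp add: scaleC_one)
next
  case (Suc k)
  have lin: "clinear (\<lambda>p :: int \<Rightarrow>\<^sub>0 complex. - ddx p)"
    by (rule clinearI) (simp_all add: clinear_simps[OF clinear_ddx] scaleC_simps)
  have "of_nat (Suc k) *\<^sub>C dpow (\<lambda>p :: int \<Rightarrow>\<^sub>0 complex. - ddx p) (Suc k) (xpow n) =
    ((-1) ^ Suc k * ((of_int n gchoose k) * (of_int n - of_nat k))) *\<^sub>C xpow (n - int k - 1)"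
    unfolding D_dpow[OF lin, symmetric] Suc
    by (simp add: clinear_simps[OF clinear_ddx] ddx_xpow scaleC_simps mult.assoc)
      (simp add: right_diff_distrib scaleC_simps)
  also have "\<dots> = of_nat (Suc k) *\<^sub>C ((-1) ^ Suc k * (of_int n gchoose Suc k)) *\<^sub>C xpow (n - int (Suc k))"
    unfolding gbinomial_Suc_mult scaleC_scaleC by (simp add: diff_diff_eq mult.left_commute add.commute)
  finally show ?case
    by (simp only: complex_vector.scale_cancel_left of_nat_eq_0_iff nat.distinct simp_thms)
qed

context lattice_form
begin

lemma conn_single:
  "conn \<beta> (single n u) =
    single n (heis_conn \<beta> u) - single (n - 1) (of_int n *\<^sub>C u)"
  by (simp add: conn_def heis_conn_def dtot_def coeff_trans_single ddx_single mult_single single_add)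

text \<open>By the Leibniz rule for a power of x times a coefficient, \<open>conn \<beta>\<close>
  acts as -d/dx on the former and as L(-1) on the latter. Its exponential thus substitutes x_1-x_2
  for x_1 and applies e^(x_2 L(-1)) to the coefficients.\<close>

lemma dpow_conn_single:
  "dpow (conn \<beta>) N (single n u) =
    (\<Sum>k\<le>N. ((-1) ^ k * (of_int n gchoose k)) *\<^sub>C single (n - int k) (dpow (heis_conn \<beta>) (N - k) u))"
proof -
  let ?m = "\<lambda>(p :: int \<Rightarrow>\<^sub>0 complex) (u :: 'l heis). pm_lift (\<lambda>n. single n u) p"
  let ?D = "\<lambda>p :: int \<Rightarrow>\<^sub>0 complex. - ddx p"
  have m: "cbilinear ?m"
    unfolding cbilinear_def
    by (intro conjI allI clinear_pm_lift clinear_pm_lift_fun clinear_single)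
  have lin: "clinear ?D"
    by (rule clinearI) (simp_all add: clinear_simps[OF clinear_ddx] scaleC_simps)
  have der: "conn \<beta> (?m p u) = ?m (?D p) u + ?m p (heis_conn \<beta> u)" for p u
  proof (rule clinear_pm_eqI[where f = "\<lambda>p. conn \<beta> (?m p u)" and g = "\<lambda>p. ?m (?D p) u + ?m p (heis_conn \<beta> u)"])
    show "clinear (\<lambda>p. conn \<beta> (?m p u))"
      by (rule clinear_compose[OF clinear_conn clinear_pm_lift])
    show "clinear (\<lambda>p. ?m (?D p) u + ?m p (heis_conn \<beta> u))"
      by (rule clinearI)
        (simp_all only: clinear_simps[OF lin] clinear_simps[OF clinear_pm_lift] scaleC_add_right add_ac)
    show "conn \<beta> (?m (xpow k) u) = ?m (?D (xpow k)) u + ?m (xpow k) (heis_conn \<beta> u)" for k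
      by (simp add: conn_single ddx_single clinear_simps[OF clinear_pm_lift] scaleC_one scaleC_single scaleC_complex_def
          del: single_one)
  qed
  have "dpow (conn \<beta>) N (?m (xpow n) u) =
    (\<Sum>k\<le>N. ?m (dpow ?D k (xpow n)) (dpow (heis_conn \<beta>) (N - k) u))"
    by (rule dpow_leibniz[OF m lin clinear_heis_conn clinear_conn der])
  then show ?thesis
    by (simp add: dpow_neg_ddx_xpow clinear_simps[OF clinear_pm_lift] scaleC_one del: single_one)
qed

lemma dpow_B_trans_bas: "dpow B_trans n (bas \<beta> u) = bas \<beta> (dpow (heis_conn \<beta>) n u)"
  by (rule dpow_commute[symmetric, OF cbilinear_right[OF cbilinear_tens]]) (simp add: B_trans_bas)

text \<open>Y(f(x_1-x_2),x_2) is multiplication by e^(x_2 L(-1))f(x_1-x_2), and this is the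
  exponential of \<open>conn \<beta>\<close> applied to f; the coefficient of x_2^N is its N-th
  divided power.\<close>

lemma twisted_coeff_laurent_fls:
  assumes "normalized_cocycle eps"
  shows "twisted_coeff (B_Y eps) (laurent_fls \<beta> F) (laurent_fls \<beta>' G) a (int N) =
    eps \<beta> \<beta>' *\<^sub>C bas (\<beta> + \<beta>') (lookup (dpow (conn \<beta>) N F * G) a)"
proof -
  interpret E: differential_algebra "B_mult eps" B_one B_trans
    by (rule differential_algebra_B[OF assms])
  have "twisted_coeff (B_Y eps) (laurent_fls \<beta> F) (laurent_fls \<beta>' G) a (int N) =
    (\<Sum>n\<in>keys F. \<Sum>k\<le>N. ((-1) ^ k * (of_int n gchoose k)) *\<^sub>C
      eps \<beta> \<beta>' *\<^sub>C bas (\<beta> + \<beta>') (dpow (heis_conn \<beta>) (N - k) (lookup F n) * lookup G (a - (n - int k))))"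
    unfolding B_Y_def
    by (subst E.twisted_coeff_sum[of "keys F"])
      (auto simp: in_keys_iff tens_simps dpow_B_trans_bas B_mult_bas)
  moreover have "dpow (conn \<beta>) N F * G =
    (\<Sum>n\<in>keys F. \<Sum>k\<le>N. ((-1) ^ k * (of_int n gchoose k)) *\<^sub>C
      (single (n - int k) (dpow (heis_conn \<beta>) (N - k) (lookup F n)) * G))"
    by (subst pm_sum_single[of F])
      (simp add: clinear_sum[OF clinear_dpow[OF clinear_conn]] dpow_conn_single sum_distrib_right scaleC_mult_left)
  ultimately show ?thesis
    by (simp add: lookup_sum lookup_single_mult tens_simps complex_vector.scale_sum_right scaleC_scaleC
        mult.commute[of _ "eps \<beta> \<beta>'"])
qed

lemma fls_finite_BL_Y: "fls_finite (BL_Y h v)"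
  by (induction v rule: lattice_alg_induct)
    (simp_all add: BL_Y_simps fls_finite_add fls_finite_laurent_fls)

lemma BL_Y_vac: "BL_Y h B_one = fls_const (BL_counit h *\<^sub>C B_one)"
  unfolding B_one_def BL_Y_lift(2) single_one BL_op_vac
  by (auto simp: fls_eq_iff lookup_one when_def tens_simps scaleC_simps)

lemma cbilinear_twisted:
  assumes "normalized_cocycle eps"
  shows "cbilinear (\<lambda>h1 h2. twisted_coeff (B_Y eps) (BL_Y h1 u) (BL_Y h2 v) a b)"
proof -
  interpret E: differential_algebra "B_mult eps" B_one B_trans
    by (rule differential_algebra_B[OF assms])
  note tw = E.twisted_coeff_linear[OF fls_finite_BL_Y fls_finite_BL_Y, folded B_Y_def]
  show ?thesis
    by (rule cbilinearI) (simp_all only: cbilinear_simps[OF cbilinear_BL_Y] tw)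
qed

text \<open>Only the product formula \<open>BL_op_comult\<close> and the commutation with
  \<open>conn\<close> enter: the former splits the action over the product, the latter exchanges it
  with the divided powers of L(-1) applied to \<open>u\<close>.\<close>

lemma BL_Y_B_Y:
  assumes eps: "normalized_cocycle eps"
  shows "BL_Y h (B_Y eps u v $$ b) $$ a =
    tensor_lift (\<lambda>h1 h2. twisted_coeff (B_Y eps) (BL_Y h1 u) (BL_Y h2 v) a b) (BL_comult h)"
proof -
  interpret E: differential_algebra "B_mult eps" B_one B_trans
    by (rule differential_algebra_B[OF assms])
  note tw = E.twisted_coeff_linear[OF fls_finite_BL_Y fls_finite_BL_Y, folded B_Y_def]
  note Y = cbilinear_simps[OF E.cbilinear_Y, folded B_Y_def]
  show ?thesis
  proof (cases "b < 0")
    case True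
    then show ?thesis
      by (simp add: B_Y_def E.Y_neg E.twisted_coeff_neg cbilinear_simps[OF cbilinear_BL_Y] tensor_lift_zero)
  next
    case False
    then obtain N where b: "b = int N" by (metis nat_0_le not_less)
    show ?thesis
    proof (induction u rule: lattice_alg_induct)
      case (add u u')
      then show ?case
        by (simp add: Y cbilinear_simps[OF cbilinear_BL_Y] tw tensor_lift_add_fun[OF cbilinear_twisted cbilinear_twisted, OF eps eps])
    next
      case (bas \<beta> u)
      show ?case
      proof (induction v rule: lattice_alg_induct)
        case (add v v')
        then show ?case
          by (simp add: Y cbilinear_simps[OF cbilinear_BL_Y] tw tensor_lift_add_fun[OF cbilinear_twisted cbilinear_twisted, OF eps eps])
      next
        case (bas \<beta>' w)
        let ?g = "\<lambda>q. eps \<beta> \<beta>' *\<^sub>C bas (\<beta> + \<beta>') (lookup q a)"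
        have g: "clinear ?g"
          by (rule clinearI) (simp_all add: lookup_add tens_simps scaleC_simps mult.commute)
        have bil: "cbilinear (\<lambda>h1 h2. BL_op \<beta> h1 p * BL_op \<beta>' h2 q)" for p q
          by (rule cbilinearI) (simp_all add: BL_op_simps algebra_simps scaleC_mult)
        \<comment> \<open>On constants d/dx is zero, so \<open>conn \<beta>\<close> restricts to
          \<open>heis_conn \<beta>\<close>; its divided powers then pass through the action.\<close>
        have dp: "dpow (conn \<beta>) N (BL_op \<beta> h1 (lconst u)) = BL_op \<beta> h1 (lconst (dpow (heis_conn \<beta>) N u))" for h1
        proof -
          have "lconst (dpow (heis_conn \<beta>) N u) = dpow (conn \<beta>) N (lconst u)"
            by (rule dpow_commute[OF clinear_single]) (simp add: conn_single complex_vector.scale_zero_left)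
          then show ?thesis
            using dpow_commute[of "BL_op \<beta> h1" "conn \<beta>" "conn \<beta>", OF cbilinear_right[OF cbilinear_BL_op] conn_BL_op[symmetric]]
            by simp
        qed
        have "BL_Y h (B_Y eps (bas \<beta> u) (bas \<beta>' w) $$ b) $$ a =
          ?g (BL_op (\<beta> + \<beta>') h (lconst (dpow (heis_conn \<beta>) N u) * lconst w))"
          by (simp add: b B_Y_def E.Y_nat dpow_B_trans_bas B_mult_bas BL_Y_simps mult_single)
        also have "\<dots> = tensor_lift (\<lambda>h1 h2. ?g (BL_op \<beta> h1 (lconst (dpow (heis_conn \<beta>) N u)) * BL_op \<beta>' h2 (lconst w))) (BL_comult h)"
          unfolding BL_op_comult by (rule clinear_comp_tensor_lift[OF bil g])
        also have "\<dots> = tensor_lift (\<lambda>h1 h2. twisted_coeff (B_Y eps) (BL_Y h1 (bas \<beta> u)) (BL_Y h2 (bas \<beta>' w)) a b) (BL_comult h)"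
          by (simp only: BL_Y_lift(2) b twisted_coeff_laurent_fls[OF eps] dp)
        finally show ?case .
      qed
    qed
  qed
qed

lemma BL_Y_module_nonlocal_vertex_algebra:
  assumes eps: "normalized_cocycle eps"
  shows "module_nonlocal_vertex_algebra (B_Y trivial_cocycle) B_one BL_comult BL_counit (B_Y eps) B_one BL_Y"
proof -
  interpret E: differential_algebra "B_mult eps" B_one B_trans
    by (rule differential_algebra_B[OF assms])
  show ?thesis
    by (intro module_nonlocal_vertex_algebra.intro module_nonlocal_vertex_algebra_axioms.intro
        BL_vertex_bialgebra BL_Y_module E.nonlocal_vertex_algebra[folded B_Y_def]
        fls_finite_tensor_laurent fls_finite_BL_Y BL_Y_vac BL_Y_B_Y eps)
qed

text \<open>For a group-like element the Sweedler sum has one term and the counit is 1, so the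
  module compatibilities specialise to the defining conditions.\<close>

lemma E_x_operator_PEnd_minus:
  assumes eps: "normalized_cocycle eps"
  shows "E_x_operator form \<gamma> \<in> PEnd_minus (B_Y eps) B_one"
  unfolding PEnd_minus_def E_x_operator_eq
proof (intro CollectI conjI allI)
  show "clinear (BL_Y (bas \<gamma> 1))" by (rule BL_Y_lift(1))
  show "range (BL_Y (bas \<gamma> 1)) \<subseteq> tensor_laurent"
    using fls_finite_tensor_laurent[OF fls_finite_BL_Y] by blast
  show "BL_Y (bas \<gamma> 1) B_one = fls_const B_one"
    by (simp add: BL_Y_vac BL_counit_group scaleC_one)
  fix v w a b
  show "BL_Y (bas \<gamma> 1) (B_Y eps v w $$ b) $$ a = twisted_coeff (B_Y eps) (BL_Y (bas \<gamma> 1) v) (BL_Y (bas \<gamma> 1) w) a b"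
    unfolding BL_Y_B_Y[OF eps] BL_comult_group by (rule tensor_lift_tens[OF cbilinear_twisted[OF eps]])
qed

end

section \<open>Uniqueness of the module structure\<close>

lemma nonlocal_va_module_agree:
  assumes M: "nonlocal_va_module Y vac YW" and M': "nonlocal_va_module Y vac YW'"
    and neg: "\<And>n. n < 0 \<Longrightarrow> Y u v $$ n = 0"
    and u: "YW u = YW' u" and v: "YW v = YW' v"
  shows "YW (Y u v $$ n) = YW' (Y u v $$ n)"
proof (intro ext fls_eqI)
  interpret M: nonlocal_va_module Y vac YW by fact
  interpret M': nonlocal_va_module Y vac YW' by fact
  fix w b
  have z: "YW 0 w $$ b = 0" "YW' 0 w $$ b = 0" for b
    by (simp_all add: cbilinear_simps[OF M.YW_bilinear] cbilinear_simps[OF M'.YW_bilinear])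
  \<comment> \<open>The shifted series involve only the operators of \<open>u\<close> and of
    \<open>v\<close>, on which the two structures agree.\<close>
  have sh: "iterate_shifted YW u v w = iterate_shifted YW' u v w"
    by (intro ext) (simp add: iterate_shifted_def u v)
  obtain l l' where
    l: "mult_sum_power l (iterate_shifted YW u v w) = mult_sum_power l (iterate_nested Y YW u v w)" and
    l': "mult_sum_power l' (iterate_shifted YW' u v w) = mult_sum_power l' (iterate_nested Y YW' u v w)"
    using M.YW_weak_assoc M'.YW_weak_assoc by blast
  have "mult_sum_power (max l l') (iterate_nested Y YW u v w) = mult_sum_power (max l l') (iterate_nested Y YW' u v w)"
    using mult_sum_power_mono[OF l, of "max l l'"] mult_sum_power_mono[OF l', of "max l l'"] sh by simp
  \<comment> \<open>The hypothesis \<open>neg\<close> excludes negative powers of x_0, so the common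
    power of x_0+x_2 can be cancelled.\<close>
  then have "iterate_nested Y YW u v w n b = iterate_nested Y YW' u v w n b"
    by (rule mult_sum_power_cancel) (simp add: iterate_nested_def neg z)
  then show "YW (Y u v $$ n) w $$ b = YW' (Y u v $$ n) w $$ b"
    by (simp add: iterate_nested_def)
qed

lemma BL_module_unique:
  fixes YW YW' :: "'l::ab_group_add lattice_alg \<Rightarrow> 'w::complex_vector \<Rightarrow> 'w fls"
  assumes M: "nonlocal_va_module (B_Y trivial_cocycle) B_one YW"
    and M': "nonlocal_va_module (B_Y trivial_cocycle) B_one YW'"
    and eq: "\<And>\<alpha>. YW (bas \<alpha> 1) = YW' (bas \<alpha> 1)"
  shows "YW = YW'"
proof
  interpret M: nonlocal_va_module "B_Y trivial_cocycle" B_one YW by fact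
  interpret M': nonlocal_va_module "B_Y trivial_cocycle" B_one YW' by fact
  have agree: "YW (B_Y trivial_cocycle u v $$ n) = YW' (B_Y trivial_cocycle u v $$ n)"
    if "YW u = YW' u" "YW v = YW' v" for u v n
    by (rule nonlocal_va_module_agree[OF M M' _ that]) (simp add: B_Y_def BL.Y_neg)
  \<comment> \<open>The product is the constant term of Y(u,x)v.\<close>
  have mult: "YW (BL_mult u v) = YW' (BL_mult u v)" if "YW u = YW' u" "YW v = YW' v" for u v
    using agree[OF that, of 0] BL.Y_nat[of u v 0] by (simp add: B_Y_def)
  \<comment> \<open>L(-1)u is the coefficient of x in Y(u,x) applied to the vacuum, and the vacuum
    is itself the group-like element for 0.\<close>
  have trans: "YW (B_trans u) = YW' (B_trans u)" if "YW u = YW' u" for u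
    using agree[OF that, of B_one 1] BL.Y_nat[of u B_one 1] eq[of 0, folded B_one_def]
    by (simp add: B_Y_def BL.one_right dpow_def scaleC_one)
  note lin = cbilinear_simps[OF M.YW_bilinear] cbilinear_simps[OF M'.YW_bilinear]
  have scale: "YW (c *\<^sub>C u) = YW' (c *\<^sub>C u)" if "YW u = YW' u" for c u
    using that by (simp add: fun_eq_iff lin)
  have prim: "YW (bas 0 (sym_inc (osc \<alpha> k))) = YW' (bas 0 (sym_inc (osc \<alpha> k)))" for \<alpha> k
  proof (induction k)
    case 0
    have "BL_mult (bas (- \<alpha>) 1) (B_trans (bas \<alpha> 1)) = bas 0 (sym_inc (osc \<alpha> 0))"
      by (simp add: B_trans_group BL_mult_bas)
    then show ?case using mult[OF eq trans[OF eq], of "- \<alpha>" \<alpha>] by simp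
  next
    case (Suc k)
    have "bas 0 (sym_inc (osc \<alpha> (Suc k))) = (1 / of_nat (Suc k)) *\<^sub>C B_trans (bas 0 (sym_inc (osc \<alpha> k)))"
      by (simp add: B_trans_prim scaleC_simps del: of_nat_Suc)
    then show ?case using scale[OF trans[OF Suc]] by simp
  qed
  show "YW h = YW' h" for h
  proof (induction h rule: BL_gen_induct)
    case (add s t)
    then show ?case by (simp add: fun_eq_iff lin)
  qed (rule scale eq prim mult; assumption?)+
qed

theorem proposition5p5:
  fixes form :: "'l::ab_group_add \<Rightarrow> 'l \<Rightarrow> int"
    and eps :: "'l \<Rightarrow> 'l \<Rightarrow> complex"
  assumes "nondegenerate_even_lattice form"
    and "normalized_cocycle eps"
  shows "(\<forall>\<alpha>. E_x_operator form \<alpha> \<in> PEnd_minus (B_Y eps) B_one) \<and>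
    (\<exists>!YM :: 'l lattice_alg \<Rightarrow> 'l lattice_alg \<Rightarrow> 'l lattice_alg fls.
       nonlocal_va_module (B_Y trivial_cocycle) B_one YM \<and>
       (\<forall>\<alpha>. YM (e_basis \<alpha> \<otimes>\<^sub>C 1) = E_x_operator form \<alpha>)) \<and>
    (\<forall>YM :: 'l lattice_alg \<Rightarrow> 'l lattice_alg \<Rightarrow> 'l lattice_alg fls.
       nonlocal_va_module (B_Y trivial_cocycle) B_one YM \<and>
       (\<forall>\<alpha>. YM (e_basis \<alpha> \<otimes>\<^sub>C 1) = E_x_operator form \<alpha>) \<longrightarrow>
       module_nonlocal_vertex_algebra (B_Y trivial_cocycle) B_one BL_comult BL_counit
         (B_Y eps) B_one YM)"
proof -
  interpret lattice_form form
    using assms(1) by unfold_locales (auto simp: nondegenerate_even_lattice_def)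
  have unique: "YM = BL_Y" if "nonlocal_va_module (B_Y trivial_cocycle) B_one YM \<and>
       (\<forall>\<alpha>. YM (bas \<alpha> 1) = E_x_operator form \<alpha>)" for YM
    by (rule BL_module_unique[OF _ BL_Y_module]) (use that in \<open>auto simp: E_x_operator_eq\<close>)
  have "\<exists>!YM. nonlocal_va_module (B_Y trivial_cocycle) B_one YM \<and>
       (\<forall>\<alpha>. YM (bas \<alpha> 1) = E_x_operator form \<alpha>)"
    by (rule ex1I[of _ BL_Y]) (auto simp: BL_Y_module E_x_operator_eq intro!: unique)
  then show ?thesis
    using unique E_x_operator_PEnd_minus[OF assms(2)] BL_Y_module_nonlocal_vertex_algebra[OF assms(2)] by metis
qed

end
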